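(* For every $\varepsilon>0$ there exist $d_0,n_0\in\mathbb{N}$ such that for all even integers $n\geq n_0$ and all integers $d$ with $d_0\le d\le n-1$ the following holds: if $G$ is an $(n,d,\lambda)$-graph with $\lambda\leq d^{1-\varepsilon}$, then $\chi'(G)=d$; equivalently, $G$ admits a $1$-factorization.
   Context: For a $d$-regular graph $G$ on $n$ vertices with adjacency matrix eigenvalues $d=\lambda_1\ge\lambda_2\ge\dots\ge\lambda_n$, let $\lambda(G)=\max\{|\lambda_2|,|\lambda_n|\}$. An $(n,d,\lambda)$-graph is a $d$-regular graph on $n$ vertices with $\lambda(G)\le\lambda$. The chromatic index $\chi'(G)$ is the minimum number of colors in an edge coloring of $G$ in which each color class is a matching. A $1$-factorization of $G$ is a partition of $E(G)$ into perfect matchings; for a $d$-regular graph on an even number of vertices, $\chi'(G)=d$ is equivalent to the existence of a $1$-factorization. *)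

theory Defs
  imports "Jordan_Normal_Form.Char_Poly"
begin

definition simple_graph :: "nat \<Rightarrow> (nat \<Rightarrow> nat \<Rightarrow> bool) \<Rightarrow> bool" where
  "simple_graph n E \<longleftrightarrow>
     (\<forall>u v. E u v \<longrightarrow> u < n \<and> v < n) \<and>
     (\<forall>u v. E u v \<longrightarrow> E v u) \<and>
     (\<forall>u. \<not> E u u)"

definition regular :: "nat \<Rightarrow> (nat \<Rightarrow> nat \<Rightarrow> bool) \<Rightarrow> nat \<Rightarrow> bool" where
  "regular n E d \<longleftrightarrow> (\<forall>v<n. card {u. u < n \<and> E v u} = d)"

definition adj_matrix :: "nat \<Rightarrow> (nat \<Rightarrow> nat \<Rightarrow> bool) \<Rightarrow> real mat" where
  "adj_matrix n E = mat n n (\<lambda>(i, j). if E i j then 1 else 0)"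

text \<open>Eigenvalues of the adjacency matrix with multiplicity, in non-increasing order
  lambda_1 >= ... >= lambda_n: the (unique) non-increasing list of roots of the
  characteristic polynomial (which splits over the reals, the matrix being symmetric).\<close>
definition adj_eigenvalues :: "nat \<Rightarrow> (nat \<Rightarrow> nat \<Rightarrow> bool) \<Rightarrow> real list" where
  "adj_eigenvalues n E = (THE ls. sorted (rev ls) \<and>
      char_poly (adj_matrix n E) = (\<Prod>a\<leftarrow>ls. [:- a, 1:]))"

definition spectral_lambda :: "nat \<Rightarrow> (nat \<Rightarrow> nat \<Rightarrow> bool) \<Rightarrow> real" where
  "spectral_lambda n E = (let ls = adj_eigenvalues n E in max \<bar>ls ! 1\<bar> \<bar>ls ! (n - 1)\<bar>)"

definition nd_lambda_graph :: "nat \<Rightarrow> nat \<Rightarrow> real \<Rightarrow> (nat \<Rightarrow> nat \<Rightarrow> bool) \<Rightarrow> bool" where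
  "nd_lambda_graph n d lam E \<longleftrightarrow> simple_graph n E \<and> regular n E d \<and> spectral_lambda n E \<le> lam"

definition graph_edges :: "nat \<Rightarrow> (nat \<Rightarrow> nat \<Rightarrow> bool) \<Rightarrow> nat set set" where
  "graph_edges n E = {{u, v} | u v. u < n \<and> v < n \<and> E u v}"

definition proper_edge_colouring ::
    "nat \<Rightarrow> (nat \<Rightarrow> nat \<Rightarrow> bool) \<Rightarrow> nat \<Rightarrow> (nat set \<Rightarrow> nat) \<Rightarrow> bool" where
  "proper_edge_colouring n E k c \<longleftrightarrow>
     (\<forall>e\<in>graph_edges n E. c e < k) \<and>
     (\<forall>e\<in>graph_edges n E. \<forall>f\<in>graph_edges n E. e \<noteq> f \<and> e \<inter> f \<noteq> {} \<longrightarrow> c e \<noteq> c f)"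

definition chromatic_index :: "nat \<Rightarrow> (nat \<Rightarrow> nat \<Rightarrow> bool) \<Rightarrow> nat" where
  "chromatic_index n E = (LEAST k. \<exists>c. proper_edge_colouring n E k c)"

end

theory Submission
  imports Defs "HOL-Analysis.L2_Norm" "HOL-Real_Asymp.Real_Asymp"
begin

text \<open>
  Only the upper bound of the expander mixing lemma is used, and only with \<open>\<lambda> \<le> d / 10\<^sup>6\<close>.
  The vertices are halved at random into \<open>A\<close> and \<open>B\<close> of equal size so that every vertex has about
  \<open>d / 2\<close> neighbours on either side. The edges inside the two sides are coloured with slightly more than
  \<open>d / 2\<close> colours, every colour having equally many edges in \<open>A\<close> and in \<open>B\<close>. From each colour class a
  tiny random fraction of pairs (an edge in \<open>A\<close>, an edge in \<open>B\<close>) is dropped. The uncovered vertices then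
  look random, so Hall's condition between their halves follows from the expander mixing lemma, and the
  class extends to a perfect matching by edges between \<open>A\<close> and \<open>B\<close>. Treating the colours in a bounded
  number of batches, with fresh randomness in each, keeps the previously used edges from interfering.
  The dropped edges have tiny degree; they are coloured greedily, split into sparse matchings and
  completed in the same way. What remains is a regular bipartite graph between \<open>A\<close> and \<open>B\<close>, to which
  Koenig's theorem applies. All random choices are made by the Lovasz local lemma, since \<open>d\<close> may be
  bounded while \<open>n\<close> grows.
\<close>

section \<open>Edge colourings and Kempe chains\<close>

text \<open>Koenig's theorem is exact, so it can be kept for the end: if every class removed before
  is a perfect matching, the graph stays regular and no colour is wasted. The obstacle is the set
  left uncovered by a colour class: it is tiny and arbitrary, and nothing forces edges between its
  two halves. After dropping a fraction 1/40000 of the pairs, every vertex sees about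
  \<open>d / 80000\<close> uncovered vertices. About half of these are needed against the density
  term in Hall's condition; the other half must pay for \<lambda> and for cross edges already spent
  on other classes. The bound \<open>d / 10^6\<close> on \<lambda> fits. The second cost dictates
  the batches: a vertex is uncovered in about 1/40000 of the classes, so treating all
  \<open>d / 2\<close> classes at once could spend every edge available, whereas
  \<open>d / 10\<close> classes spend a fifth. Vertices uncovered before the dropping must be
  negligible on this scale, hence the demand for very few colours and for classes of equal size. The
  local lemma controls local counts only; the global sizes needed are recovered from them by double
  counting.\<close>

definition colouring :: "'a set set \<Rightarrow> nat \<Rightarrow> ('a set \<Rightarrow> nat) \<Rightarrow> bool" where
  "colouring E k c \<longleftrightarrow> (\<forall>e\<in>E. c e < k) \<and>
     (\<forall>e\<in>E. \<forall>f\<in>E. e \<noteq> f \<and> e \<inter> f \<noteq> {} \<longrightarrow> c e \<noteq> c f)"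

definition edges :: "'a set set \<Rightarrow> bool" where
  "edges E \<longleftrightarrow> finite E \<and> (\<forall>e\<in>E. card e = 2)"

definition deg :: "'a set set \<Rightarrow> 'a \<Rightarrow> nat" where
  "deg E v = card {e\<in>E. v \<in> e}"

definition matching :: "'a set set \<Rightarrow> bool" where
  "matching M \<longleftrightarrow> (\<forall>e\<in>M. \<forall>f\<in>M. e \<noteq> f \<longrightarrow> e \<inter> f = {})"

lemma edgesD: "edges E \<Longrightarrow> e \<in> E \<Longrightarrow> card e = 2" "edges E \<Longrightarrow> finite E"
  and edges_finite: "edges E \<Longrightarrow> e \<in> E \<Longrightarrow> finite e"
  by (auto simp: edges_def intro: card_ge_0_finite)

lemma edges_subset: "edges E \<Longrightarrow> F \<subseteq> E \<Longrightarrow> edges F"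
  by (auto simp: edges_def intro: finite_subset)

lemma matching_subset: "matching M \<Longrightarrow> N \<subseteq> M \<Longrightarrow> matching N"
  by (auto simp: matching_def)

lemma colouring_class_matching: "colouring E k c \<Longrightarrow> matching {e\<in>E. c e = i}"
  by (auto simp: colouring_def matching_def)

lemma colouring_mono: "colouring E k c \<Longrightarrow> k \<le> l \<Longrightarrow> colouring E l c"
  by (fastforce simp: colouring_def)

lemma card_Union_matching:
  assumes "edges M" "matching M"
  shows "card (\<Union>M) = 2 * card M"
proof -
  have "card (\<Union>M) = sum card M"
    using assms by (intro card_Union_disjoint) (auto simp: matching_def pairwise_def disjnt_def edges_finite)
  also have "\<dots> = 2 * card M" using assms by (simp add: edges_def)
  finally show ?thesis .
qed

lemma deg_matching_le:
  assumes "matching M"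
  shows "deg M v = (if v \<in> \<Union>M then 1 else 0)"
proof (cases "v \<in> \<Union>M")
  case True
  then obtain e where e: "e \<in> M" "v \<in> e" by auto
  then have "{e\<in>M. v \<in> e} = {e}" using assms by (auto simp: matching_def)
  then show ?thesis using True by (simp add: deg_def)
next
  case False
  then have "{e\<in>M. v \<in> e} = {}" by auto
  then show ?thesis using False unfolding deg_def by (metis card.empty)
qed

lemma deg_Un_disjoint:
  assumes "finite E" "finite F" "E \<inter> F = {}"
  shows "deg (E \<union> F) v = deg E v + deg F v"
proof -
  have "{e \<in> E \<union> F. v \<in> e} = {e\<in>E. v \<in> e} \<union> {e\<in>F. v \<in> e}" by auto
  moreover have "{e\<in>E. v \<in> e} \<inter> {e\<in>F. v \<in> e} = {}" using assms by auto
  ultimately show ?thesis using assms by (simp add: deg_def card_Un_disjoint)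
qed

lemma deg_mono: "finite E \<Longrightarrow> F \<subseteq> E \<Longrightarrow> deg F v \<le> deg E v"
  unfolding deg_def by (rule card_mono) auto

text \<open>A union of connected components of \<open>E\<close>, edges being joined when they share
  a vertex. For two colour classes these are unions of Kempe chains.\<close>

definition linked_closed :: "'a set set \<Rightarrow> 'a set set \<Rightarrow> bool" where
  "linked_closed E C \<longleftrightarrow> C \<subseteq> E \<and> (\<forall>x\<in>C. \<forall>f\<in>E. f \<inter> x \<noteq> {} \<longrightarrow> f \<in> C)"

text \<open>A connected edge set spans at most one vertex more than it has edges; this count is all that
  is needed of the path structure of Kempe chains.\<close>
lemma kempe_component:
  assumes E: "edges E" and e: "e \<in> E"
  shows "\<exists>C. linked_closed E C \<and> e \<in> C \<and> card (\<Union>C) \<le> card C + 1"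
proof -
  \<comment> \<open>Connectivity is never defined. A largest edge set obeying this count is closed,
    because an edge meeting it brings at most one new vertex and could otherwise be added.\<close>
  let ?P = "\<lambda>C. C \<subseteq> E \<and> e \<in> C \<and> card (\<Union>C) \<le> card C + 1"
  have "?P {e}" using E e by (auto simp: edges_def)
  moreover have "\<forall>C. ?P C \<longrightarrow> card C < Suc (card E)"
    using E by (auto simp: edges_def less_Suc_eq_le intro: card_mono)
  ultimately have "\<exists>C. ?P C \<and> (\<forall>D. ?P D \<longrightarrow> card D \<le> card C)"
    by (rule ex_has_greatest_nat)
  then obtain C where C: "?P C" and max: "\<And>D. ?P D \<Longrightarrow> card D \<le> card C" by blast
  have finC: "finite C" using C E finite_subset by (auto simp: edges_def)
  have "f \<in> C" if x: "x \<in> C" and f: "f \<in> E" "f \<inter> x \<noteq> {}" for x f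
  proof (rule ccontr)
    assume n: "f \<notin> C"
    have cf: "card f = 2" "finite f" using f E edgesD(1) edges_finite by blast+
    obtain w where w: "w \<in> f" "w \<in> x" using f by auto
    have "\<Union>(insert f C) = \<Union>C \<union> (f - {w})" using w x by auto
    then have "card (\<Union>(insert f C)) \<le> card (\<Union>C) + card (f - {w})"
      by (metis card_Un_le)
    also have "card (f - {w}) = 1" using cf w by simp
    finally have "?P (insert f C)" using C f n finC by auto
    then have "card (insert f C) \<le> card C" by (rule max)
    then show False using n finC by simp
  qed
  then have "linked_closed E C" using C by (auto simp: linked_closed_def)
  then show ?thesis using C by blast
qed

text \<open>Every colour other than \<open>i\<close> becomes \<open>i\<close> on \<open>C\<close>.
  The sets \<open>C\<close> in use carry only the colours \<open>i\<close> and \<open>j\<close>, so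
  this is an exchange.\<close>

definition swap_colours :: "('a set \<Rightarrow> nat) \<Rightarrow> nat \<Rightarrow> nat \<Rightarrow> 'a set set \<Rightarrow> 'a set \<Rightarrow> nat" where
  "swap_colours c i j C e = (if e \<in> C then (if c e = i then j else i) else c e)"

text \<open>An edge outside \<open>C\<close> that meets \<open>C\<close> has a colour different from
  \<open>i\<close> and \<open>j\<close>, by closedness, so the exchange creates no clash along the
  border of \<open>C\<close>.\<close>

lemma colouring_swap:
  assumes c: "colouring E k c" and ij: "i < k" "j < k"
    and C: "linked_closed {e\<in>E. c e \<in> {i, j}} C"
  shows "colouring E k (swap_colours c i j C)"
  unfolding colouring_def
proof (intro conjI ballI impI)
  fix e assume "e \<in> E"
  then show "swap_colours c i j C e < k" using c ij by (auto simp: swap_colours_def colouring_def)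
next
  fix e f assume ef: "e \<in> E" "f \<in> E" and ne: "e \<noteq> f \<and> e \<inter> f \<noteq> {}"
  have neq: "c e \<noteq> c f" using c ef ne by (auto simp: colouring_def)
  have CE: "c x = i \<or> c x = j" if "x \<in> C" for x using C that by (auto simp: linked_closed_def)
  have out: "c y \<noteq> i \<and> c y \<noteq> j" if "x \<in> C" "y \<in> E" "y \<notin> C" "y \<inter> x \<noteq> {}" for x y
    using C that unfolding linked_closed_def by blast
  have fe: "f \<inter> e \<noteq> {}" using ne by auto
  consider "e \<in> C" "f \<in> C" | "e \<in> C" "f \<notin> C" | "e \<notin> C" "f \<in> C" | "e \<notin> C" "f \<notin> C" by blast
  then show "swap_colours c i j C e \<noteq> swap_colours c i j C f"
  proof cases
    case 1 then show ?thesis using neq CE[of e] CE[of f] by (auto simp: swap_colours_def)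
  next
    case 2 then show ?thesis using out[of e f] ef fe CE[of e] by (auto simp: swap_colours_def)
  next
    case 3 then show ?thesis using out[of f e] ef ne CE[of f] by (auto simp: swap_colours_def)
  next
    case 4 then show ?thesis using neq by (simp add: swap_colours_def)
  qed
qed

section \<open>Koenig's theorem and greedy colouring\<close>

lemma missing_colour:
  assumes E: "finite E" and d: "deg E v < k"
  shows "\<exists>a<k. \<forall>e\<in>E. v \<in> e \<longrightarrow> c e \<noteq> a"
proof (rule ccontr)
  assume "\<not> ?thesis"
  then have "{..<k} \<subseteq> c ` {e\<in>E. v \<in> e}" by force
  then have "card {..<k} \<le> card (c ` {e\<in>E. v \<in> e})" using E by (intro card_mono) auto
  also have "\<dots> \<le> deg E v" unfolding deg_def using E by (intro card_image_le) auto
  finally show False using d by simp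
qed

lemma colouring_insert:
  assumes "colouring E k c" "a < k" "e \<notin> E" "\<forall>f\<in>E. f \<inter> e \<noteq> {} \<longrightarrow> c f \<noteq> a"
  shows "colouring (insert e E) k (c(e := a))"
  using assms unfolding colouring_def by (auto simp: Int_commute)

lemma deg_insert: "finite E \<Longrightarrow> e \<notin> E \<Longrightarrow> v \<in> e \<Longrightarrow> deg (insert e E) v = Suc (deg E v)"
proof -
  assume a: "finite E" "e \<notin> E" "v \<in> e"
  then have "{f\<in>insert e E. v \<in> f} = insert e {f\<in>E. v \<in> f}" by auto
  then show ?thesis using a by (simp add: deg_def)
qed

text \<open>Disjoint edges have distinct vertices in \<open>X\<close>. In Koenig's theorem this
  bounds a colour class of a Kempe component by the vertices of one side, without the endpoint that
  misses the colour.\<close>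

lemma card_matching_le:
  assumes M: "matching M" and X: "\<And>f. f \<in> M \<Longrightarrow> card (f \<inter> X) = 1"
    and W: "finite W" "\<And>f. f \<in> M \<Longrightarrow> f \<inter> X \<subseteq> W"
  shows "card M \<le> card W"
proof -
  have "\<forall>f\<in>M. \<exists>x. f \<inter> X = {x}" using X by (simp add: card_1_singleton_iff)
  then obtain g where g: "\<forall>f\<in>M. f \<inter> X = {g f}" by metis
  have "inj_on g M"
  proof (rule inj_onI)
    fix f f' assume f: "f \<in> M" "f' \<in> M" "g f = g f'"
    then have "g f \<in> f \<inter> f'" using g by blast
    then show "f = f'" using M f unfolding matching_def by blast
  qed
  moreover have "g ` M \<subseteq> W" using g W(2) by blast
  ultimately show ?thesis using W(1) by (rule card_inj_on_le)
qed

text \<open>Edges are inserted one at a time. If the colour \<open>a\<close> free at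
  \<open>u\<close> is used at \<open>v\<close>, it is freed there by exchanging \<open>a\<close> and
  \<open>b\<close> on the component containing \<open>v\<close>. The usual parity argument that this
  component avoids \<open>u\<close> is replaced by a count.\<close>

theorem koenig_colouring:
  assumes "edges E" and "\<forall>e\<in>E. card (e \<inter> A) = 1" and "\<forall>v. deg E v \<le> k"
  shows "\<exists>c. colouring E k c"
proof -
  have "finite E" using assms by (simp add: edges_def)
  then show ?thesis using assms
  proof (induction E rule: finite_induct)
    case empty
    then show ?case by (auto simp: colouring_def)
  next
    case (insert e E)
    have E: "edges E" using insert.prems edges_subset by blast
    have ce: "card e = 2" "card (e \<inter> A) = 1" using insert.prems edgesD by auto
    have fe: "finite e" using ce card.infinite by force
    obtain u where u: "e \<inter> A = {u}" using ce card_1_singletonE by blast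
    have "card (e - A) = 1" using ce fe by (metis Int_commute card_Diff_subset_Int finite_Int diff_add_inverse one_add_one)
    then obtain v where v: "e - A = {v}" using card_1_singletonE by blast
    have euv: "e = {u, v}" "u \<in> A" "v \<notin> A" using u v by blast+
    have "deg E x \<le> k" for x
      using insert.prems(3) deg_mono[of "insert e E" E x] insert.hyps by (meson finite_insert le_trans subset_insertI)
    then obtain c where c: "colouring E k c" using insert.IH E insert.prems by blast
    have "deg E u < k" using deg_insert[of E e u] insert.hyps insert.prems(3)[rule_format, of u] euv by simp
    then obtain a where a: "a < k" "\<forall>f\<in>E. u \<in> f \<longrightarrow> c f \<noteq> a"
      using missing_colour[OF edgesD(2)[OF E], of u k c] by auto
    have "deg E v < k" using deg_insert[of E e v] insert.hyps insert.prems(3)[rule_format, of v] euv by simp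
    then obtain b where b: "b < k" "\<forall>f\<in>E. v \<in> f \<longrightarrow> c f \<noteq> b"
      using missing_colour[OF edgesD(2)[OF E], of v k c] by auto
    show ?case
    proof (cases "\<forall>f\<in>E. v \<in> f \<longrightarrow> c f \<noteq> a")
      case True
      then have "\<forall>f\<in>E. f \<inter> e \<noteq> {} \<longrightarrow> c f \<noteq> a" using a euv by auto
      then show ?thesis using insert.hyps by (intro exI[of _ "c(e := a)"] colouring_insert[OF c a(1)]) auto
    next
      case False
      then obtain g where g: "g \<in> E" "v \<in> g" "c g = a" by auto
      then have ab: "a \<noteq> b" using b by auto
      let ?K = "{e\<in>E. c e \<in> {a, b}}"
      have K: "edges ?K" using E by (auto simp: edges_def)
      obtain C where C: "linked_closed ?K C" "g \<in> C" "card (\<Union>C) \<le> card C + 1"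
        using kempe_component[OF K, of g] g by auto
      have CE: "C \<subseteq> E" and Cab: "\<And>f. f \<in> C \<Longrightarrow> c f = a \<or> c f = b"
        using C by (auto simp: linked_closed_def)
      have eC: "edges C" using CE E edges_subset by blast
      have finC: "finite C" "finite (\<Union>C)" using eC edges_finite by (auto simp: edges_def)
      \<comment> \<open>If the component contained both ends, each edge of colour \<open>a\<close>
        would occupy a vertex of \<open>A\<close> other than \<open>u\<close>, and each edge of
        colour \<open>b\<close> a vertex outside \<open>A\<close> other than \<open>v\<close>. That
        makes at most \<open>card (\<Union>C) - 2\<close> edges, against the count of
        \<open>kempe_component\<close>.\<close>
      have u_notin: "u \<notin> \<Union>C"
      proof
        assume uC: "u \<in> \<Union>C"
        have vC: "v \<in> \<Union>C" using g C by auto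
        let ?Ca = "{f\<in>C. c f = a}" and ?Cb = "{f\<in>C. c f = b}"
        have split: "card C = card ?Ca + card ?Cb"
        proof -
          have "C = ?Ca \<union> ?Cb" using Cab by auto
          moreover have "?Ca \<inter> ?Cb = {}" using ab by auto
          ultimately show ?thesis using finC(1)
            by (metis (no_types, lifting) card_Un_disjoint finite_Un)
        qed
        have A1: "card (f \<inter> A) = 1" if "f \<in> C" for f using that CE insert.prems by auto
        have A2: "card (f - A) = 1" if "f \<in> C" for f
        proof -
          have "card f = 2" "finite f" using that eC edgesD edges_finite by auto
          then show ?thesis using A1[OF that]
            by (metis Int_commute card_Diff_subset_Int finite_Int diff_add_inverse one_add_one)
        qed
        have mat: "matching {f\<in>C. c f = l}" for l
          using colouring_class_matching[OF c, of l] by (rule matching_subset) (use CE in auto)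
        have 1: "card ?Ca \<le> card ((\<Union>C \<inter> A) - {u})"
          by (rule card_matching_le[OF mat, where X = A]) (use A1 a(2) CE finC in auto)
        have 2: "card ?Cb \<le> card ((\<Union>C - A) - {v})"
          by (rule card_matching_le[OF mat, where X = "- A"]) (use A2 b(2) CE finC in \<open>auto simp: Diff_eq\<close>)
        have 3: "card (\<Union>C \<inter> A - {u}) = card (\<Union>C \<inter> A) - 1" "card (\<Union>C \<inter> A) \<ge> 1"
          using uC euv finC by (auto simp: card_gt_0_iff Suc_le_eq)
        have 4: "card (\<Union>C - A - {v}) = card (\<Union>C - A) - 1" "card (\<Union>C - A) \<ge> 1"
          using vC euv finC by (auto simp: card_gt_0_iff Suc_le_eq)
        have "card (\<Union>C) = card (\<Union>C \<inter> A) + card (\<Union>C - A)"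
          using finC by (metis card_Int_Diff)
        then show False using 1 2 3 4 split C(3) by linarith
      qed
      let ?c = "swap_colours c a b C"
      have c': "colouring E k ?c" using colouring_swap[OF c a(1) b(1) C(1)] .
      have "?c f \<noteq> a" if f: "f \<in> E" "f \<inter> e \<noteq> {}" for f
      proof (cases "u \<in> f")
        case True
        then have "f \<notin> C" using u_notin by auto
        then show ?thesis using a True f by (auto simp: swap_colours_def)
      next
        case False
        then have vf: "v \<in> f" using f euv by auto
        show ?thesis
        proof
          assume h: "?c f = a"
          show False
          proof (cases "f \<in> C")
            case True
            then have "c f = b" using h ab Cab by (auto simp: swap_colours_def split: if_splits)
            then show False using b vf f by auto
          next
            case False
            then have "c f = a" using h by (simp add: swap_colours_def)
            then have "f \<in> ?K" "f \<inter> g \<noteq> {}" using f vf g by auto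
            then show False using False C unfolding linked_closed_def by blast
          qed
        qed
      qed
      then show ?thesis using insert.hyps by (intro exI[of _ "?c(e := a)"] colouring_insert[OF c' a(1)]) auto
    qed
  qed
qed

text \<open>The factor 2 is affordable in both uses: at the bottom of the halving recursion, where
  the degrees are tiny, and for the sparse set of dropped edges.\<close>

lemma greedy_colouring:
  assumes "edges E" and "\<forall>v. deg E v \<le> k"
  shows "\<exists>c. colouring E (2 * k) c"
proof -
  have "finite E" using assms by (simp add: edges_def)
  then show ?thesis using assms
  proof (induction E rule: finite_induct)
    case empty
    then show ?case by (auto simp: colouring_def)
  next
    case (insert e E)
    have E: "edges E" using insert.prems edges_subset by blast
    have "card e = 2" using insert.prems edgesD by auto
    then obtain u v where e: "e = {u, v}" by (meson card_2_iff)
    have "deg E x \<le> k" for x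
      using insert.prems(2) deg_mono[of "insert e E" E x] insert.hyps by (meson finite_insert le_trans subset_insertI)
    then obtain c where c: "colouring E (2 * k) c" using insert.IH E by blast
    have du: "deg E u < k" using deg_insert[of E e u] insert.hyps insert.prems(2)[rule_format, of u] e by simp
    have dv: "deg E v < k" using deg_insert[of E e v] insert.hyps insert.prems(2)[rule_format, of v] e by simp
    let ?F = "{f\<in>E. f \<inter> e \<noteq> {}}"
    have "?F = {f\<in>E. u \<in> f} \<union> {f\<in>E. v \<in> f}" using e by auto
    then have "card ?F \<le> deg E u + deg E v" unfolding deg_def by (simp add: card_Un_le)
    then have "card (c ` ?F) < card {..<2*k}"
      using du dv card_image_le[of ?F c] insert.hyps by simp
    then have "\<not> {..<2*k} \<subseteq> c ` ?F"
      using card_mono[of "c ` ?F" "{..<2*k}"] insert.hyps by auto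
    then obtain a where "a < 2*k" "a \<notin> c ` ?F" by auto
    then show ?case using insert.hyps by (intro exI[of _ "c(e := a)"] colouring_insert[OF c]) auto
  qed
qed

lemma colouring_Un:
  assumes "colouring E k c" "colouring F l c'" "E \<inter> F = {}"
  shows "colouring (E \<union> F) (k + l) (\<lambda>e. if e \<in> E then c e else k + c' e)"
  unfolding colouring_def
proof (intro conjI ballI impI)
  fix e assume "e \<in> E \<union> F"
  then show "(if e \<in> E then c e else k + c' e) < k + l"
    using assms(1,2) by (auto simp: colouring_def trans_less_add1)
next
  fix e f assume ef: "e \<in> E \<union> F" "f \<in> E \<union> F" and ne: "e \<noteq> f \<and> e \<inter> f \<noteq> {}"
  have 1: "x \<in> E \<Longrightarrow> c x < k" for x using assms(1) by (auto simp: colouring_def)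
  have 2: "e \<in> E \<Longrightarrow> f \<in> E \<Longrightarrow> c e \<noteq> c f" using assms(1) ne by (auto simp: colouring_def)
  have 3: "e \<in> F \<Longrightarrow> f \<in> F \<Longrightarrow> c' e \<noteq> c' f" using assms(2) ne by (auto simp: colouring_def)
  show "(if e \<in> E then c e else k + c' e) \<noteq> (if f \<in> E then c f else k + c' f)"
    using 1[of e] 1[of f] 2 3 ef by auto
qed

section \<open>Equitable edge colourings\<close>

lemma linked_closed_Un: "linked_closed E C \<Longrightarrow> linked_closed E D \<Longrightarrow> linked_closed E (C \<union> D)"
  unfolding linked_closed_def by blast

text \<open>Take a largest closed set in which \<open>M\<close> has no majority. Something is left
  over, and by maximality \<open>M\<close> has a majority in any component of the rest; the vertex
  count of components limits this majority to one edge.\<close>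

lemma kempe_unbalanced_component:
  assumes E: "edges (M \<union> N)" and M: "matching M" and disj: "M \<inter> N = {}" and gt: "card N < card M"
  shows "\<exists>C. linked_closed (M \<union> N) C \<and> card (M \<inter> C) = Suc (card (N \<inter> C))"
proof -
  let ?E = "M \<union> N"
  let ?P = "\<lambda>T. linked_closed ?E T \<and> card (M \<inter> T) \<le> card (N \<inter> T)"
  have finE: "finite ?E" using E by (simp add: edges_def)
  have "?P {}" by (simp add: linked_closed_def)
  moreover have "\<forall>T. ?P T \<longrightarrow> card T < Suc (card ?E)"
    using card_mono[OF finE] by (auto simp: linked_closed_def less_Suc_eq_le)
  ultimately have "\<exists>T. ?P T \<and> (\<forall>D. ?P D \<longrightarrow> card D \<le> card T)"
    by (rule ex_has_greatest_nat)
  then obtain T where T: "?P T" and max: "\<And>D. ?P D \<Longrightarrow> card D \<le> card T" by blast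
  have TE: "T \<subseteq> ?E" using T by (simp add: linked_closed_def)
  have "T \<noteq> ?E"
  proof
    assume "T = ?E"
    then have "M \<inter> T = M" "N \<inter> T = N" by auto
    then show False using T gt by simp
  qed
  then obtain e where e: "e \<in> ?E - T" using TE by blast
  have E': "edges (?E - T)" using E by (rule edges_subset) auto
  obtain C where C: "linked_closed (?E - T) C" "e \<in> C" "card (\<Union>C) \<le> card C + 1"
    using kempe_component[OF E' e] by blast
  have CE: "C \<subseteq> ?E" "C \<inter> T = {}" using C(1) by (auto simp: linked_closed_def)
  have C': "linked_closed ?E C"
    unfolding linked_closed_def
  proof (intro conjI ballI impI)
    fix x f assume x: "x \<in> C" "f \<in> ?E" "f \<inter> x \<noteq> {}"
    have "f \<notin> T"
    proof
      assume "f \<in> T"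
      moreover have "x \<in> ?E" "x \<inter> f \<noteq> {}" using x CE by auto
      ultimately have "x \<in> T" using T by (auto simp: linked_closed_def)
      then show False using x CE by auto
    qed
    then show "f \<in> C" using C(1) x by (auto simp: linked_closed_def)
  qed (use CE in auto)
  have finC: "finite C" "finite T" using CE TE finE finite_subset by blast+
  have eC: "edges C" using E CE(1) by (rule edges_subset)
  have gt': "card (N \<inter> C) < card (M \<inter> C)"
  proof (rule ccontr)
    assume "\<not> ?thesis"
    moreover have "card (M \<inter> (T \<union> C)) = card (M \<inter> T) + card (M \<inter> C)"
      using CE finC by (subst card_Un_disjoint[symmetric]) (auto simp: Int_Un_distrib)
    moreover have "card (N \<inter> (T \<union> C)) = card (N \<inter> T) + card (N \<inter> C)"
      using CE finC by (subst card_Un_disjoint[symmetric]) (auto simp: Int_Un_distrib)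
    ultimately have "?P (T \<union> C)" using T C' linked_closed_Un by auto
    then have "card (T \<union> C) \<le> card T" by (rule max)
    moreover have "card (T \<union> C) = card T + card C" using CE finC by (simp add: card_Un_disjoint Int_commute)
    moreover have "card C > 0" using finC C(2) by (auto simp: card_gt_0_iff)
    ultimately show False by simp
  qed
  \<comment> \<open>The edges of \<open>M\<close> in \<open>C\<close> are disjoint, so twice their
    number is at most \<open>card C + 1\<close>.\<close>
  have "2 * card (M \<inter> C) = card (\<Union>(M \<inter> C))"
    using eC M by (subst card_Union_matching) (auto intro: edges_subset matching_subset)
  also have "\<dots> \<le> card (\<Union>C)"
    using eC by (intro card_mono) (auto simp: edges_def intro: edges_finite[OF eC])
  also have "\<dots> \<le> card C + 1" by fact
  also have "card C = card (M \<inter> C) + card (N \<inter> C)"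
    using finC disj CE by (subst card_Un_disjoint[symmetric]) (auto intro!: arg_cong[of _ _ card])
  finally have "card (M \<inter> C) = Suc (card (N \<inter> C))" using gt' by simp
  then show ?thesis using C' by blast
qed

text \<open>Prescribing which classes receive the extra edge makes the sizes depend on
  \<open>m\<close> and \<open>q\<close> only. Two sides with equally many edges then get classes of
  equal size for every single colour.\<close>

definition eq_size :: "nat \<Rightarrow> nat \<Rightarrow> nat \<Rightarrow> nat" where
  "eq_size m q i = m div q + (if i < m mod q then 1 else 0)"

lemma sum_eq_size: "q > 0 \<Longrightarrow> (\<Sum>i<q. eq_size m q i) = m"
proof -
  assume q: "q > 0"
  have "(\<Sum>i<q. eq_size m q i) = q * (m div q) + card ({..<q} \<inter> {i. i < m mod q})"
    by (simp add: eq_size_def sum.distrib sum.If_cases)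
  also have "{..<q} \<inter> {i. i < m mod q} = {..<m mod q}" using q by (auto intro: less_trans mod_less_divisor)
  finally show ?thesis by simp
qed

lemma equitable_colouring:
  assumes E: "edges E" and c0: "colouring E q c0" and q: "q > 0"
  shows "\<exists>c. colouring E q c \<and> (\<forall>i<q. card {e\<in>E. c e = i} = eq_size (card E) q i)"
proof -
  define t where "t = eq_size (card E) q"
  define sz where "sz c i = card {e\<in>E. c e = i}" for c and i :: nat
  \<comment> \<open>Truncated subtraction counts the excess only, so moving one edge from an
    oversized to an undersized class lowers \<open>err\<close>.\<close>
  define err where "err c = (\<Sum>i<q. (sz c i - t i))" for c
  have finE: "finite E" using E by (simp add: edges_def)
  have sumsz: "(\<Sum>i<q. sz c i) = card E" if "colouring E q c" for c
  proof -
    have "card E = card (\<Union>i<q. {e\<in>E. c e = i})"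
      using that by (intro arg_cong[of _ _ card]) (auto simp: colouring_def)
    also have "\<dots> = (\<Sum>i<q. sz c i)" unfolding sz_def
      using finE by (intro card_UN_disjoint) auto
    finally show ?thesis by simp
  qed
  obtain c where c: "colouring E q c" and min: "\<And>c'. colouring E q c' \<Longrightarrow> err c \<le> err c'"
    using ex_has_least_nat[of "colouring E q" c0 err] c0 by auto
  have le: "sz c i \<le> t i" if i: "i < q" for i
  proof (rule ccontr)
    assume "\<not> ?thesis"
    then have gi: "t i < sz c i" by simp
    have "\<exists>j<q. sz c j < t j"
    proof (rule ccontr)
      assume "\<not> ?thesis"
      then have "\<forall>j\<in>{..<q}. t j \<le> sz c j" by (meson lessThan_iff not_less)
      moreover have "\<exists>j\<in>{..<q}. t j < sz c j" using gi i by blast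
      ultimately have "(\<Sum>j<q. t j) < (\<Sum>j<q. sz c j)" by (intro sum_strict_mono_ex1) simp_all
      then show False using sumsz[OF c] sum_eq_size[OF q] by (simp add: t_def)
    qed
    then obtain j where j: "j < q" "sz c j < t j" by auto
    have ij: "i \<noteq> j" using gi j by auto
    \<comment> \<open>The targets differ by at most one, so a class below its target is strictly
      smaller than one above its target, and a component with surplus in the larger class
      exists.\<close>
    have "t j \<le> t i + 1" by (simp add: t_def eq_size_def)
    then have lt: "sz c j < sz c i" using gi j by linarith
    let ?M = "{e\<in>E. c e = i}" and ?N = "{e\<in>E. c e = j}"
    have MN: "?M \<union> ?N = {e\<in>E. c e \<in> {i, j}}" by auto
    have "edges (?M \<union> ?N)" using E by (rule edges_subset) auto
    then obtain C where C: "linked_closed (?M \<union> ?N) C" "card (?M \<inter> C) = Suc (card (?N \<inter> C))"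
      using kempe_unbalanced_component[of ?M ?N] colouring_class_matching[OF c, of i] ij lt
      by (auto simp: sz_def)
    let ?c = "swap_colours c i j C"
    have CE: "C \<subseteq> ?M \<union> ?N" using C by (simp add: linked_closed_def)
    have c': "colouring E q ?c" using colouring_swap[OF c i j(1)] C(1) MN by simp
    have "{e\<in>E. ?c e = i} = (?N \<inter> C) \<union> (?M - C)" using CE ij by (auto simp: swap_colours_def)
    then have "sz ?c i = card (?N \<inter> C) + card (?M - C)"
      using finE ij unfolding sz_def by (simp add: card_Un_disjoint disjoint_iff)
    moreover have "card (?M - C) + card (?M \<inter> C) = sz c i"
      unfolding sz_def using finE by (simp add: card_Diff_subset_Int card_mono)
    ultimately have 1: "Suc (sz ?c i) = sz c i" using C(2) by simp
    have "{e\<in>E. ?c e = j} = (?M \<inter> C) \<union> (?N - C)" using CE ij by (auto simp: swap_colours_def)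
    then have "sz ?c j = card (?M \<inter> C) + card (?N - C)"
      using finE ij unfolding sz_def by (simp add: card_Un_disjoint disjoint_iff)
    moreover have "card (?N - C) + card (?N \<inter> C) = sz c j"
      unfolding sz_def using finE by (simp add: card_Diff_subset_Int card_mono)
    ultimately have 2: "sz ?c j = Suc (sz c j)" using C(2) by simp
    have 3: "sz ?c k = sz c k" if "k \<noteq> i" "k \<noteq> j" for k
      unfolding sz_def
    proof (rule arg_cong[of _ _ card], rule Collect_cong)
      fix e show "(e \<in> E \<and> ?c e = k) = (e \<in> E \<and> c e = k)"
        using that CE by (auto simp: swap_colours_def)
    qed
    have "err ?c < err c" unfolding err_def
    proof (rule sum_strict_mono_ex1)
      show "\<forall>k\<in>{..<q}. sz ?c k - t k \<le> sz c k - t k"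
        using 1 2 3 j by (metis Suc_leI diff_is_0_eq diff_le_mono le_SucI order_refl zero_le)
      show "\<exists>k\<in>{..<q}. sz ?c k - t k < sz c k - t k" using i gi 1 by (intro bexI[of _ i]) auto
    qed simp
    then show False using min[OF c'] by simp
  qed
  have eq: "sz c i = t i" if i: "i < q" for i
  proof (rule ccontr)
    assume "sz c i \<noteq> t i"
    then have "\<exists>j\<in>{..<q}. sz c j < t j" using le i le_neq_implies_less by blast
    moreover have "\<forall>j\<in>{..<q}. sz c j \<le> t j" using le by blast
    ultimately have "(\<Sum>j<q. sz c j) < (\<Sum>j<q. t j)" by (intro sum_strict_mono_ex1) simp_all
    then show False using sumsz[OF c] sum_eq_size[OF q] by (simp add: t_def)
  qed
  show ?thesis using c eq by (auto simp: sz_def t_def)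
qed

text \<open>The induction of Halmos and Vaughan: a nonempty proper subset attaining equality splits
  the problem into two; otherwise every such subset has a neighbour to spare, and one element may be
  matched arbitrarily.\<close>

lemma hall_distinct_representatives:
  fixes N :: "'a \<Rightarrow> 'b set"
  assumes "finite X" and "\<And>x. x \<in> X \<Longrightarrow> finite (N x)"
    and "\<And>S. S \<subseteq> X \<Longrightarrow> card S \<le> card (\<Union>x\<in>S. N x)"
  shows "\<exists>f. inj_on f X \<and> (\<forall>x\<in>X. f x \<in> N x)"
  using assms
proof (induction "card X" arbitrary: X N rule: less_induct)
  case less
  note fX = less.prems(1) and fN = less.prems(2) and hall = less.prems(3)
  show ?case
  proof (cases "X = {}")
    case True then show ?thesis by simp
  next
    case False
    then obtain x where x: "x \<in> X" by blast
    show ?thesis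
    proof (cases "\<exists>S. S \<subset> X \<and> S \<noteq> {} \<and> card (\<Union>x\<in>S. N x) \<le> card S")
      case True
      then obtain S where S: "S \<subset> X" "S \<noteq> {}" "card (\<Union>x\<in>S. N x) \<le> card S" by blast
      let ?NS = "\<Union>x\<in>S. N x"
      have fS: "finite S" using S fX finite_subset by blast
      have "card S < card X" using S fX by (simp add: psubset_card_mono)
      then have "\<exists>f. inj_on f S \<and> (\<forall>x\<in>S. f x \<in> N x)"
        using less.hyps[of S N] fS fN hall S(1) by auto
      then obtain f where f: "inj_on f S" "\<forall>x\<in>S. f x \<in> N x" by blast
      let ?N = "\<lambda>x. N x - ?NS"
      have "card (X - S) < card X" using S fX by (intro psubset_card_mono) auto
      moreover have "card T \<le> card (\<Union>x\<in>T. ?N x)" if T: "T \<subseteq> X - S" for T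
      proof -
        have fT: "finite T" using T fX finite_subset by blast
        have "card S + card T = card (S \<union> T)" using T fT fS by (subst card_Un_disjoint) auto
        also have "\<dots> \<le> card (\<Union>x\<in>S \<union> T. N x)" using T S by (intro hall) auto
        also have "(\<Union>x\<in>S \<union> T. N x) = ?NS \<union> (\<Union>x\<in>T. ?N x)" by auto
        also have "card \<dots> \<le> card ?NS + card (\<Union>x\<in>T. ?N x)" by (rule card_Un_le)
        finally show ?thesis using S(3) by linarith
      qed
      ultimately have "\<exists>g. inj_on g (X - S) \<and> (\<forall>x\<in>X - S. g x \<in> ?N x)"
        using less.hyps[of "X - S" ?N] fX fN by auto
      then obtain g where g: "inj_on g (X - S)" "\<forall>x\<in>X - S. g x \<in> ?N x" by blast
      let ?h = "\<lambda>x. if x \<in> S then f x else g x"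
      have "inj_on ?h X"
      proof (rule inj_onI)
        fix a b assume ab: "a \<in> X" "b \<in> X" "?h a = ?h b"
        have fin: "f y \<in> ?NS" if "y \<in> S" for y using f that by auto
        have gin: "g y \<notin> ?NS" if "y \<in> X - S" for y using g that by auto
        show "a = b"
          using ab fin[of a] fin[of b] gin[of a] gin[of b] f(1) g(1)
          by (cases "a \<in> S"; cases "b \<in> S") (auto simp: inj_on_def)
      qed
      moreover have "\<forall>x\<in>X. ?h x \<in> N x" using f g by auto
      ultimately show ?thesis by (intro exI[of _ ?h]) blast
    next
      case False
      have "card {x} \<le> card (\<Union>y\<in>{x}. N y)" using x by (intro hall) auto
      then have "N x \<noteq> {}" by auto
      then obtain y where y: "y \<in> N x" by blast
      let ?N = "\<lambda>z. N z - {y}"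
      have "card (X - {x}) < card X" using x fX by (intro psubset_card_mono) auto
      moreover have "card T \<le> card (\<Union>z\<in>T. ?N z)" if T: "T \<subseteq> X - {x}" for T
      proof (cases "T = {}")
        case nonempty: False
        have "T \<subset> X" using T x by auto
        then have 1: "card T < card (\<Union>z\<in>T. N z)" using False nonempty by (meson not_le)
        have 2: "(\<Union>z\<in>T. ?N z) = (\<Union>z\<in>T. N z) - {y}" by auto
        have "card (\<Union>z\<in>T. N z) - 1 \<le> card ((\<Union>z\<in>T. N z) - {y})"
          by (simp add: card_Diff_singleton_if)
        then show ?thesis unfolding 2 using 1 by linarith
      qed simp
      ultimately have "\<exists>g. inj_on g (X - {x}) \<and> (\<forall>z\<in>X - {x}. g z \<in> ?N z)"
        using less.hyps[of "X - {x}" ?N] fX fN by auto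
      then obtain g where g: "inj_on g (X - {x})" "\<forall>z\<in>X - {x}. g z \<in> ?N z" by blast
      let ?h = "g(x := y)"
      have "inj_on ?h X" using g by (auto simp: inj_on_def)
      moreover have "\<forall>z\<in>X. ?h z \<in> N z" using g y by auto
      ultimately show ?thesis by (intro exI[of _ ?h]) blast
    qed
  qed
qed

section \<open>The local lemma and random labellings\<close>

text \<open>A uniform probability space in which probabilities are ratios of cardinalities. Labels
  are fixed to \<open>undefined\<close> off \<open>I\<close>, which keeps the space finite.\<close>

definition labellings :: "'i set \<Rightarrow> nat \<Rightarrow> ('i \<Rightarrow> nat) set" where
  "labellings I s = PiE I (\<lambda>_. {..<s})"

text \<open>An event depending only on the coordinates in \<open>S\<close>. Overlap of these
  supports serves as the dependency graph of the local lemma.\<close>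

definition determined_by :: "('i \<Rightarrow> nat) set \<Rightarrow> 'i set \<Rightarrow> ('i \<Rightarrow> nat) set \<Rightarrow> bool" where
  "determined_by \<Omega> S B \<longleftrightarrow> B \<subseteq> \<Omega> \<and>
     (\<forall>f\<in>\<Omega>. \<forall>g\<in>\<Omega>. (\<forall>i\<in>S. f i = g i) \<longrightarrow> f \<in> B \<longrightarrow> g \<in> B)"

lemma finite_labellings: "finite I \<Longrightarrow> finite (labellings I s)"
  by (auto simp: labellings_def intro: finite_PiE)

lemma card_labellings: "finite I \<Longrightarrow> card (labellings I s) = s ^ card I"
  by (simp add: labellings_def card_PiE)

text \<open>Exchanging the coordinates in S of two independent copies is a bijection, which yields
  independence of events with disjoint supports.\<close>
lemma independent_determined:
  assumes I: "finite I" and X: "determined_by (labellings I s) S X"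
    and Y: "determined_by (labellings I s) T Y" and ST: "S \<inter> T = {}"
  shows "card (X \<inter> Y) * card (labellings I s) = card X * card Y"
proof -
  let ?\<Omega> = "labellings I s"
  define mix where "mix f g = (\<lambda>i. if i \<in> S then f i else g i)" for f g :: "'a \<Rightarrow> nat"
  define \<phi> where "\<phi> = (\<lambda>(f, g). (mix f g, mix g f))"
  have mixin: "mix f g \<in> ?\<Omega>" if "f \<in> ?\<Omega>" "g \<in> ?\<Omega>" for f g
    using that by (auto simp: mix_def labellings_def PiE_iff extensional_def)
  have XO: "X \<subseteq> ?\<Omega>" and YO: "Y \<subseteq> ?\<Omega>" using X Y by (auto simp: determined_by_def)
  have detX: "g \<in> X" if "f \<in> X" "g \<in> ?\<Omega>" "\<forall>i\<in>S. f i = g i" for f g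
    using X that XO unfolding determined_by_def by blast
  have detY: "g \<in> Y" if "f \<in> Y" "g \<in> ?\<Omega>" "\<forall>i\<in>T. f i = g i" for f g
    using Y that YO unfolding determined_by_def by blast
  have inv: "\<phi> (\<phi> p) = p" for p
    by (cases p) (auto simp: \<phi>_def mix_def fun_eq_iff)
  have "bij_betw \<phi> (X \<times> Y) ((X \<inter> Y) \<times> ?\<Omega>)"
  proof (rule bij_betw_byWitness[where f' = \<phi>])
    show "\<phi> ` (X \<times> Y) \<subseteq> (X \<inter> Y) \<times> ?\<Omega>"
    proof (clarsimp simp: \<phi>_def)
      fix f g assume f: "f \<in> X" and g: "g \<in> Y"
      have fg: "f \<in> ?\<Omega>" "g \<in> ?\<Omega>" using f g XO YO by auto
      have "mix f g \<in> X" by (rule detX[OF f mixin]) (use fg in \<open>auto simp: mix_def\<close>)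
      moreover have "mix f g \<in> Y" by (rule detY[OF g mixin]) (use fg ST in \<open>auto simp: mix_def\<close>)
      ultimately show "mix f g \<in> X \<and> mix f g \<in> Y \<and> mix g f \<in> ?\<Omega>" using mixin fg by auto
    qed
    show "\<phi> ` ((X \<inter> Y) \<times> ?\<Omega>) \<subseteq> X \<times> Y"
    proof (clarsimp simp: \<phi>_def)
      fix f g assume f: "f \<in> X" "f \<in> Y" and g: "g \<in> ?\<Omega>"
      have fg: "f \<in> ?\<Omega>" using f XO by auto
      have "mix f g \<in> X" by (rule detX[OF f(1) mixin]) (use fg g in \<open>auto simp: mix_def\<close>)
      moreover have "mix g f \<in> Y" by (rule detY[OF f(2) mixin]) (use fg g ST in \<open>auto simp: mix_def\<close>)
      ultimately show "mix f g \<in> X \<and> mix g f \<in> Y" by auto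
    qed
  qed (use inv in auto)
  then have "card (X \<times> Y) = card ((X \<inter> Y) \<times> ?\<Omega>)" by (rule bij_betw_same_card)
  then show ?thesis by (simp add: card_cartesian_product)
qed

text \<open>The symmetric form. The bound \<open>p1\<close> is stated separately from
  \<open>pD\<close> because an event with empty support does not even count itself as a neighbour,
  so \<open>D\<close> may be 0.\<close>

theorem lovasz_local_lemma:
  fixes p :: real
  assumes I: "finite I" and s: "s > 0" and K: "finite K"
    and det: "\<And>k. k \<in> K \<Longrightarrow> determined_by (labellings I s) (S k) (B k)"
    and p: "\<And>k. k \<in> K \<Longrightarrow> real (card (B k)) \<le> p * card (labellings I s)"
    and D: "\<And>k. k \<in> K \<Longrightarrow> card {j\<in>K. S j \<inter> S k \<noteq> {}} \<le> D"
    and pD: "4 * p * D \<le> 1" and p1: "4 * p \<le> 1" and p0: "0 \<le> p"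
  shows "\<exists>f\<in>labellings I s. \<forall>k\<in>K. f \<notin> B k"
proof -
  let ?\<Omega> = "labellings I s"
  define av where "av T = ?\<Omega> - (\<Union>j\<in>T. B j)" for T
  have finO: "finite ?\<Omega>" using I by (rule finite_labellings)
  have Opos: "card ?\<Omega> > 0" using s I by (simp add: card_labellings)
  have finav: "finite (av T)" for T using finO by (auto simp: av_def)
  have av_det: "determined_by ?\<Omega> (\<Union>j\<in>T. S j) (av T)" if "T \<subseteq> K" for T
    unfolding determined_by_def
  proof (intro conjI ballI impI)
    fix f g assume f: "f \<in> ?\<Omega>" and g: "g \<in> ?\<Omega>" and eq: "\<forall>i\<in>\<Union>(S ` T). f i = g i" and fav: "f \<in> av T"
    have "g \<notin> B j" if j: "j \<in> T" for j
    proof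
      assume "g \<in> B j"
      moreover have "\<forall>i\<in>S j. g i = f i" using eq j by auto
      ultimately have "f \<in> B j" using det[of j] j \<open>T \<subseteq> K\<close> f g unfolding determined_by_def by blast
      then show False using fav j by (auto simp: av_def)
    qed
    then show "g \<in> av T" using g by (auto simp: av_def)
  qed (auto simp: av_def)
  \<comment> \<open>The conditional probability of \<open>B k\<close>, given that all events of
    \<open>T\<close> are avoided, is at most \<open>2 * p\<close>; written without division. The
    events in \<open>T2\<close> are independent of \<open>B k\<close>, and passing from
    \<open>T2\<close> to \<open>T\<close> costs a factor 2.\<close>
  have key: "real (card (B k \<inter> av T)) \<le> 2 * p * card (av T)" if "T \<subseteq> K" "k \<in> K" for k T
    using that
  proof (induction "card T" arbitrary: T k rule: less_induct)
    case less
    have finT: "finite T" using less.prems K finite_subset by blast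
    define T1 where "T1 = {j\<in>T. S j \<inter> S k \<noteq> {}}"
    define T2 where "T2 = {j\<in>T. S j \<inter> S k = {}}"
    have T12: "T = T1 \<union> T2" "T1 \<inter> T2 = {}" "T1 \<subseteq> K" "T2 \<subseteq> K" "finite T1" "finite T2"
      using finT less.prems by (auto simp: T1_def T2_def)
    have "S k \<inter> (\<Union>j\<in>T2. S j) = {}" by (auto simp: T2_def)
    then have "card (B k \<inter> av T2) * card ?\<Omega> = card (B k) * card (av T2)"
      using independent_determined[OF I det[OF less.prems(2)] av_det[OF T12(4)]] by simp
    then have "real (card (B k \<inter> av T2)) * card ?\<Omega> = real (card (B k)) * card (av T2)"
      by (metis of_nat_mult)
    also have "\<dots> \<le> p * card ?\<Omega> * card (av T2)" by (intro mult_right_mono p less.prems) auto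
    finally have "real (card (B k \<inter> av T2)) * card ?\<Omega> \<le> (p * card (av T2)) * card ?\<Omega>" by (simp add: mult_ac)
    then have ind: "real (card (B k \<inter> av T2)) \<le> p * card (av T2)" using Opos by simp
    have sub: "card (B k \<inter> av T) \<le> card (B k \<inter> av T2)"
      using finav by (intro card_mono) (auto simp: av_def T2_def)
    \<comment> \<open>By induction each of the at most \<open>D\<close> events in \<open>T1\<close>
      has probability at most \<open>2 * p\<close> given \<open>av T2\<close>, so together they
      remove at most half of \<open>av T2\<close>.\<close>
    have half: "card (av T2) \<le> 2 * real (card (av T))"
    proof (cases "T1 = {}")
      case True
      then show ?thesis using T12 by simp
    next
      case False
      then have "card T2 < card T" using T12 finT by (intro psubset_card_mono) auto
      then have IH: "real (card (B j \<inter> av T2)) \<le> 2 * p * card (av T2)" if "j \<in> T1" for j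
        using less.hyps[of T2 j] T12 that by auto
      have "av T2 \<subseteq> av T \<union> (\<Union>j\<in>T1. B j \<inter> av T2)" using T12(1) by (auto simp: av_def)
      then have "card (av T2) \<le> card (av T \<union> (\<Union>j\<in>T1. B j \<inter> av T2))"
        using finav T12 by (intro card_mono) auto
      also have "\<dots> \<le> card (av T) + card (\<Union>j\<in>T1. B j \<inter> av T2)" by (rule card_Un_le)
      also have "card (\<Union>j\<in>T1. B j \<inter> av T2) \<le> (\<Sum>j\<in>T1. card (B j \<inter> av T2))"
        using T12 by (intro card_UN_le)
      finally have "card (av T2) \<le> card (av T) + (\<Sum>j\<in>T1. card (B j \<inter> av T2))" by simp
      from of_nat_mono[OF this, where 'a = real]
      have "real (card (av T2)) \<le> card (av T) + (\<Sum>j\<in>T1. real (card (B j \<inter> av T2)))" by simp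
      also have "(\<Sum>j\<in>T1. real (card (B j \<inter> av T2))) \<le> card T1 * (2 * p * card (av T2))"
        using sum_bounded_above[of T1 "\<lambda>j. real (card (B j \<inter> av T2))"] IH by simp
      also have "card T1 \<le> D"
      proof -
        have "card T1 \<le> card {j\<in>K. S j \<inter> S k \<noteq> {}}"
          using K T12 by (intro card_mono) (auto simp: T1_def)
        then show ?thesis using D[OF less.prems(2)] by linarith
      qed
      then have "real (card T1) * (2 * p * card (av T2)) \<le> D * (2 * p * card (av T2))"
        using p0 by (intro mult_right_mono) auto
      also have "D * (2 * p * card (av T2)) = (4 * p * D) * (card (av T2) / 2)" by simp
      also have "\<dots> \<le> 1 * (card (av T2) / 2)" using pD by (intro mult_right_mono) auto
      finally show ?thesis by simp
    qed
    have "real (card (B k \<inter> av T)) \<le> p * card (av T2)" using sub ind by linarith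
    also have "\<dots> \<le> p * (2 * real (card (av T)))" using half p0 by (intro mult_left_mono) auto
    finally show ?case by simp
  qed
  have pos: "card (av T) > 0" if "T \<subseteq> K" for T
  proof -
    have "finite T" using that K finite_subset by blast
    then show ?thesis using that
    proof (induction T rule: finite_induct)
      case empty
      then show ?case using Opos by (simp add: av_def)
    next
      case (insert k T)
      have split: "av T = av (insert k T) \<union> (B k \<inter> av T)" by (auto simp: av_def)
      have "card (av T) \<le> card (av (insert k T)) + card (B k \<inter> av T)"
        by (subst split) (rule card_Un_le)
      moreover have "real (card (B k \<inter> av T)) \<le> 2 * p * card (av T)" using key insert.prems by auto
      moreover have "2 * p * card (av T) \<le> (1/2) * card (av T)" using p1 by (intro mult_right_mono) auto
      ultimately have "real (card (av T)) \<le> 2 * card (av (insert k T))" by linarith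
      moreover have "card (av T) > 0" using insert by auto
      ultimately show ?case by linarith
    qed
  qed
  have "av K \<noteq> {}" using pos[of K] by auto
  then show ?thesis by (auto simp: av_def)
qed

section \<open>Concentration of sums of independent labels\<close>

lemma exp_le_quadratic:
  fixes x :: real
  assumes "\<bar>x\<bar> \<le> 1"
  shows "exp x \<le> 1 + x + x\<^sup>2"
proof (cases "x \<ge> 0")
  case True
  then show ?thesis using exp_bound assms by auto
next
  case False
  have "exp x * exp (- x) = 1" by (simp flip: exp_add)
  moreover have "1 - x \<le> exp (- x)" using exp_ge_add_one_self[of "- x"] by simp
  moreover have "1 \<le> (1 + x + x\<^sup>2) * (1 - x)"
  proof -
    have "(1 + x + x\<^sup>2) * (1 - x) = 1 - x ^ 3" by (simp add: algebra_simps power2_eq_square power3_eq_cube)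
    then show ?thesis using False by simp
  qed
  ultimately show ?thesis
    using False by (smt (verit, best) exp_gt_zero mult_less_cancel_right mult_mono zero_le_power2)
qed

text \<open>Exponential moments; independence enters as the factorisation of a sum over a product
  set. \<open>N\<close> merely bounds \<open>card S\<close>, so that test sets of different sizes
  obey one tail bound.\<close>

lemma hoeffding_count:
  fixes g :: "'i \<Rightarrow> nat \<Rightarrow> real"
  assumes I: "finite I" and S: "S \<subseteq> I" "real (card S) \<le> N" and s: "s > 0"
    and bd: "\<And>i l. i \<in> S \<Longrightarrow> l < s \<Longrightarrow> \<bar>g i l\<bar> \<le> 4"
    and mean: "\<And>i. i \<in> S \<Longrightarrow> (\<Sum>l<s. g i l) = 0"
    and th: "0 < \<theta>" "\<theta> \<le> 8"
  shows "real (card {f\<in>labellings I s. (\<Sum>i\<in>S. g i (f i)) > \<theta> * N})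
    \<le> exp (- \<theta>\<^sup>2 * N / 64) * card (labellings I s)"
proof -
  \<comment> \<open>The minimiser of \<open>16 * t^2 - t * \<theta>\<close>, the exponent per
    element. With \<theta> \<le> 8 it satisfies \<open>4 * t \<le> 1\<close>, the range of the
    quadratic bound on \<open>exp\<close>.\<close>
  define t where "t = \<theta> / 32"
  let ?\<Omega> = "labellings I s"
  have finO: "finite ?\<Omega>" using I by (rule finite_labellings)
  have finS: "finite S" using I S finite_subset by blast
  define h where "h i l = (if i \<in> S then exp (t * g i l) else 1)" for i l
  let ?B = "{f\<in>?\<Omega>. (\<Sum>i\<in>S. g i (f i)) > \<theta> * N}"
  have one: "(\<Sum>l<s. h i l) \<le> s * (if i \<in> S then exp (16 * t\<^sup>2) else 1)" for i
  proof (cases "i \<in> S")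
    case True
    have "(\<Sum>l<s. h i l) \<le> (\<Sum>l<s. 1 + t * g i l + 16 * t\<^sup>2)"
    proof (rule sum_mono)
      fix l assume l: "l \<in> {..<s}"
      have b: "\<bar>g i l\<bar> \<le> 4" using bd True l by auto
      have "\<bar>t * g i l\<bar> = t * \<bar>g i l\<bar>" using th by (simp add: abs_mult t_def)
      also have "\<dots> \<le> t * 4" using b th by (intro mult_left_mono) (auto simp: t_def)
      also have "t * 4 \<le> 1" using th by (simp add: t_def)
      finally have "exp (t * g i l) \<le> 1 + t * g i l + (t * g i l)\<^sup>2" by (rule exp_le_quadratic)
      moreover have "(g i l)\<^sup>2 \<le> 4\<^sup>2" using b by (intro abs_le_square_iff[THEN iffD1]) auto
      then have "(t * g i l)\<^sup>2 \<le> 16 * t\<^sup>2" by (simp add: power_mult_distrib mult_left_mono mult.commute)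
      ultimately show "h i l \<le> 1 + t * g i l + 16 * t\<^sup>2" using True by (simp add: h_def)
    qed
    also have "\<dots> = s + t * (\<Sum>l<s. g i l) + s * (16 * t\<^sup>2)" by (simp add: sum.distrib sum_distrib_left)
    also have "\<dots> = s * (1 + 16 * t\<^sup>2)" using mean[OF True] by (simp add: algebra_simps)
    also have "\<dots> \<le> s * exp (16 * t\<^sup>2)" by (intro mult_left_mono) auto
    finally show ?thesis using True by simp
  qed (simp add: h_def)
  have "(\<Sum>f\<in>?\<Omega>. exp (t * (\<Sum>i\<in>S. g i (f i)))) = (\<Sum>f\<in>?\<Omega>. \<Prod>i\<in>I. h i (f i))"
  proof (rule sum.cong)
    fix f
    have "exp (t * (\<Sum>i\<in>S. g i (f i))) = (\<Prod>i\<in>S. exp (t * g i (f i)))"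
      using finS by (simp add: sum_distrib_left exp_sum)
    also have "\<dots> = (\<Prod>i\<in>I. h i (f i))"
      using S I by (intro prod.mono_neutral_cong_left) (auto simp: h_def)
    finally show "exp (t * (\<Sum>i\<in>S. g i (f i))) = (\<Prod>i\<in>I. h i (f i))" .
  qed simp
  also have "\<dots> = (\<Prod>i\<in>I. \<Sum>l<s. h i l)"
    unfolding labellings_def using I by (intro prod_sum_PiE[symmetric]) auto
  also have "\<dots> \<le> (\<Prod>i\<in>I. s * (if i \<in> S then exp (16 * t\<^sup>2) else 1))"
    by (intro prod_mono conjI one sum_nonneg) (auto simp: h_def)
  also have "\<dots> = card ?\<Omega> * (\<Prod>i\<in>I. if i \<in> S then exp (16 * t\<^sup>2) else 1)"
    using I by (simp add: prod.distrib card_labellings)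
  also have "(\<Prod>i\<in>I. if i \<in> S then exp (16 * t\<^sup>2) else 1) = exp (16 * t\<^sup>2) ^ card S"
    using S I by (simp add: prod.If_cases Int_absorb1)
  also have "\<dots> = exp (16 * t\<^sup>2 * card S)" by (simp add: exp_of_nat_mult[symmetric] mult.commute)
  also have "\<dots> \<le> exp (16 * t\<^sup>2 * N)" using S by (simp add: mult_left_mono)
  finally have total: "(\<Sum>f\<in>?\<Omega>. exp (t * (\<Sum>i\<in>S. g i (f i)))) \<le> card ?\<Omega> * exp (16 * t\<^sup>2 * N)"
    by (simp add: mult_left_mono)
  have "card ?B * exp (t * (\<theta> * N)) = (\<Sum>f\<in>?B. exp (t * (\<theta> * N)))" by simp
  also have "\<dots> \<le> (\<Sum>f\<in>?B. exp (t * (\<Sum>i\<in>S. g i (f i))))"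
    using th by (intro sum_mono) (auto simp: t_def)
  also have "\<dots> \<le> (\<Sum>f\<in>?\<Omega>. exp (t * (\<Sum>i\<in>S. g i (f i))))"
    using finO by (intro sum_mono2) auto
  finally have "card ?B * exp (t * (\<theta> * N)) \<le> card ?\<Omega> * exp (16 * t\<^sup>2 * N)" using total by linarith
  then have "card ?B \<le> card ?\<Omega> * exp (16 * t\<^sup>2 * N) / exp (t * (\<theta> * N))" by (simp add: field_simps)
  also have "\<dots> = card ?\<Omega> * exp (16 * t\<^sup>2 * N - t * (\<theta> * N))" by (simp add: exp_diff)
  also have "16 * t\<^sup>2 * N - t * (\<theta> * N) = - \<theta>\<^sup>2 * N / 64"
    by (simp add: t_def power2_eq_square field_simps)
  finally show ?thesis by (simp add: mult.commute)
qed

text \<open>Elements x of T carry a variable \<open>\<pi> x\<close> and a tested label \<open>\<tau> x\<close>; the lemma labels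
  the variables so that every T sees its expected number of hits.\<close>
theorem random_labelling:
  fixes \<pi> :: "'x \<Rightarrow> 'i" and \<tau> :: "'x \<Rightarrow> nat" and \<T> :: "'x set set" and N \<theta> :: real
  assumes fT: "finite \<T>" "\<And>T. T \<in> \<T> \<Longrightarrow> finite T" and cT: "\<And>T. T \<in> \<T> \<Longrightarrow> real (card T) \<le> N"
    and fib: "\<And>T y. T \<in> \<T> \<Longrightarrow> card {x\<in>T. \<pi> x = y} \<le> 4"
    and R: "\<And>y. real (card {T\<in>\<T>. y \<in> \<pi> ` T}) \<le> R"
    and \<tau>: "\<And>T x. T \<in> \<T> \<Longrightarrow> x \<in> T \<Longrightarrow> \<tau> x < s"
    and s: "s > 0" and th: "0 < \<theta>" "\<theta> \<le> 8" and NR: "N \<ge> 1" "R \<ge> 1"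
    and small: "8 * N * R * exp (- \<theta>\<^sup>2 * N / 64) \<le> 1"
  shows "\<exists>f. (\<forall>y. f y < s) \<and> (\<forall>T\<in>\<T>. \<bar>real (card {x\<in>T. f (\<pi> x) = \<tau> x}) - card T / s\<bar> \<le> \<theta> * N)"
proof -
  define I where "I = \<pi> ` \<Union>\<T>"
  have I: "finite I" using fT by (auto simp: I_def)
  define w where "w T y l = real (card {x\<in>T. \<pi> x = y \<and> \<tau> x = l})" for T y l
  define m where "m T y = real (card {x\<in>T. \<pi> x = y}) / s" for T y
  define sg where "sg b = (if b then 1 else - 1 :: real)" for b
  \<comment> \<open>The centred contribution of one variable. Up to four elements of a test may
    share it, whence the bound 4. The Boolean in \<open>k\<close> chooses between upper and lower
    deviation, so a two-sided estimate becomes two bad events.\<close>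
  define g where "g k y l = sg (snd k) * (w (fst k) y l - m (fst k) y)" for k y l
  define K where "K = \<T> \<times> (UNIV :: bool set)"
  define S where "S k = \<pi> ` fst k" for k :: "'x set \<times> bool"
  define B where "B k = {f\<in>labellings I s. (\<Sum>y\<in>S k. g k y (f y)) > \<theta> * N}" for k
  have finK: "finite K" using fT by (simp add: K_def)
  have SI: "S k \<subseteq> I" if "k \<in> K" for k
    unfolding S_def I_def using that by (intro image_mono Union_upper) (auto simp: K_def)
  have finS: "finite (S k)" if "k \<in> K" for k using SI[OF that] I finite_subset by blast
  have cS: "real (card (S k)) \<le> N" if "k \<in> K" for k
  proof -
    have k: "fst k \<in> \<T>" using that by (auto simp: K_def)
    have "card (S k) \<le> card (fst k)" unfolding S_def using fT(2)[OF k] by (rule card_image_le)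
    then show ?thesis using cT[OF k] by linarith
  qed
  have sumw: "(\<Sum>l<s. w T y l) = card {x\<in>T. \<pi> x = y}" if "T \<in> \<T>" for T y
  proof -
    have "{x\<in>T. \<pi> x = y} = (\<Union>l<s. {x\<in>T. \<pi> x = y \<and> \<tau> x = l})" using \<tau>[OF that] by auto
    then have "card {x\<in>T. \<pi> x = y} = card (\<Union>l<s. {x\<in>T. \<pi> x = y \<and> \<tau> x = l})" by simp
    also have "\<dots> = (\<Sum>l<s. card {x\<in>T. \<pi> x = y \<and> \<tau> x = l})"
      using fT(2)[OF that] by (intro card_UN_disjoint) auto
    finally show ?thesis by (simp add: w_def)
  qed
  have det: "determined_by (labellings I s) (S k) (B k)" for k
    unfolding determined_by_def
  proof (intro conjI ballI impI)
    fix f h assume "f \<in> B k" "h \<in> labellings I s" "\<forall>i\<in>S k. f i = h i"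
    moreover from this have "(\<Sum>y\<in>S k. g k y (f y)) = (\<Sum>y\<in>S k. g k y (h y))" by (intro sum.cong) auto
    ultimately show "h \<in> B k" by (auto simp: B_def)
  qed (auto simp: B_def)
  let ?p = "exp (- \<theta>\<^sup>2 * N / 64)"
  have pB: "real (card (B k)) \<le> ?p * card (labellings I s)" if k: "k \<in> K" for k
    unfolding B_def
  proof (rule hoeffding_count[OF I SI[OF k] cS[OF k] s _ _ th])
    have kT: "fst k \<in> \<T>" using k by (auto simp: K_def)
    fix y
    show "(\<Sum>l<s. g k y l) = 0"
      using sumw[OF kT, of y] s by (simp add: g_def m_def sum_distrib_left[symmetric] sum_subtractf)
    fix l
    have "w (fst k) y l \<le> card {x\<in>fst k. \<pi> x = y}" unfolding w_def
      using fT(2)[OF kT] by (intro of_nat_mono card_mono) auto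
    moreover have "real (card {x\<in>fst k. \<pi> x = y}) \<le> 4" using fib[OF kT, of y] by linarith
    moreover have "m (fst k) y \<le> real (card {x\<in>fst k. \<pi> x = y})" using s by (simp add: m_def divide_le_eq mult_le_cancel_left1)
    moreover have "0 \<le> w (fst k) y l" "0 \<le> m (fst k) y" by (auto simp: w_def m_def)
    ultimately show "\<bar>g k y l\<bar> \<le> 4" by (auto simp: g_def sg_def abs_mult)
  qed
  \<comment> \<open>A test uses at most \<open>N\<close> variables, each occurring in at most
    \<open>R\<close> tests, and every test gives two events.\<close>
  have D: "card {j\<in>K. S j \<inter> S k \<noteq> {}} \<le> nat \<lfloor>2 * N * R\<rfloor>" if k: "k \<in> K" for k
  proof -
    have "{j\<in>K. S j \<inter> S k \<noteq> {}} \<subseteq> (\<Union>y\<in>S k. {T\<in>\<T>. y \<in> \<pi> ` T} \<times> UNIV)"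
    proof
      fix j assume j: "j \<in> {j\<in>K. S j \<inter> S k \<noteq> {}}"
      then have "S j \<inter> S k \<noteq> {}" "fst j \<in> \<T>" by (auto simp: K_def)
      then obtain y where y: "y \<in> S k" "y \<in> \<pi> ` fst j" by (auto simp only: S_def)
      have "j \<in> {T\<in>\<T>. y \<in> \<pi> ` T} \<times> UNIV" using y \<open>fst j \<in> \<T>\<close> by (simp add: mem_Times_iff)
      then show "j \<in> (\<Union>y\<in>S k. {T\<in>\<T>. y \<in> \<pi> ` T} \<times> UNIV)" using y(1) by blast
    qed
    then have "card {j\<in>K. S j \<inter> S k \<noteq> {}} \<le> card (\<Union>y\<in>S k. {T\<in>\<T>. y \<in> \<pi> ` T} \<times> (UNIV :: bool set))"
      using finS[OF k] fT by (intro card_mono) auto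
    also have "\<dots> \<le> (\<Sum>y\<in>S k. card ({T\<in>\<T>. y \<in> \<pi> ` T} \<times> (UNIV :: bool set)))"
      using finS[OF k] by (rule card_UN_le)
    also have "\<dots> = (\<Sum>y\<in>S k. 2 * card {T\<in>\<T>. y \<in> \<pi> ` T})"
      by (simp add: card_cartesian_product mult.commute)
    finally have "card {j\<in>K. S j \<inter> S k \<noteq> {}} \<le> (\<Sum>y\<in>S k. 2 * card {T\<in>\<T>. y \<in> \<pi> ` T})" .
    from of_nat_mono[OF this, where 'a = real]
    have "real (card {j\<in>K. S j \<inter> S k \<noteq> {}}) \<le> (\<Sum>y\<in>S k. 2 * real (card {T\<in>\<T>. y \<in> \<pi> ` T}))" by simp
    also have "\<dots> \<le> (\<Sum>y\<in>S k. 2 * R)" using R by (intro sum_mono) auto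
    also have "\<dots> \<le> N * (2 * R)" using cS[OF k] NR by simp
    finally show ?thesis using NR by (intro le_nat_floor) (simp add: mult_ac)
  qed
  have "4 * ?p * nat \<lfloor>2 * N * R\<rfloor> \<le> 4 * ?p * (2 * N * R)"
    using NR by (intro mult_left_mono) auto
  moreover have eq: "4 * ?p * (2 * N * R) = 8 * N * R * ?p" by (simp add: mult_ac)
  ultimately have pD: "4 * ?p * nat \<lfloor>2 * N * R\<rfloor> \<le> 1" using small by linarith
  have "1 * 1 \<le> N * R" using NR by (intro mult_mono) auto
  then have "4 * ?p * 1 \<le> 4 * ?p * (2 * N * R)" by (intro mult_left_mono) auto
  then have p1: "4 * ?p \<le> 1" using small eq by linarith
  have "\<exists>f\<in>labellings I s. \<forall>k\<in>K. f \<notin> B k"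
    by (rule lovasz_local_lemma[OF I s finK det pB D pD p1]) simp_all
  then obtain f where f: "f \<in> labellings I s" "\<forall>k\<in>K. f \<notin> B k" by blast
  \<comment> \<open>The default 0 makes the values smaller than \<open>s\<close> everywhere, also
    off \<open>I\<close>.\<close>
  define f' where "f' y = (if y \<in> I then f y else 0)" for y
  have "f' y < s" for y using f(1) s by (auto simp: f'_def labellings_def PiE_iff)
  moreover have "\<bar>real (card {x\<in>T. f' (\<pi> x) = \<tau> x}) - card T / s\<bar> \<le> \<theta> * N" if T: "T \<in> \<T>" for T
  proof -
    have SS: "S (T, b) = \<pi> ` T" for b by (simp add: S_def)
    have le: "(\<Sum>y\<in>\<pi> ` T. g (T, b) y (f y)) \<le> \<theta> * N" for b
      using f T unfolding B_def K_def by (auto simp: not_less SS)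
    have finT: "finite T" using fT T by auto
    have "card {x\<in>T. f' (\<pi> x) = \<tau> x} = card (\<Union>y\<in>\<pi> ` T. {x\<in>T. \<pi> x = y \<and> \<tau> x = f y})"
      using T by (intro arg_cong[of _ _ card]) (auto simp: f'_def I_def)
    also have "\<dots> = (\<Sum>y\<in>\<pi> ` T. card {x\<in>T. \<pi> x = y \<and> \<tau> x = f y})"
      using finT by (intro card_UN_disjoint) auto
    finally have 1: "real (card {x\<in>T. f' (\<pi> x) = \<tau> x}) = (\<Sum>y\<in>\<pi> ` T. w T y (f y))" by (simp add: w_def)
    have "card T = card (\<Union>y\<in>\<pi> ` T. {x\<in>T. \<pi> x = y})" by (intro arg_cong[of _ _ card]) auto
    also have "\<dots> = (\<Sum>y\<in>\<pi> ` T. card {x\<in>T. \<pi> x = y})" using finT by (intro card_UN_disjoint) auto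
    finally have 2: "real (card T) / s = (\<Sum>y\<in>\<pi> ` T. m T y)" by (simp add: m_def sum_divide_distrib)
    show ?thesis using le[of True] le[of False]
      by (simp add: 1 2 g_def sg_def sum_subtractf abs_le_iff)
  qed
  ultimately show ?thesis by blast
qed

section \<open>Pseudorandom bipartite graphs\<close>

definition nb :: "'a set set \<Rightarrow> 'a \<Rightarrow> 'a set" where
  "nb E v = {u. {v, u} \<in> E}"

lemma nb_sym: "u \<in> nb E v \<longleftrightarrow> v \<in> nb E u"
  by (simp add: nb_def insert_commute)

lemma nb_neq: "edges E \<Longrightarrow> u \<in> nb E v \<Longrightarrow> u \<noteq> v"
  by (auto simp: nb_def edges_def)

lemma nb_subset: "nb E v \<subseteq> \<Union>E"
  by (auto simp: nb_def)

lemma edges_incident: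
  assumes E: "edges E"
  shows "{e\<in>E. v \<in> e} = (\<lambda>u. {v, u}) ` nb E v"
proof (intro equalityI subsetI)
  fix e assume e: "e \<in> {e\<in>E. v \<in> e}"
  then have "card e = 2" using E by (auto simp: edges_def)
  then obtain a b where ab: "e = {a, b}" by (meson card_2_iff)
  then consider "e = {v, b}" | "e = {v, a}" using e by auto
  then show "e \<in> (\<lambda>u. {v, u}) ` nb E v" using e by cases (auto simp: nb_def)
qed (auto simp: nb_def)

lemma finite_nb: "edges E \<Longrightarrow> finite (nb E v)"
  using nb_subset[of E v] edges_finite[of E] by (meson edgesD(2) finite_Union finite_subset)

lemma card_nb: "edges E \<Longrightarrow> card (nb E v) = deg E v"
  unfolding deg_def edges_incident by (subst card_image) (auto simp: inj_on_def doubleton_eq_iff)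

lemma nb_cross:
  assumes E: "edges E"
  shows "nb {e\<in>E. card (e \<inter> A) = 1} v = (if v \<in> A then nb E v - A else nb E v \<inter> A)"
proof -
  have "card ({v, u} \<inter> A) = 1 \<longleftrightarrow> (v \<in> A \<longleftrightarrow> u \<notin> A)" if "u \<in> nb E v" for u
    using nb_neq[OF E that] by (cases "v \<in> A"; cases "u \<in> A") auto
  then have "{u\<in>nb E v. card ({v, u} \<inter> A) = 1} = {u\<in>nb E v. v \<in> A \<longleftrightarrow> u \<notin> A}" by blast
  moreover have "nb {e\<in>E. card (e \<inter> A) = 1} v = {u\<in>nb E v. card ({v, u} \<inter> A) = 1}" by (auto simp only: nb_def mem_Collect_eq)
  ultimately show ?thesis by auto
qed

lemma nb_inner:
  assumes E: "edges E"
  shows "nb {e\<in>E. card (e \<inter> A) \<noteq> 1} v = (if v \<in> A then nb E v \<inter> A else nb E v - A)"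
proof -
  have "card ({v, u} \<inter> A) = 1 \<longleftrightarrow> (v \<in> A \<longleftrightarrow> u \<notin> A)" if "u \<in> nb E v" for u
    using nb_neq[OF E that] by (cases "v \<in> A"; cases "u \<in> A") auto
  then have "{u\<in>nb E v. card ({v, u} \<inter> A) \<noteq> 1} = {u\<in>nb E v. v \<in> A \<longleftrightarrow> u \<in> A}" by blast
  moreover have "nb {e\<in>E. card (e \<inter> A) \<noteq> 1} v = {u\<in>nb E v. card ({v, u} \<inter> A) \<noteq> 1}" by (auto simp only: nb_def mem_Collect_eq)
  ultimately show ?thesis by auto
qed

text \<open>The side of a vertex is decided by one coin per pair 2k, 2k+1, so the two sides have equal
  size for every outcome.\<close>
lemma balanced_halving:
  fixes E :: "nat set set" and N \<theta> :: real
  assumes E: "edges E" and V: "\<Union>E \<subseteq> {..<n}" and n: "even n" and d: "\<And>v. real (deg E v) \<le> N"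
    and th: "0 < \<theta>" "\<theta> \<le> 8" and N: "N \<ge> 1" and small: "8 * N * (2 * N) * exp (- \<theta>\<^sup>2 * N / 64) \<le> 1"
  shows "\<exists>A\<subseteq>{..<n}. card A = n div 2 \<and> (\<forall>v. \<bar>real (card (nb E v \<inter> A)) - deg E v / 2\<bar> \<le> \<theta> * N)"
proof -
  let ?T = "nb E ` {..<n}"
  \<comment> \<open>\<open>f y\<close> tells which of \<open>2 * y\<close> and
    \<open>2 * y + 1\<close> enters \<open>A\<close>, so the test for \<open>x\<close> asks whether
    \<open>x\<close> lies in \<open>A\<close>. The tests are the neighbourhoods; a variable touches
    only those centred at neighbours of its two vertices.\<close>
  have "\<exists>f :: nat \<Rightarrow> nat. (\<forall>y. f y < 2) \<and> (\<forall>T\<in>?T. \<bar>real (card {x\<in>T. f (x div 2) = x mod 2}) - card T / real 2\<bar> \<le> \<theta> * N)"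
  proof (rule random_labelling[where R = "2 * N"])
    show "card {x\<in>T. x div 2 = y} \<le> 4" for T and y :: nat
    proof -
      have "{x\<in>T. x div 2 = y} \<subseteq> {2 * y, 2 * y + 1}" by auto
      then have "card {x\<in>T. x div 2 = y} \<le> card {2 * y, 2 * y + 1}" by (intro card_mono) auto
      also have "\<dots> \<le> 4" by simp
      finally show ?thesis .
    qed
    show "real (card {T\<in>?T. y \<in> (\<lambda>x. x div 2) ` T}) \<le> 2 * N" for y :: nat
    proof -
      let ?W = "nb E (2 * y) \<union> nb E (2 * y + 1)"
      have "{T\<in>?T. y \<in> (\<lambda>x. x div 2) ` T} \<subseteq> nb E ` ?W"
      proof
        fix T assume "T \<in> {T\<in>?T. y \<in> (\<lambda>x. x div 2) ` T}"
        then obtain v u where v: "T = nb E v" "u \<in> nb E v" "y = u div 2" by auto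
        have "u = 2 * y \<or> u = 2 * y + 1" using v(3) by auto
        then have "v \<in> ?W" using v(2) nb_sym[of u E v] by auto
        then show "T \<in> nb E ` ?W" using v by auto
      qed
      then have "card {T\<in>?T. y \<in> (\<lambda>x. x div 2) ` T} \<le> card (nb E ` ?W)"
        using finite_nb[OF E] by (intro card_mono) auto
      also have "\<dots> \<le> card ?W" using finite_nb[OF E] by (intro card_image_le) auto
      also have "\<dots> \<le> deg E (2 * y) + deg E (2 * y + 1)"
        using card_Un_le[of "nb E (2*y)" "nb E (2*y+1)"] by (simp add: card_nb[OF E])
      finally show ?thesis using d[of "2 * y"] d[of "2 * y + 1"] by linarith
    qed
    show "8 * N * (2 * N) * exp (- \<theta>\<^sup>2 * N / 64) \<le> 1" by fact
  qed (use th N d in \<open>auto simp: finite_nb[OF E] card_nb[OF E]\<close>)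
  then obtain f :: "nat \<Rightarrow> nat" where f: "\<And>y. f y < 2"
    and fT: "\<And>v. v < n \<Longrightarrow> \<bar>real (card {x\<in>nb E v. f (x div 2) = x mod 2}) - card (nb E v) / 2\<bar> \<le> \<theta> * N"
    by auto
  define A where "A = {u\<in>{..<n}. f (u div 2) = u mod 2}"
  have "bij_betw (\<lambda>k. 2 * k + f k) {..<n div 2} A"
  proof (rule bij_betw_byWitness[where f' = "\<lambda>u. u div 2"])
    have fm: "(2 * k + f k) div 2 = k" "(2 * k + f k) mod 2 = f k" for k using f[of k] by auto
    show "\<forall>k\<in>{..<n div 2}. (2 * k + f k) div 2 = k" using fm by blast
    show "\<forall>u\<in>A. 2 * (u div 2) + f (u div 2) = u" by (auto simp: A_def)
    show "(\<lambda>k. 2 * k + f k) ` {..<n div 2} \<subseteq> A"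
    proof
      fix u assume "u \<in> (\<lambda>k. 2 * k + f k) ` {..<n div 2}"
      then obtain k where k: "k < n div 2" "u = 2 * k + f k" by auto
      then have "u < n" using f[of k] n by (auto elim!: evenE)
      then show "u \<in> A" using fm[of k] k by (simp add: A_def)
    qed
    show "(\<lambda>u. u div 2) ` A \<subseteq> {..<n div 2}" using n by (auto simp: A_def elim!: evenE)
  qed
  then have "card {..<n div 2} = card A" by (rule bij_betw_same_card)
  then have cA: "card A = n div 2" by simp
  have "\<bar>real (card (nb E v \<inter> A)) - deg E v / 2\<bar> \<le> \<theta> * N" for v
  proof (cases "v < n")
    case True
    have "nb E v \<inter> A = {x\<in>nb E v. f (x div 2) = x mod 2}"
      using nb_subset[of E v] V by (auto simp: A_def)
    then show ?thesis using fT[OF True] by (simp add: card_nb[OF E])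
  next
    case False
    have "nb E v = {}"
    proof (rule ccontr)
      assume "nb E v \<noteq> {}"
      then have "v \<in> \<Union>E" by (auto simp: nb_def)
      then show False using V False by auto
    qed
    then show ?thesis using card_nb[OF E, of v] th N by simp
  qed
  then show ?thesis using cA by (intro exI[of _ A]) (auto simp: A_def)
qed

text \<open>A substitute for Vizing's theorem up to a small error. The cross edges of a halving are
  bipartite and cost about \<open>x / 2\<close> colours by Koenig; the inner edges of both sides
  form one graph of about half the degree, to which the induction applies. Only at the bottom is the
  greedy factor 2 paid, whence the term \<open>x / 2 ^ k\<close>. Each level loses at most
  \<open>3 * \<theta> * N\<close>.\<close>

lemma colouring_by_halving:
  fixes E :: "nat set set" and N \<theta> :: real
  assumes n: "even n" and th: "0 < \<theta>" "\<theta> \<le> 1/2" and N: "N \<ge> 1"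
    and small: "8 * N * (2 * N) * exp (- \<theta>\<^sup>2 * N / 64) \<le> 1"
    and "edges E" and "\<Union>E \<subseteq> {..<n}" and "0 \<le> x" "x \<le> N" and "\<And>v. real (deg E v) \<le> x"
  shows "\<exists>q c. colouring E q c \<and> real q \<le> x + x / 2 ^ k + 3 * k * \<theta> * N"
  using assms(6-)
proof (induction k arbitrary: E x)
  case 0
  have "\<forall>v. deg E v \<le> nat \<lfloor>x\<rfloor>" using 0 by (auto intro: le_nat_floor)
  then obtain c where "colouring E (2 * nat \<lfloor>x\<rfloor>) c" using greedy_colouring 0 by blast
  then show ?case using 0 by (intro exI[of _ "2 * nat \<lfloor>x\<rfloor>"] exI[of _ c]) auto
next
  case (Suc k)
  note E = Suc.prems(1)
  have dN: "real (deg E v) \<le> N" for v using Suc.prems(4) Suc.prems(5)[of v] by linarith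
  obtain A where A: "\<And>v. \<bar>real (card (nb E v \<inter> A)) - deg E v / 2\<bar> \<le> \<theta> * N"
    using balanced_halving[OF E Suc.prems(2) n dN th(1) _ N small] th by auto
  let ?X = "{e\<in>E. card (e \<inter> A) = 1}" and ?I = "{e\<in>E. card (e \<inter> A) \<noteq> 1}"
  define y where "y = x / 2 + \<theta> * N"
  have XI: "E = ?X \<union> ?I" "?X \<inter> ?I = {}" by auto
  have eX: "edges ?X" and eI: "edges ?I" using E by (auto intro: edges_subset)
  have cd: "real (card (nb E v - A)) = deg E v - card (nb E v \<inter> A)" for v
    using card_Int_Diff[OF finite_nb[OF E, of v], of A] card_nb[OF E, of v] by simp
  have dX: "real (deg ?X v) \<le> y" for v
    using A[of v] cd[of v] Suc.prems(5)[of v] unfolding card_nb[OF eX, symmetric] nb_cross[OF E]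
    by (auto simp: y_def abs_le_iff)
  have dI: "real (deg ?I v) \<le> y" for v
    using A[of v] cd[of v] Suc.prems(5)[of v] unfolding card_nb[OF eI, symmetric] nb_inner[OF E]
    by (auto simp: y_def abs_le_iff)
  have y: "0 \<le> y" using Suc.prems th N by (simp add: y_def)
  have "\<theta> * N \<le> 1/2 * N" using th N by (intro mult_right_mono) auto
  then have yN: "y \<le> N" using Suc.prems by (simp add: y_def)
  have "\<forall>v. deg ?X v \<le> nat \<lfloor>y\<rfloor>" using dX by (auto intro: le_nat_floor)
  then obtain c where c: "colouring ?X (nat \<lfloor>y\<rfloor>) c" using koenig_colouring[OF eX, of A] by auto
  have "\<Union>?I \<subseteq> {..<n}" using Suc.prems by auto
  then obtain q c' where c': "colouring ?I q c'" "real q \<le> y + y / 2 ^ k + 3 * k * \<theta> * N"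
    using Suc.IH[OF eI _ y yN dI] by auto
  have "colouring E (nat \<lfloor>y\<rfloor> + q) (\<lambda>e. if e \<in> ?X then c e else nat \<lfloor>y\<rfloor> + c' e)"
    using colouring_Un[OF c c'(1) XI(2)] XI(1) by simp
  moreover have "real (nat \<lfloor>y\<rfloor> + q) \<le> x + x / 2 ^ Suc k + 3 * real (Suc k) * \<theta> * N"
  proof -
    have "real (nat \<lfloor>y\<rfloor>) \<le> y" using y by simp
    moreover have "y / 2 ^ k \<le> x / 2 ^ Suc k + \<theta> * N"
    proof -
      have "y / 2 ^ k = x / 2 ^ Suc k + \<theta> * N / 2 ^ k" by (simp add: y_def field_simps)
      also have "\<theta> * N / 2 ^ k \<le> \<theta> * N / 1" using th N by (intro divide_left_mono) auto
      finally show ?thesis by simp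
    qed
    ultimately show ?thesis using c'(2) by (simp add: y_def algebra_simps)
  qed
  ultimately show ?case by (intro exI conjI)
qed

section \<open>Perfect matchings from an upper bound on edge counts\<close>

definition edge_bound :: "'a set set \<Rightarrow> 'a set \<Rightarrow> real \<Rightarrow> real \<Rightarrow> bool" where
  "edge_bound E V \<alpha> \<kappa> \<longleftrightarrow> (\<forall>X\<subseteq>V. \<forall>Y\<subseteq>V. real (card {(x, y). x \<in> X \<and> y \<in> Y \<and> {x, y} \<in> E})
     \<le> \<alpha> * card X * card Y + \<kappa> * sqrt (real (card X) * real (card Y)))"

lemma edge_bound_subset:
  assumes b: "edge_bound E V \<alpha> \<kappa>" and V: "finite V" and F: "F \<subseteq> E"
  shows "edge_bound F V \<alpha> \<kappa>"
  unfolding edge_bound_def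
proof (intro allI impI)
  fix X Y assume XY: "X \<subseteq> V" "Y \<subseteq> V"
  have "card {(x, y). x \<in> X \<and> y \<in> Y \<and> {x, y} \<in> F} \<le> card {(x, y). x \<in> X \<and> y \<in> Y \<and> {x, y} \<in> E}"
  proof (rule card_mono)
    show "finite {(x, y). x \<in> X \<and> y \<in> Y \<and> {x, y} \<in> E}"
      by (rule finite_subset[of _ "V \<times> V"]) (use XY V in auto)
  qed (use F in auto)
  then have "real (card {(x, y). x \<in> X \<and> y \<in> Y \<and> {x, y} \<in> F}) \<le> real (card {(x, y). x \<in> X \<and> y \<in> Y \<and> {x, y} \<in> E})"
    by (rule of_nat_mono)
  also have "\<dots> \<le> \<alpha> * card X * card Y + \<kappa> * sqrt (real (card X) * real (card Y))"
    using b XY unfolding edge_bound_def by blast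
  finally show "real (card {(x, y). x \<in> X \<and> y \<in> Y \<and> {x, y} \<in> F})
     \<le> \<alpha> * card X * card Y + \<kappa> * sqrt (real (card X) * real (card Y))" .
qed

text \<open>If \<open>T\<close> were smaller than \<open>S\<close>, the bound would allow at most
  \<open>\<alpha> * h / 2 + \<kappa>\<close> pairs per vertex of \<open>S\<close>, while each sends
  at least \<open>a\<close> into \<open>T\<close>. Halving \<open>h\<close> here is what makes the
  two cases of Hall's condition fit together.\<close>

lemma no_contracting_set:
  assumes b: "edge_bound C V \<alpha> \<kappa>" and V: "finite V" and S: "S \<subseteq> V" and T: "T \<subseteq> V"
    and land: "\<And>v. v \<in> S \<Longrightarrow> nb C v \<inter> U \<subseteq> T"
    and a: "\<And>v. v \<in> S \<Longrightarrow> real (card (nb C v \<inter> U)) \<ge> a"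
    and h: "2 * real (card T) \<le> h" and gt: "a > \<alpha> * h / 2 + \<kappa>" and pos: "0 \<le> \<alpha>" "0 \<le> \<kappa>"
  shows "card S \<le> card T"
proof (rule ccontr)
  assume "\<not> ?thesis"
  then have lt: "card T < card S" by simp
  have fin: "finite S" "finite T" using S T V finite_subset by auto
  let ?P = "{(x, y). x \<in> S \<and> y \<in> T \<and> {x, y} \<in> C}"
  have "?P = (SIGMA x:S. nb C x \<inter> T)" by (auto simp: nb_def)
  then have "card ?P = (\<Sum>x\<in>S. card (nb C x \<inter> T))" using fin by simp
  then have "real (card ?P) = (\<Sum>x\<in>S. real (card (nb C x \<inter> T)))" by simp
  also have "\<dots> \<ge> (\<Sum>x\<in>S. a)"
  proof (rule sum_mono)
    fix x assume x: "x \<in> S"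
    have "card (nb C x \<inter> U) \<le> card (nb C x \<inter> T)" using land[OF x] fin by (intro card_mono) auto
    then show "a \<le> real (card (nb C x \<inter> T))" using a[OF x] by linarith
  qed
  finally have 1: "card S * a \<le> card ?P" by simp
  have "real (card ?P) \<le> \<alpha> * card S * card T + \<kappa> * sqrt (real (card S) * real (card T))"
    using b S T unfolding edge_bound_def by blast
  also have "sqrt (real (card S) * real (card T)) \<le> sqrt (real (card S) * real (card S))"
    using lt by (intro real_sqrt_le_mono mult_left_mono) auto
  then have "\<kappa> * sqrt (real (card S) * real (card T)) \<le> \<kappa> * card S"
    using pos by (intro mult_left_mono) auto
  also have "\<alpha> * card S * card T \<le> \<alpha> * card S * (h / 2)" using h pos by (intro mult_left_mono) auto
  finally have "card S * a \<le> card S * (\<alpha> * h / 2 + \<kappa>)" using 1 by (simp add: algebra_simps)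
  moreover have "real (card S) > 0" using lt by linarith
  ultimately show False using gt by simp
qed

text \<open>A small neighbourhood is excluded as a contracting image directly. If the neighbourhood
  of \<open>S\<close> exceeds \<open>h / 2\<close>, the complements are considered instead: vertices
  outside the neighbourhood send all their edges to the complement of \<open>S\<close>, which is
  then small.\<close>

lemma pseudorandom_perfect_matching:
  assumes b: "edge_bound C V \<alpha> \<kappa>" and V: "finite V" and C: "edges C"
    and cross: "\<And>e. e \<in> C \<Longrightarrow> card (e \<inter> A) = 1" and U: "U \<subseteq> V"
    and bal: "card (U \<inter> A) = card (U - A)" and h: "real (card (U \<inter> A)) \<le> h"
    and a: "\<And>v. v \<in> U \<Longrightarrow> real (card (nb C v \<inter> U)) \<ge> a"
    and gt: "a > \<alpha> * h / 2 + \<kappa>" and pos: "0 \<le> \<alpha>" "0 \<le> \<kappa>"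
  shows "\<exists>M\<subseteq>C. matching M \<and> \<Union>M = U"
proof -
  let ?X = "U \<inter> A" and ?Y = "U - A"
  have finU: "finite U" using U V finite_subset by blast
  have side: "u \<in> A \<longleftrightarrow> v \<notin> A" if "u \<in> nb C v" for u v
  proof -
    have "card ({v, u} \<inter> A) = 1" using cross that by (auto simp: nb_def)
    then show ?thesis using nb_neq[OF C that] by (cases "v \<in> A"; cases "u \<in> A") auto
  qed
  have hall: "card S \<le> card (\<Union>x\<in>S. nb C x \<inter> U)" if S: "S \<subseteq> ?X" for S
  proof -
    let ?T = "\<Union>x\<in>S. nb C x \<inter> U"
    have TY: "?T \<subseteq> ?Y" using S side by blast
    have finT: "finite ?T" using TY finU by (meson finite_Diff finite_subset)
    show ?thesis
    proof (cases "2 * real (card ?T) \<le> h")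
      case True
      show ?thesis
      proof (rule no_contracting_set[OF b V])
        show "real (card (nb C v \<inter> U)) \<ge> a" if "v \<in> S" for v using a[of v] S that by auto
      qed (use S U True gt pos in auto)
    next
      case False
      show ?thesis
      proof (rule ccontr)
        assume "\<not> ?thesis"
        then have lt: "card ?T < card S" by simp
        have finS: "finite S" using S finU finite_subset by blast
        have c1: "card (?X - S) + card S = card ?X" using S finU by (metis card_Diff_subset card_mono finS finite_Int le_add_diff_inverse2)
        have c2: "card (?Y - ?T) + card ?T = card ?Y" using TY finU by (metis card_Diff_subset card_mono finT finite_Diff le_add_diff_inverse2)
        have "card (?Y - ?T) \<le> card (?X - S)"
        proof (rule no_contracting_set[OF b V])
          show "nb C v \<inter> U \<subseteq> ?X - S" if v: "v \<in> ?Y - ?T" for v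
          proof
            fix u assume u: "u \<in> nb C v \<inter> U"
            then have "u \<in> A" using side[of u v] v by auto
            moreover have "u \<notin> S" using u v nb_sym[of u C v] by auto
            ultimately show "u \<in> ?X - S" using u by auto
          qed
          show "real (card (nb C v \<inter> U)) \<ge> a" if "v \<in> ?Y - ?T" for v using a[of v] that by auto
          show "2 * real (card (?X - S)) \<le> h" using False c1 lt h by linarith
        qed (use U gt pos in auto)
        then show False using c1 c2 bal lt by linarith
      qed
    qed
  qed
  obtain f where f: "inj_on f ?X" "\<And>x. x \<in> ?X \<Longrightarrow> f x \<in> nb C x \<inter> U"
    using hall_distinct_representatives[of ?X "\<lambda>x. nb C x \<inter> U"] hall finU by auto
  have fY: "f ` ?X \<subseteq> ?Y" using f(2) side by blast
  have "f ` ?X = ?Y"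
    using fY card_image[OF f(1)] bal finU by (intro card_subset_eq) auto
  define M where "M = (\<lambda>x. {x, f x}) ` ?X"
  have "M \<subseteq> C" using f(2) by (auto simp: M_def nb_def)
  moreover have "\<Union>M = U" using \<open>f ` ?X = ?Y\<close> by (auto simp: M_def)
  moreover have "matching M"
    unfolding matching_def
  proof (intro ballI impI)
    fix e g assume "e \<in> M" "g \<in> M" and ne: "e \<noteq> g"
    then obtain x y where xy: "x \<in> ?X" "y \<in> ?X" "e = {x, f x}" "g = {y, f y}" by (auto simp: M_def)
    have "x \<noteq> y" using ne xy by auto
    moreover have "f x \<noteq> f y" using \<open>x \<noteq> y\<close> f(1) xy by (auto simp: inj_on_def)
    moreover have "f x \<notin> A" "f y \<notin> A" using fY xy by auto
    ultimately show "e \<inter> g = {}" using xy by auto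
  qed
  ultimately show ?thesis by blast
qed

lemma deg_UN_le:
  assumes Q: "finite Q" and P: "\<And>i. i \<in> Q \<Longrightarrow> finite (P i)" "\<And>i. i \<in> Q \<Longrightarrow> matching (P i)"
  shows "deg (\<Union>i\<in>Q. P i) v \<le> card {i\<in>Q. v \<in> \<Union>(P i)}"
proof -
  have "{e\<in>(\<Union>i\<in>Q. P i). v \<in> e} = (\<Union>i\<in>Q. {e\<in>P i. v \<in> e})" by auto
  then have "deg (\<Union>i\<in>Q. P i) v \<le> (\<Sum>i\<in>Q. deg (P i) v)"
    unfolding deg_def using card_UN_le[OF Q] by simp
  also have "\<dots> = (\<Sum>i\<in>Q. if v \<in> \<Union>(P i) then 1 else 0)"
    using P by (intro sum.cong) (auto simp: deg_matching_le)
  also have "\<dots> = card {i\<in>Q. v \<in> \<Union>(P i)}" using Q by (simp add: sum.If_cases Int_def)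
  finally show ?thesis .
qed

text \<open>The matchings are chosen one after another. A vertex loses one edge for each earlier
  \<open>U i\<close> containing it, hence at most \<mu> in all, so a degree of at least
  \<open>a\<close> into the current set survives.\<close>

lemma extend_matchings:
  fixes U :: "'i \<Rightarrow> 'a set"
  assumes b: "edge_bound C V \<alpha> \<kappa>" and V: "finite V" and C: "edges C"
    and cross: "\<And>e. e \<in> C \<Longrightarrow> card (e \<inter> A) = 1" and Q: "finite Q"
    and U: "\<And>i. i \<in> Q \<Longrightarrow> U i \<subseteq> V" and bal: "\<And>i. i \<in> Q \<Longrightarrow> card (U i \<inter> A) = card (U i - A)"
    and h: "\<And>i. i \<in> Q \<Longrightarrow> real (card (U i \<inter> A)) \<le> h"
    and a: "\<And>i v. i \<in> Q \<Longrightarrow> v \<in> U i \<Longrightarrow> real (card (nb C v \<inter> U i)) \<ge> a + \<mu>"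
    and \<mu>: "\<And>v. v \<in> V \<Longrightarrow> real (card {i\<in>Q. v \<in> U i}) \<le> \<mu>"
    and gt: "a > \<alpha> * h / 2 + \<kappa>" and pos: "0 \<le> \<alpha>" "0 \<le> \<kappa>"
  shows "\<exists>P. (\<forall>i\<in>Q. P i \<subseteq> C \<and> matching (P i) \<and> \<Union>(P i) = U i) \<and>
    (\<forall>i\<in>Q. \<forall>j\<in>Q. i \<noteq> j \<longrightarrow> P i \<inter> P j = {})"
proof -
  have "\<exists>P. (\<forall>i\<in>R. P i \<subseteq> C \<and> matching (P i) \<and> \<Union>(P i) = U i) \<and>
    (\<forall>i\<in>R. \<forall>j\<in>R. i \<noteq> j \<longrightarrow> P i \<inter> P j = {})" if "R \<subseteq> Q" for R
  proof -
    have "finite R" using that Q finite_subset by blast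
    then show ?thesis using that
    proof (induction R rule: finite_induct)
      case empty
      then show ?case by simp
    next
      case (insert k R)
      have "R \<subseteq> Q" using insert.prems by auto
      from insert.IH[OF this] obtain P where P': "\<forall>i\<in>R. P i \<subseteq> C \<and> matching (P i) \<and> \<Union>(P i) = U i"
        and disj': "\<forall>i\<in>R. \<forall>j\<in>R. i \<noteq> j \<longrightarrow> P i \<inter> P j = {}"
        by (elim exE conjE)
      have P: "P i \<subseteq> C" "matching (P i)" "\<Union>(P i) = U i" if "i \<in> R" for i using P' that by auto
      have disj: "P i \<inter> P j = {}" if "i \<in> R" "j \<in> R" "i \<noteq> j" for i j using disj' that by auto
      have finP: "finite (P i)" if "i \<in> R" for i using P(1)[OF that] C finite_subset by (auto simp: edges_def)
      let ?W = "\<Union>i\<in>R. P i"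
      let ?C = "C - ?W"
      have eW: "edges ?W" using P(1) by (intro edges_subset[OF C]) auto
      have eC: "edges ?C" using C by (rule edges_subset) auto
      have kQ: "k \<in> Q" using insert by auto
      have "\<exists>M\<subseteq>?C. matching M \<and> \<Union>M = U k"
      proof (rule pseudorandom_perfect_matching[OF edge_bound_subset[OF b V] V eC _ U[OF kQ] bal[OF kQ] h[OF kQ] _ gt pos])
        fix v assume v: "v \<in> U k"
        have "nb C v \<inter> U k \<subseteq> (nb ?C v \<inter> U k) \<union> nb ?W v" by (auto simp: nb_def)
        then have "card (nb C v \<inter> U k) \<le> card ((nb ?C v \<inter> U k) \<union> nb ?W v)"
          using finite_nb[OF eC] finite_nb[OF eW] by (intro card_mono) auto
        also have "\<dots> \<le> card (nb ?C v \<inter> U k) + deg ?W v"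
          using card_Un_le[of "nb ?C v \<inter> U k" "nb ?W v"] by (simp only: card_nb[OF eW])
        also have "deg ?W v \<le> card {i\<in>R. v \<in> \<Union>(P i)}"
          using insert.hyps finP P(2) by (intro deg_UN_le) auto
        also have "{i\<in>R. v \<in> \<Union>(P i)} = {i\<in>R. v \<in> U i}" using P(3) by auto
        also have "card {i\<in>R. v \<in> U i} \<le> card {i\<in>Q. v \<in> U i}"
          using insert.prems Q by (intro card_mono) auto
        finally have "card (nb C v \<inter> U k) \<le> card (nb ?C v \<inter> U k) + card {i\<in>Q. v \<in> U i}" by simp
        moreover have "real (card {i\<in>Q. v \<in> U i}) \<le> \<mu>" using \<mu> U[OF kQ] v by auto
        ultimately show "a \<le> real (card (nb ?C v \<inter> U k))" using a[OF kQ v] by linarith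
      qed (use cross in auto)
      then obtain M where M: "M \<subseteq> ?C" "matching M" "\<Union>M = U k" by blast
      show ?case
      proof (intro exI[of _ "P(k := M)"] conjI ballI impI)
        fix i assume "i \<in> insert k R"
        then show "(P(k := M)) i \<subseteq> C" "matching ((P(k := M)) i)" "\<Union>((P(k := M)) i) = U i"
          using P[of i] M by (cases "i = k"; simp; blast)+
      next
        fix i j assume ij: "i \<in> insert k R" "j \<in> insert k R" "i \<noteq> j"
        have dM: "M \<inter> P l = {}" if "l \<in> R" for l using M(1) that by auto
        show "(P(k := M)) i \<inter> (P(k := M)) j = {}"
          using ij dM[of i] dM[of j] disj[of i j] by (cases "i = k"; cases "j = k") auto
      qed
    qed
  qed
  then show ?thesis by blast
qed

text \<open>Edges on the two sides are split in pairs, which keeps the parts balanced.\<close>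
lemma split_matchings:
  fixes MA MB :: "'i \<Rightarrow> 'a set set" and N \<theta> :: real
  assumes Q: "finite Q" "real (card Q) \<le> N"
    and MA: "\<And>i. i \<in> Q \<Longrightarrow> edges (MA i)" and MB: "\<And>i. i \<in> Q \<Longrightarrow> edges (MB i)"
    and disj: "\<And>i. i \<in> Q \<Longrightarrow> MA i \<inter> MB i = {}" and mat: "\<And>i. i \<in> Q \<Longrightarrow> matching (MA i \<union> MB i)"
    and bal: "\<And>i. i \<in> Q \<Longrightarrow> card (MA i) = card (MB i)"
    and C: "edges C" and dC: "\<And>v. real (deg C v) \<le> N" and V: "finite V" and s: "s > 0"
    and th: "0 < \<theta>" "\<theta> \<le> 8" and N: "N \<ge> 1"
    and small: "8 * N * (8 * N * real s) * exp (- \<theta>\<^sup>2 * N / 64) \<le> 1"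
  shows "\<exists>lab. \<forall>l<s. (\<forall>i\<in>Q. (\<forall>e. lab i e < s) \<and>
      card {e\<in>MA i. lab i e = l} = card {e\<in>MB i. lab i e = l} \<and>
      (\<forall>v\<in>V. \<bar>real (card (nb C v \<inter> \<Union>{e\<in>MA i \<union> MB i. lab i e = l})) -
         card (nb C v \<inter> \<Union>(MA i \<union> MB i)) / s\<bar> \<le> \<theta> * N)) \<and>
      (\<forall>v\<in>V. \<bar>real (card {i\<in>Q. v \<in> \<Union>{e\<in>MA i \<union> MB i. lab i e = l}}) -
         card {i\<in>Q. v \<in> \<Union>(MA i \<union> MB i)} / s\<bar> \<le> \<theta> * N)"
proof -
  let ?M = "\<lambda>i. MA i \<union> MB i"
  have fin: "finite (MA i)" "finite (MB i)" if "i \<in> Q" for i using MA[OF that] MB[OF that] by (auto simp: edges_def)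
  have "\<forall>i\<in>Q. \<exists>\<phi>. bij_betw \<phi> (MA i) (MB i)"
    using bal fin by (auto intro!: finite_same_card_bij)
  then obtain \<phi> where \<phi>: "\<And>i. i \<in> Q \<Longrightarrow> bij_betw (\<phi> i) (MA i) (MB i)" by metis
  \<comment> \<open>Paired edges share one random label, stored at the member of the pair in
    \<open>MA i\<close>; \<psi> finds this member.\<close>
  define \<psi> where "\<psi> i e = (if e \<in> MA i then e else inv_into (MA i) (\<phi> i) e)" for i e
  define ed where "ed i u = (THE e. e \<in> ?M i \<and> u \<in> e)" for i u
  have ed: "ed i u = e" if "i \<in> Q" "e \<in> ?M i" "u \<in> e" for i u e
    unfolding ed_def using that mat[OF that(1)] unfolding matching_def
    by (intro the_equality) auto
  have \<psi>: "e = \<psi> i e \<or> e = \<phi> i (\<psi> i e)" if "i \<in> Q" "e \<in> ?M i" for i e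
    using that \<phi>[OF that(1)] by (auto simp: \<psi>_def bij_betw_inv_into_right)
  have \<psi>MA: "\<psi> i e \<in> MA i" if "i \<in> Q" "e \<in> ?M i" for i e
    using that \<phi>[OF that(1)] by (auto simp: \<psi>_def bij_betw_def inv_into_into)
  have \<psi>\<phi>: "\<psi> i (\<phi> i e) = e" if "i \<in> Q" "e \<in> MA i" for i e
    using that \<phi>[OF that(1)] disj[OF that(1)]
    by (auto simp: \<psi>_def bij_betw_def inv_into_f_f disjoint_iff)
  \<comment> \<open>The four vertices of a pair. They bound the fibres of \<pi> and the number of
    tests a variable can influence.\<close>
  define W where "W i e = e \<union> \<phi> i e" for i e
  have W: "finite (W i e)" "card (W i e) \<le> 4" if "i \<in> Q" "e \<in> MA i" for i e
  proof -
    have c: "card e = 2" "card (\<phi> i e) = 2"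
      using MA[OF that(1)] MB[OF that(1)] that \<phi>[OF that(1)] by (auto simp: edges_def bij_betw_def)
    then show "card (W i e) \<le> 4" using card_Un_le[of e "\<phi> i e"] by (simp add: W_def)
    show "finite (W i e)" using c by (auto simp: W_def intro: card_ge_0_finite)
  qed
  have uW: "u \<in> W i (\<psi> i (ed i u)) \<and> \<psi> i (ed i u) \<in> MA i" if iQ: "i \<in> Q" and ui: "u \<in> \<Union>(?M i)" for i u
  proof -
    from ui obtain e where e: "e \<in> ?M i" "u \<in> e" by (rule UnionE)
    have eq: "ed i u = e" using ed[OF iQ e] .
    have "e = \<psi> i e \<or> e = \<phi> i (\<psi> i e)" by (rule \<psi>[OF iQ e(1)])
    then have "u \<in> \<psi> i e \<union> \<phi> i (\<psi> i e)" using e(2) by blast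
    then show ?thesis using \<psi>MA[OF iQ e(1)] by (simp add: W_def eq)
  qed
  \<comment> \<open>Two families of tests, with the label \<open>l\<close> carried in the elements
    so that \<tau> can read it off: \<open>T1\<close> counts neighbours of \<open>v\<close> covered
    by part \<open>l\<close> of matching \<open>i\<close>, and \<open>T2\<close> counts matchings
    whose part \<open>l\<close> covers \<open>v\<close>.\<close>
  define T1 where "T1 = (\<lambda>(v, i, l). {i} \<times> (nb C v \<inter> \<Union>(?M i)) \<times> {l::nat})"
  define T2 where "T2 = (\<lambda>(v, l). {i\<in>Q. v \<in> \<Union>(?M i)} \<times> {v} \<times> {l::nat})"
  define \<pi> where "\<pi> = (\<lambda>(i, u, l::nat). (i, \<psi> i (ed i u)))"
  define \<tau> where "\<tau> = (\<lambda>(i::'i, u::'a, l::nat). l)"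
  define \<T> where "\<T> = T1 ` (V \<times> Q \<times> {..<s}) \<union> T2 ` (V \<times> {..<s})"
  have fnb: "finite (nb C v)" for v by (rule finite_nb[OF C])
  have cT1: "card (T1 (v, i, l)) = card (nb C v \<inter> \<Union>(?M i))" for v i l
    by (simp add: T1_def card_cartesian_product)
  have cT2: "card (T2 (v, l)) = card {i\<in>Q. v \<in> \<Union>(?M i)}" for v l
    by (simp add: T2_def card_cartesian_product)
  have "\<exists>f. (\<forall>y. f y < s) \<and> (\<forall>T\<in>\<T>. \<bar>real (card {x\<in>T. f (\<pi> x) = \<tau> x}) - card T / s\<bar> \<le> \<theta> * N)"
  proof (rule random_labelling[where R = "8 * N * s"])
    show "finite \<T>" using Q V by (simp add: \<T>_def)
    show "finite T" if "T \<in> \<T>" for T using that Q fnb by (auto simp: \<T>_def T1_def T2_def)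
    show "real (card T) \<le> N" if T: "T \<in> \<T>" for T
    proof -
      consider v i l where "T = T1 (v, i, l)" | v l where "T = T2 (v, l)" using T by (auto simp: \<T>_def)
      then show ?thesis
      proof cases
        case 1
        have "card (nb C v \<inter> \<Union>(?M i)) \<le> card (nb C v)" using fnb by (intro card_mono) auto
        then show ?thesis using 1 cT1 dC[of v] by (simp add: card_nb[OF C])
      next
        case 2
        have "card {i\<in>Q. v \<in> \<Union>(?M i)} \<le> card Q" using Q by (intro card_mono) auto
        then show ?thesis using 2 cT2 Q by simp
      qed
    qed
    show "card {x\<in>T. \<pi> x = y} \<le> 4" if T: "T \<in> \<T>" for T y
    proof -
      obtain j e where y: "y = (j, e)" by (cases y)
      consider v i l where "T = T1 (v, i, l)" "i \<in> Q" | v l where "T = T2 (v, l)" using T by (auto simp: \<T>_def)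
      then show ?thesis
      proof cases
        case 1
        show ?thesis
        proof (cases "{x\<in>T. \<pi> x = y} = {}")
          case True
          then show ?thesis by (metis card.empty le0)
        next
          case False
          then have je: "j = i" "e \<in> MA i" using 1 uW by (auto simp: T1_def \<pi>_def y)
          have "{x\<in>T. \<pi> x = y} \<subseteq> {i} \<times> W i e \<times> {l}" using 1 uW by (auto simp: T1_def \<pi>_def y)
          then have "card {x\<in>T. \<pi> x = y} \<le> card ({i} \<times> W i e \<times> {l})"
            using W[OF 1(2) je(2)] by (intro card_mono) auto
          also have "\<dots> \<le> 4" using W[OF 1(2) je(2)] by (simp add: card_cartesian_product)
          finally show ?thesis .
        qed
      next
        case 2
        then have "{x\<in>T. \<pi> x = y} \<subseteq> {(j, v, l)}" by (auto simp: T2_def \<pi>_def y)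
        then have "card {x\<in>T. \<pi> x = y} \<le> card {(j, v, l)}" by (intro card_mono) auto
        then show ?thesis by simp
      qed
    qed
    \<comment> \<open>Each of the at most four vertices of the pair occurs in tests
      \<open>T1\<close> centred at its at most \<open>N\<close> neighbours and in \<open>T2\<close>
      at itself, for \<open>s\<close> labels: at most \<open>4 * N * s + 4 * s\<close>
      tests.\<close>
    show "real (card {T\<in>\<T>. y \<in> \<pi> ` T}) \<le> 8 * N * s" for y
    proof (cases "{T\<in>\<T>. y \<in> \<pi> ` T} = {}")
      case True
      then show ?thesis using N by (metis card.empty mult_nonneg_nonneg of_nat_0 of_nat_0_le_iff order_trans zero_le_numeral zero_le_one)
    next
      case False
      obtain j e where y: "y = (j, e)" by (cases y)
      have je: "j \<in> Q" "e \<in> MA j" using False uW by (auto simp: \<T>_def T1_def T2_def \<pi>_def y)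
      let ?S1 = "(\<Union>u\<in>W j e. nb C u) \<times> {j} \<times> {..<s}" and ?S2 = "W j e \<times> {..<s}"
      have "{T\<in>\<T>. y \<in> \<pi> ` T} \<subseteq> T1 ` ?S1 \<union> T2 ` ?S2"
      proof
        fix T assume T: "T \<in> {T\<in>\<T>. y \<in> \<pi> ` T}"
        then consider v i l where "T = T1 (v, i, l)" "i \<in> Q" "l < s" | v l where "T = T2 (v, l)" "l < s"
          by (auto simp: \<T>_def)
        then show "T \<in> T1 ` ?S1 \<union> T2 ` ?S2"
        proof cases
          case 1
          then obtain u where u: "u \<in> nb C v" "u \<in> \<Union>(?M i)" "j = i" "e = \<psi> i (ed i u)"
            using T by (auto simp: T1_def \<pi>_def y)
          then have "u \<in> W j e" "v \<in> nb C u" using uW[OF 1(2) u(2)] nb_sym[of u C v] by auto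
          then have "(v, i, l) \<in> ?S1" using 1 u by auto
          then show ?thesis using 1 by blast
        next
          case 2
          then have "v \<in> \<Union>(?M j)" "j \<in> Q" "e = \<psi> j (ed j v)"
            using T by (auto simp: T2_def \<pi>_def y)
          then have "v \<in> W j e" using uW[of j v] by auto
          then have "(v, l) \<in> ?S2" using 2 by auto
          then show ?thesis using 2 by blast
        qed
      qed
      then have "card {T\<in>\<T>. y \<in> \<pi> ` T} \<le> card (T1 ` ?S1 \<union> T2 ` ?S2)"
        using W[OF je] fnb by (intro card_mono) auto
      also have "\<dots> \<le> card (T1 ` ?S1) + card (T2 ` ?S2)" by (rule card_Un_le)
      also have "card (T1 ` ?S1) \<le> card ?S1" using W[OF je] fnb by (intro card_image_le) auto
      also have "card (T2 ` ?S2) \<le> card ?S2" using W[OF je] by (intro card_image_le) auto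
      finally have 1: "card {T\<in>\<T>. y \<in> \<pi> ` T} \<le> card (\<Union>u\<in>W j e. nb C u) * s + card (W j e) * s"
        by (simp add: card_cartesian_product)
      have "card (\<Union>u\<in>W j e. nb C u) \<le> (\<Sum>u\<in>W j e. card (nb C u))" using W[OF je] by (intro card_UN_le)
      from of_nat_mono[OF this, where 'a = real]
      have "real (card (\<Union>u\<in>W j e. nb C u)) \<le> (\<Sum>u\<in>W j e. real (deg C u))" by (simp add: card_nb[OF C])
      also have "\<dots> \<le> card (W j e) * N" using dC sum_bounded_above[of "W j e" "\<lambda>u. real (deg C u)" N] by simp
      also have "\<dots> \<le> 4 * N" using W[OF je] N by (intro mult_right_mono) auto
      finally have 2: "real (card (\<Union>u\<in>W j e. nb C u)) * s \<le> 4 * N * s" by (intro mult_right_mono) auto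
      have "real (card (W j e)) \<le> 4 * N" using W[OF je] N by linarith
      then have 3: "real (card (W j e)) * s \<le> 4 * N * s" by (intro mult_right_mono) auto
      from of_nat_mono[OF 1, where 'a = real] 2 3 show ?thesis by simp
    qed
    show "\<tau> x < s" if "T \<in> \<T>" "x \<in> T" for T x using that by (auto simp: \<T>_def T1_def T2_def \<tau>_def)
    have "1 * 1 \<le> 8 * N * s" using N s by (intro mult_mono) auto
    then show "1 \<le> 8 * N * s" by simp
  qed (use s th N small in auto)
  then obtain f where f: "\<And>y. f y < s"
    and fT: "\<And>T. T \<in> \<T> \<Longrightarrow> \<bar>real (card {x\<in>T. f (\<pi> x) = \<tau> x}) - card T / s\<bar> \<le> \<theta> * N" by blast
  define lab where "lab i e = f (i, \<psi> i e)" for i e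
  have cov: "u \<in> \<Union>{e\<in>?M i. lab i e = l} \<longleftrightarrow> u \<in> \<Union>(?M i) \<and> f (i, \<psi> i (ed i u)) = l" if "i \<in> Q" for i u l
  proof
    assume "u \<in> \<Union>{e\<in>?M i. lab i e = l}"
    then obtain e where e: "e \<in> ?M i" "u \<in> e" "lab i e = l" by blast
    then show "u \<in> \<Union>(?M i) \<and> f (i, \<psi> i (ed i u)) = l" using ed[OF that e(1,2)] by (auto simp: lab_def)
  next
    assume u: "u \<in> \<Union>(?M i) \<and> f (i, \<psi> i (ed i u)) = l"
    then obtain e where e: "e \<in> ?M i" "u \<in> e" by blast
    then have "lab i e = l" using u ed[OF that e] by (simp add: lab_def)
    then show "u \<in> \<Union>{e\<in>?M i. lab i e = l}" using e by blast
  qed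
  have 1: "card {e\<in>MA i. lab i e = l} = card {e\<in>MB i. lab i e = l}" if i: "i \<in> Q" for i l
  proof (rule bij_betw_same_card[of "\<phi> i"])
    have lab\<phi>: "lab i (\<phi> i e) = lab i e" if "e \<in> MA i" for e
      using that i by (simp add: lab_def \<psi>\<phi>) (simp add: \<psi>_def)
    have bij: "inj_on (\<phi> i) (MA i)" "MB i = \<phi> i ` MA i" using \<phi>[OF i] by (auto simp: bij_betw_def)
    have "{e\<in>MB i. lab i e = l} = \<phi> i ` {e\<in>MA i. lab i e = l}" unfolding bij(2) using lab\<phi> by force
    then show "bij_betw (\<phi> i) {e\<in>MA i. lab i e = l} {e\<in>MB i. lab i e = l}"
      using bij(1) unfolding bij_betw_def by (auto intro: inj_on_subset)
  qed
  have 2: "\<bar>real (card (nb C v \<inter> \<Union>{e\<in>?M i. lab i e = l})) - card (nb C v \<inter> \<Union>(?M i)) / s\<bar> \<le> \<theta> * N"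
    if "i \<in> Q" "v \<in> V" "l < s" for i v l
  proof -
    have "{x\<in>T1 (v, i, l). f (\<pi> x) = \<tau> x} = {i} \<times> (nb C v \<inter> \<Union>{e\<in>?M i. lab i e = l}) \<times> {l}"
    proof (intro equalityI subsetI)
      fix x assume "x \<in> {x\<in>T1 (v, i, l). f (\<pi> x) = \<tau> x}"
      then obtain u where "x = (i, u, l)" "u \<in> nb C v" "u \<in> \<Union>(?M i)" "f (i, \<psi> i (ed i u)) = l"
        by (auto simp: T1_def \<pi>_def \<tau>_def)
      then show "x \<in> {i} \<times> (nb C v \<inter> \<Union>{e\<in>?M i. lab i e = l}) \<times> {l}" using cov[OF that(1), of u l] by blast
    next
      fix x assume "x \<in> {i} \<times> (nb C v \<inter> \<Union>{e\<in>?M i. lab i e = l}) \<times> {l}"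
      then obtain u where u: "x = (i, u, l)" "u \<in> nb C v" "u \<in> \<Union>{e\<in>?M i. lab i e = l}" by blast
      then have "u \<in> \<Union>(?M i)" "f (i, \<psi> i (ed i u)) = l" using cov[OF that(1), of u l] by blast+
      then show "x \<in> {x\<in>T1 (v, i, l). f (\<pi> x) = \<tau> x}" using u by (auto simp only: T1_def \<pi>_def \<tau>_def mem_Collect_eq prod.case mem_Times_iff fst_conv snd_conv)
    qed
    moreover have "T1 (v, i, l) \<in> \<T>" using that by (auto simp: \<T>_def)
    ultimately show ?thesis using fT[of "T1 (v, i, l)"] by (simp add: card_cartesian_product cT1)
  qed
  have 3: "\<bar>real (card {i\<in>Q. v \<in> \<Union>{e\<in>?M i. lab i e = l}}) - card {i\<in>Q. v \<in> \<Union>(?M i)} / s\<bar> \<le> \<theta> * N"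
    if "v \<in> V" "l < s" for v l
  proof -
    have "{x\<in>T2 (v, l). f (\<pi> x) = \<tau> x} = {i\<in>Q. v \<in> \<Union>{e\<in>?M i. lab i e = l}} \<times> {v} \<times> {l}"
    proof (intro equalityI subsetI)
      fix x assume "x \<in> {x\<in>T2 (v, l). f (\<pi> x) = \<tau> x}"
      then obtain i where "x = (i, v, l)" "i \<in> Q" "v \<in> \<Union>(?M i)" "f (i, \<psi> i (ed i v)) = l"
        by (auto simp: T2_def \<pi>_def \<tau>_def)
      then show "x \<in> {i\<in>Q. v \<in> \<Union>{e\<in>?M i. lab i e = l}} \<times> {v} \<times> {l}" using cov[of i v l] by blast
    next
      fix x assume "x \<in> {i\<in>Q. v \<in> \<Union>{e\<in>?M i. lab i e = l}} \<times> {v} \<times> {l}"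
      then obtain i where u: "x = (i, v, l)" "i \<in> Q" "v \<in> \<Union>{e\<in>?M i. lab i e = l}" by blast
      then have "v \<in> \<Union>(?M i)" "f (i, \<psi> i (ed i v)) = l" using cov[of i v l] by blast+
      then show "x \<in> {x\<in>T2 (v, l). f (\<pi> x) = \<tau> x}" using u by (auto simp only: T2_def \<pi>_def \<tau>_def mem_Collect_eq prod.case mem_Times_iff fst_conv snd_conv)
    qed
    moreover have "T2 (v, l) \<in> \<T>" using that by (auto simp: \<T>_def)
    ultimately show ?thesis using fT[of "T2 (v, l)"] by (simp add: card_cartesian_product cT2)
  qed
  have 4: "lab i e < s" for i e using f by (simp add: lab_def)
  show ?thesis by (rule exI[of _ lab]) (use 1 2 3 4 in blast)
qed

section \<open>Colouring pseudorandom regular graphs\<close>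

lemma colouring_subset: "colouring E k c \<Longrightarrow> F \<subseteq> E \<Longrightarrow> colouring F k c"
  unfolding colouring_def by blast

lemma matchingD: "matching M \<Longrightarrow> e \<in> M \<Longrightarrow> f \<in> M \<Longrightarrow> e \<noteq> f \<Longrightarrow> e \<inter> f = {}"
  by (simp add: matching_def)

lemma matching_Un:
  assumes "matching M" "matching N" "\<Union>M \<inter> \<Union>N = {}"
  shows "matching (M \<union> N)"
  unfolding matching_def
proof (intro ballI impI)
  fix e f assume ef: "e \<in> M \<union> N" "f \<in> M \<union> N" "e \<noteq> f"
  have MN: "x \<inter> y = {}" if "x \<in> M" "y \<in> N" for x y using assms(3) that by blast
  show "e \<inter> f = {}"
  proof (cases "e \<in> M \<longleftrightarrow> f \<in> M")
    case True
    then consider "e \<in> M" "f \<in> M" | "e \<in> N" "f \<in> N" using ef by blast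
    then show ?thesis using matchingD[OF assms(1)] matchingD[OF assms(2)] ef(3) by cases metis+
  next
    case False
    then consider "e \<in> M" "f \<in> N" | "f \<in> M" "e \<in> N" using ef by blast
    then show ?thesis using MN by cases (metis Int_commute)+
  qed
qed

lemma colouring_matchings:
  assumes J: "finite J" and P: "\<And>j. j \<in> J \<Longrightarrow> matching (P j)"
    and disj: "\<And>i j. i \<in> J \<Longrightarrow> j \<in> J \<Longrightarrow> i \<noteq> j \<Longrightarrow> P i \<inter> P j = {}"
  shows "\<exists>c. colouring (\<Union>j\<in>J. P j) (card J) c"
proof -
  obtain g where g: "bij_betw g J {0..<card J}" using ex_bij_betw_finite_nat[OF J] by blast
  define idx where "idx e = (THE j. j \<in> J \<and> e \<in> P j)" for e
  have idx: "idx e = j" if "j \<in> J" "e \<in> P j" for e j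
    unfolding idx_def using that disj by (intro the_equality) (auto simp: disjoint_iff)
  have "colouring (\<Union>j\<in>J. P j) (card J) (\<lambda>e. g (idx e))"
    unfolding colouring_def
  proof (intro conjI ballI impI)
    fix e assume "e \<in> (\<Union>j\<in>J. P j)"
    then obtain j where "j \<in> J" "e \<in> P j" by auto
    then show "g (idx e) < card J" using idx g by (auto simp: bij_betw_def)
  next
    fix e f assume "e \<in> (\<Union>j\<in>J. P j)" "f \<in> (\<Union>j\<in>J. P j)" and ne: "e \<noteq> f \<and> e \<inter> f \<noteq> {}"
    then obtain i j where ij: "i \<in> J" "e \<in> P i" "j \<in> J" "f \<in> P j" by auto
    have "i \<noteq> j" using P[OF ij(1)] ij ne unfolding matching_def by blast
    then show "g (idx e) \<noteq> g (idx f)"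
      using ij idx g by (auto simp: bij_betw_def inj_on_def)
  qed
  then show ?thesis by blast
qed

lemma deg_perfect_matchings:
  assumes J: "finite J" and P: "\<And>j. j \<in> J \<Longrightarrow> matching (P j)" "\<And>j. j \<in> J \<Longrightarrow> finite (P j)"
    and disj: "\<And>i j. i \<in> J \<Longrightarrow> j \<in> J \<Longrightarrow> i \<noteq> j \<Longrightarrow> P i \<inter> P j = {}"
    and v: "\<And>j. j \<in> J \<Longrightarrow> v \<in> \<Union>(P j)"
  shows "deg (\<Union>j\<in>J. P j) v = card J"
proof -
  have "{e\<in>(\<Union>j\<in>J. P j). v \<in> e} = (\<Union>j\<in>J. {e\<in>P j. v \<in> e})" by auto
  then have "deg (\<Union>j\<in>J. P j) v = card (\<Union>j\<in>J. {e\<in>P j. v \<in> e})" by (simp add: deg_def)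
  also have "\<dots> = (\<Sum>j\<in>J. deg (P j) v)"
    unfolding deg_def using J P(2) disj by (intro card_UN_disjoint) (auto simp: disjoint_iff)
  also have "\<dots> = (\<Sum>j\<in>J. 1)" using P v by (intro sum.cong) (auto simp: deg_matching_le)
  finally show ?thesis by simp
qed

lemma deg_Diff: "finite E \<Longrightarrow> F \<subseteq> E \<Longrightarrow> deg (E - F) v = deg E v - deg F v"
  using deg_Un_disjoint[of "E - F" F v] by (simp add: finite_subset Un_absorb2 Diff_disjoint Int_commute)

lemma deg_Un_le: "deg (E \<union> F) v \<le> deg E v + deg F v"
proof -
  have "{e \<in> E \<union> F. v \<in> e} = {e\<in>E. v \<in> e} \<union> {e\<in>F. v \<in> e}" by auto
  then show ?thesis unfolding deg_def by (simp add: card_Un_le)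
qed

text \<open>Each perfect matching takes exactly one edge at every vertex and costs exactly one
  colour, so regularity and the balance between degree and colours are both preserved.\<close>

lemma colouring_remove_perfect_matchings:
  assumes H: "finite H" and V: "V \<noteq> {}" and r: "\<And>v. v \<in> V \<Longrightarrow> deg H v = r"
    and J: "finite J" and P: "\<And>j. j \<in> J \<Longrightarrow> P j \<subseteq> H" "\<And>j. j \<in> J \<Longrightarrow> matching (P j)" "\<And>j. j \<in> J \<Longrightarrow> \<Union>(P j) = V"
    and disj: "\<And>i j. i \<in> J \<Longrightarrow> j \<in> J \<Longrightarrow> i \<noteq> j \<Longrightarrow> P i \<inter> P j = {}"
  shows "v \<in> V \<Longrightarrow> deg (H - (\<Union>j\<in>J. P j)) v = r - card J" and "card J \<le> r"
    and "\<exists>c. colouring (H - (\<Union>j\<in>J. P j)) (r - card J) c \<Longrightarrow> \<exists>c. colouring H r c"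
proof -
  let ?P = "\<Union>j\<in>J. P j"
  have PH: "?P \<subseteq> H" using P by auto
  have dP: "deg ?P v = card J" if "v \<in> V" for v
    using J P disj H that by (intro deg_perfect_matchings) (auto intro: finite_subset)
  show "deg (H - ?P) v = r - card J" if "v \<in> V" for v
    using deg_Diff[OF H PH, of v] dP[OF that] r[OF that] by simp
  obtain v0 where "v0 \<in> V" using V by auto
  then show le: "card J \<le> r" using deg_mono[OF H PH, of v0] dP r by simp
  assume "\<exists>c. colouring (H - ?P) (r - card J) c"
  then obtain c where c: "colouring (H - ?P) (r - card J) c" by blast
  obtain c' where c': "colouring ?P (card J) c'" using colouring_matchings[of J P] J P disj by auto
  have "colouring (?P \<union> (H - ?P)) (card J + (r - card J)) (\<lambda>e. if e \<in> ?P then c' e else card J + c e)"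
    by (rule colouring_Un[OF c' c]) auto
  moreover have "?P \<union> (H - ?P) = H" using PH by auto
  ultimately show "\<exists>c. colouring H r c" using le by auto
qed

lemma sum_deg:
  assumes H: "edges H" and X: "finite X"
  shows "(\<Sum>v\<in>X. deg H v) = (\<Sum>e\<in>H. card (e \<inter> X))"
proof -
  have fH: "finite H" using H by (simp add: edges_def)
  have "(\<Sum>v\<in>X. deg H v) = (\<Sum>v\<in>X. \<Sum>e\<in>H. if v \<in> e then 1 else 0)"
    unfolding deg_def using fH by (simp add: sum.If_cases Int_def)
  also have "\<dots> = (\<Sum>e\<in>H. \<Sum>v\<in>X. if v \<in> e then 1 else 0)" by (rule sum.swap)
  also have "\<dots> = (\<Sum>e\<in>H. card (e \<inter> X))"
    using X by (intro sum.cong) (auto simp: sum.If_cases Int_def conj_commute)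
  finally show ?thesis .
qed

lemma card_Diff_Union_matching:
  assumes "edges M" "matching M" "\<And>e. e \<in> M \<Longrightarrow> e \<subseteq> X" "finite X"
  shows "card (X - \<Union>M) + 2 * card M = card X"
proof -
  have "\<Union>M \<subseteq> X" using assms by auto
  then have "card (X - \<Union>M) = card X - card (\<Union>M)" "card (\<Union>M) \<le> card X"
    using assms(4) by (auto intro: card_mono card_Diff_subset finite_subset)
  then show ?thesis using card_Union_matching[OF assms(1,2)] by simp
qed

section \<open>Completing colour classes in a halved regular graph\<close>

locale halved =
  fixes V A :: "'a set" and d :: nat and \<kappa> :: real
  assumes finV: "finite V" and VN: "V \<noteq> {}" and AV: "A \<subseteq> V" and bal: "card A = card (V - A)"
    and \<kappa>: "0 \<le> \<kappa>" "\<kappa> \<le> d / 10 ^ 6" and d_large: "d \<ge> 10 ^ 9"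
    and small: "8 * real d * (8 * real d * 40000) * exp (- (1 / 10 ^ 10)\<^sup>2 * real d / 64) \<le> 1"
begin

text \<open>What survives the removal of perfect matchings: the degree \<open>r\<close> falls, while
  the density \<open>d / card V\<close> stays that of the initial graph, since an upper bound on
  edge counts passes to subgraphs.\<close>

definition host :: "'a set set \<Rightarrow> nat \<Rightarrow> bool" where
  "host H r \<longleftrightarrow> edges H \<and> \<Union>H \<subseteq> V \<and> (\<forall>v\<in>V. deg H v = r) \<and> edge_bound H V (d / card V) \<kappa>"

abbreviation "cross H \<equiv> {e\<in>H. card (e \<inter> A) = 1}"
abbreviation "inner H \<equiv> {e\<in>H. card (e \<inter> A) \<noteq> 1}"
abbreviation "inA H \<equiv> {e\<in>H. e \<subseteq> A}"
abbreviation "inB H \<equiv> {e\<in>H. e \<inter> A = {}}"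

text \<open>One numerical hypothesis serves every application of the local lemma: 100 labels for the
  dropped edges and 40000 for the batches.\<close>

lemma small_s: "1 \<le> s \<Longrightarrow> s \<le> 40000 \<Longrightarrow> 8 * real d * (8 * real d * real s) * exp (- (1 / 10 ^ 10)\<^sup>2 * real d / 64) \<le> 1"
proof -
  assume "1 \<le> s" "s \<le> 40000"
  then have "8 * real d * (8 * real d * real s) \<le> 8 * real d * (8 * real d * 40000)" by (intro mult_left_mono) auto
  then have "8 * real d * (8 * real d * real s) * exp (- (1 / 10 ^ 10)\<^sup>2 * real d / 64) \<le>
    8 * real d * (8 * real d * 40000) * exp (- (1 / 10 ^ 10)\<^sup>2 * real d / 64)" by (rule mult_right_mono) auto
  then show ?thesis using small by linarith
qed

lemma finA: "finite A" using AV finV finite_subset by blast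

lemma card_V: "card V = 2 * card A"
  using bal AV finV finA card_mono[OF finV AV] by (simp add: card_Diff_subset)

lemma card_V_pos: "card V > 0" using VN finV by (simp add: card_gt_0_iff)

lemma inA_nonempty: "edges H \<Longrightarrow> e \<in> H \<Longrightarrow> e \<subseteq> A \<Longrightarrow> e \<inter> A \<noteq> {}"
  by (metis card.empty edgesD(1) inf.absorb1 zero_neq_numeral)

lemma card_2_cases:
  assumes "edges H" "e \<in> H"
  shows "card (e \<inter> A) = (if e \<subseteq> A then 2 else if e \<inter> A = {} then 0 else 1)"
proof -
  have "card e = 2" using assms by (auto simp: edges_def)
  then obtain x y where "e = {x, y}" "x \<noteq> y" by (meson card_2_iff)
  then show ?thesis by (cases "x \<in> A"; cases "y \<in> A") auto
qed

lemma inner_eq: "edges H \<Longrightarrow> inner H = inA H \<union> inB H"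
  using card_2_cases by (auto split: if_splits)

lemma inA_inB_disjoint: "edges H \<Longrightarrow> inA H \<inter> inB H = {}"
  using inA_nonempty by blast

text \<open>Both sides have the same degree sum, and every cross edge contributes one to
  each.\<close>

lemma side_edges_balanced:
  assumes "host H r"
  shows "card (inA H) = card (inB H)"
proof -
  have H: "edges H" and HV: "\<Union>H \<subseteq> V" and r: "\<And>v. v \<in> V \<Longrightarrow> deg H v = r" using assms by (auto simp: host_def)
  have fH: "finite H" using H by (simp add: edges_def)
  have 1: "(\<Sum>e\<in>H. card (e \<inter> A)) = card A * r" using sum_deg[OF H finA] r AV by (simp add: subset_iff)
  have 2: "(\<Sum>e\<in>H. card (e \<inter> (V - A))) = card A * r"
    using sum_deg[OF H, of "V - A"] r finV bal by simp
  have "(\<Sum>e\<in>H. card (e \<inter> A)) = (\<Sum>e\<in>H. (if e \<subseteq> A then 1 else 0) + (if e \<inter> A = {} then 0 else 1))"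
    using inA_nonempty[OF H] by (intro sum.cong) (simp_all add: card_2_cases[OF H])
  moreover have "(\<Sum>e\<in>H. card (e \<inter> (V - A))) = (\<Sum>e\<in>H. (if e \<subseteq> A then 0 else 1) + (if e \<inter> A = {} then 1 else 0))"
  proof (intro sum.cong refl)
    fix e assume e: "e \<in> H"
    have "e \<inter> (V - A) = e - A" using HV e by auto
    moreover have "card (e - A) + card (e \<inter> A) = 2" using H e edges_finite[OF H e] card_Int_Diff[of e A] by (auto simp: edges_def)
    ultimately show "card (e \<inter> (V - A)) = (if e \<subseteq> A then 0 else 1) + (if e \<inter> A = {} then 1 else 0)"
      using card_2_cases[OF H e] inA_nonempty[OF H e] by (cases "e \<subseteq> A"; cases "e \<inter> A = {}") simp_all
  qed
  moreover have "(\<Sum>e\<in>H. (if e \<subseteq> A then 0 else 1) + (if e \<subseteq> A then 1 else 0 :: nat)) =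
      (\<Sum>e\<in>H. (if e \<inter> A = {} then 0 else 1) + (if e \<inter> A = {} then 1 else 0))"
    by (intro sum.cong) auto
  ultimately have "(\<Sum>e\<in>H. if e \<subseteq> A then 1 else 0 :: nat) = (\<Sum>e\<in>H. if e \<inter> A = {} then 1 else 0)"
    using 1 2 by (simp add: sum.distrib)
  then show ?thesis using fH by (simp add: sum.If_cases Int_def)
qed

text \<open>The colour classes of the inner edges are split at random until they are sparse, so that they
  leave most of every neighbourhood uncovered.\<close>
lemma colouring_small_inner:
  assumes host: "host H r" and rd: "r \<le> d" and dL: "\<And>v. deg (inner H) v \<le> \<Delta>"
    and \<Delta>: "100 * (2 * real \<Delta> + 1) \<le> d / 100" and dC: "\<And>v. v \<in> V \<Longrightarrow> real (deg (cross H) v) \<ge> 45 / 100 * d"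
  shows "\<exists>c. colouring H r c"
proof -
  have H: "edges H" and HV: "\<Union>H \<subseteq> V" and r: "\<And>v. v \<in> V \<Longrightarrow> deg H v = r"
    and eb: "edge_bound H V (d / card V) \<kappa>" using host by (auto simp: host_def)
  have fH: "finite H" using H by (simp add: edges_def)
  let ?C = "cross H"
  \<comment> \<open>The extra colour makes \<open>q\<close> positive, as the equitable colouring
    requires, even if there are no inner edges.\<close>
  define q where "q = 2 * \<Delta> + 1"
  have eA: "edges (inA H)" and eB: "edges (inB H)" and eI: "edges (inner H)" and eC: "edges ?C"
    using H by (auto intro: edges_subset)
  obtain c0 where "colouring (inner H) (2 * \<Delta>) c0" using greedy_colouring[OF eI] dL by blast
  then have c0: "colouring (inner H) q c0" by (rule colouring_mono) (simp add: q_def)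
  have "colouring (inA H) q c0" "colouring (inB H) q c0"
    by (rule colouring_subset[OF c0[unfolded inner_eq[OF H]]], simp)+
  then obtain cA cB where cA: "colouring (inA H) q cA" "\<And>i. i < q \<Longrightarrow> card {e\<in>inA H. cA e = i} = eq_size (card (inA H)) q i"
    and cB: "colouring (inB H) q cB" "\<And>i. i < q \<Longrightarrow> card {e\<in>inB H. cB e = i} = eq_size (card (inB H)) q i"
    using equitable_colouring[OF eA, of q c0] equitable_colouring[OF eB, of q c0] by (auto simp: q_def)
  define MA where "MA i = {e\<in>inA H. cA e = i}" for i
  define MB where "MB i = {e\<in>inB H. cB e = i}" for i
  let ?Q = "{..<q}"
  have eMA: "edges (MA i)" and eMB: "edges (MB i)" for i using H by (auto simp: MA_def MB_def intro: edges_subset)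
  have mMA: "matching (MA i)" and mMB: "matching (MB i)" for i
    using colouring_class_matching[OF cA(1), of i] colouring_class_matching[OF cB(1), of i] by (auto simp: MA_def MB_def)
  have mat: "matching (MA i \<union> MB i)" for i
    using mMA[of i] mMB[of i] by (rule matching_Un) (auto simp: MA_def MB_def)
  have cardM: "card (MA i) = card (MB i)" if "i \<in> ?Q" for i
    using cA(2) cB(2) that side_edges_balanced[OF host] by (simp add: MA_def MB_def)
  have disj: "MA i \<inter> MB i = {}" for i using inA_inB_disjoint[OF H] by (auto simp: MA_def MB_def)
  have dCd: "real (deg ?C v) \<le> d" for v
  proof (cases "v \<in> V")
    case True
    then show ?thesis using deg_mono[OF fH, of ?C v] r rd by (auto intro: order_trans)
  next
    case False
    then have "{e\<in>?C. v \<in> e} = {}" using HV by auto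
    then show ?thesis unfolding deg_def by (metis card.empty of_nat_0 of_nat_0_le_iff)
  qed
  have qd: "100 * real q \<le> d / 100" using \<Delta> by (simp add: q_def)
  let ?\<theta> = "1 / 10 ^ 10 :: real"
  have Qd: "finite ?Q" "real (card ?Q) \<le> real d" and th: "0 < ?\<theta>" "?\<theta> \<le> 8" and d1: "1 \<le> real d"
    and s100: "(0::nat) < 100" "1 \<le> (100::nat)" "(100::nat) \<le> 40000"
    using qd d_large by simp_all
  from split_matchings[OF Qd eMA eMB disj mat cardM eC dCd finV s100(1) th d1 small_s[OF s100(2,3)]]
  obtain lab :: "nat \<Rightarrow> 'a set \<Rightarrow> nat" where lab: "\<forall>l<(100::nat). (\<forall>i\<in>?Q. (\<forall>e. lab i e < 100) \<and>
      card {e\<in>MA i. lab i e = l} = card {e\<in>MB i. lab i e = l} \<and>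
      (\<forall>v\<in>V. \<bar>real (card (nb ?C v \<inter> \<Union>{e\<in>MA i \<union> MB i. lab i e = l})) -
         card (nb ?C v \<inter> \<Union>(MA i \<union> MB i)) / real 100\<bar> \<le> ?\<theta> * d)) \<and>
      (\<forall>v\<in>V. \<bar>real (card {i\<in>?Q. v \<in> \<Union>{e\<in>MA i \<union> MB i. lab i e = l}}) -
         card {i\<in>?Q. v \<in> \<Union>(MA i \<union> MB i)} / real 100\<bar> \<le> ?\<theta> * d)"
    by (rule exE)
  have lab_lt: "lab i e < 100" if "i < q" for i e using spec[OF lab, of 0] that by simp
  define M where "M = (\<lambda>(i, l). {e\<in>MA i \<union> MB i. lab i e = (l::nat)})"
  \<comment> \<open>One matching for each colour and label, at most \<open>d / 100\<close> in all. A
    vertex is used at most once per matching, so this number itself bounds the loss \<mu>.\<close>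
  define J where "J = ?Q \<times> {..<100::nat}"
  define U where "U j = V - \<Union>(M j)" for j
  have MH: "M j \<subseteq> inner H" for j
    using inner_eq[OF H] by (auto simp: M_def MA_def MB_def split: prod.splits)
  have MJ: "M (i, l) = {e\<in>MA i. lab i e = l} \<union> {e\<in>MB i. lab i e = l}" for i l by (auto simp: M_def)
  have part: "card (U (i, l) \<inter> A) + 2 * card {e\<in>MA i. lab i e = l} = card A"
    "card (U (i, l) - A) + 2 * card {e\<in>MB i. lab i e = l} = card (V - A)" if "(i, l) \<in> J" for i l
  proof -
    have "U (i, l) \<inter> A = A - \<Union>{e\<in>MA i. lab i e = l}" unfolding U_def MJ using AV by (auto simp: MB_def)
    then show "card (U (i, l) \<inter> A) + 2 * card {e\<in>MA i. lab i e = l} = card A"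
      by (simp only:, intro card_Diff_Union_matching edges_subset[OF eMA[of i]] matching_subset[OF mMA[of i]])
        (auto simp: MA_def finA)
    have "U (i, l) - A = (V - A) - \<Union>{e\<in>MB i. lab i e = l}" unfolding U_def MJ by (auto simp: MA_def)
    then show "card (U (i, l) - A) + 2 * card {e\<in>MB i. lab i e = l} = card (V - A)"
      by (simp only:, intro card_Diff_Union_matching edges_subset[OF eMB[of i]] matching_subset[OF mMB[of i]])
        (use HV in \<open>auto simp: MB_def finV\<close>)
  qed
  \<comment> \<open>Each part covers only about a hundredth of a neighbourhood, so of the
    \<open>0.45 * d\<close> cross neighbours at least \<open>0.43 * d\<close> are uncovered. With
    \<open>h = card A\<close> the density term is \<open>d / 4\<close>, well below.\<close>
  have "\<exists>P. (\<forall>j\<in>J. P j \<subseteq> ?C \<and> matching (P j) \<and> \<Union>(P j) = U j) \<and> (\<forall>i\<in>J. \<forall>j\<in>J. i \<noteq> j \<longrightarrow> P i \<inter> P j = {})"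
  proof (rule extend_matchings[where a = "42 / 100 * d" and \<mu> = "d / 100" and h = "card A" and A = A])
    show "edge_bound ?C V (d / card V) \<kappa>" by (rule edge_bound_subset[OF eb finV]) auto
    show "card (U j \<inter> A) = card (U j - A)" if jJ: "j \<in> J" for j
    proof -
      obtain i l where j: "j = (i, l)" "i < q" "l < 100" using jJ by (auto simp: J_def)
      have "card {e\<in>MA i. lab i e = l} = card {e\<in>MB i. lab i e = l}" using lab j by blast
      then show ?thesis using part[of i l] jJ bal j by simp
    qed
    show "real (card (U j \<inter> A)) \<le> card A" for j using finA by (simp add: card_mono)
    show "42 / 100 * d + d / 100 \<le> real (card (nb ?C v \<inter> U j))" if jJ: "j \<in> J" and vU: "v \<in> U j" for j v
    proof -
      obtain i l where j: "j = (i, l)" "i < q" "l < 100" using jJ by (auto simp: J_def)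
      have vV: "v \<in> V" using vU by (auto simp: U_def)
      have "nb ?C v \<subseteq> V" using nb_subset[of ?C v] HV by auto
      then have "nb ?C v \<inter> U j = nb ?C v - \<Union>(M j)" by (auto simp: U_def)
      then have "card (nb ?C v \<inter> U j) + card (nb ?C v \<inter> \<Union>(M j)) = deg ?C v"
        using card_Int_Diff[OF finite_nb[OF eC, of v], of "\<Union>(M j)"] card_nb[OF eC, of v] by simp
      from arg_cong[OF this, of real]
      have "real (card (nb ?C v \<inter> U j)) + real (card (nb ?C v \<inter> \<Union>(M j))) = real (deg ?C v)"
        by (simp only: of_nat_add)
      moreover have "\<bar>real (card (nb ?C v \<inter> \<Union>(M j))) - card (nb ?C v \<inter> \<Union>(MA i \<union> MB i)) / real 100\<bar> \<le> ?\<theta> * d"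
        using lab j vV by (simp add: M_def)
      moreover have "real (card (nb ?C v \<inter> \<Union>(MA i \<union> MB i))) \<le> real (deg ?C v)"
        unfolding card_nb[OF eC, symmetric] using finite_nb[OF eC] by (intro of_nat_mono card_mono) auto
      moreover have "real (deg ?C v) \<le> d" by (rule dCd)
      moreover note dC[OF vV]
      ultimately show ?thesis unfolding abs_le_iff by simp
    qed
    show "real (card {j\<in>J. v \<in> U j}) \<le> d / 100" for v
    proof -
      have "card {j\<in>J. v \<in> U j} \<le> card J" by (intro card_mono) (auto simp: J_def)
      also have "card J = q * 100" by (simp add: J_def)
      finally show ?thesis using qd by linarith
    qed
    have eq: "d / card V * card A / 2 = d / 4" using card_V card_V_pos by simp
    have "real d > 0" using d_large by simp
    moreover have "\<kappa> \<le> d / 100" using \<kappa> by simp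
    ultimately show "d / card V * card A / 2 + \<kappa> < 42 / 100 * d" unfolding eq by linarith
  qed (use finV eC \<kappa> in \<open>auto simp: U_def J_def\<close>)
  then obtain P where P': "\<forall>j\<in>J. P j \<subseteq> ?C \<and> matching (P j) \<and> \<Union>(P j) = U j"
    and Pd': "\<forall>i\<in>J. \<forall>j\<in>J. i \<noteq> j \<longrightarrow> P i \<inter> P j = {}" by (elim exE conjE)
  have P: "P j \<subseteq> ?C" "matching (P j)" "\<Union>(P j) = U j" if "j \<in> J" for j
    using bspec[OF P' that] by (simp_all only: simp_thms)
  have Pd: "P i \<inter> P j = {}" if "i \<in> J" "j \<in> J" "i \<noteq> j" for i j
    using Pd' that by metis
  define R where "R j = M j \<union> P j" for j
  have MV: "\<Union>(M j) \<subseteq> V" for j using MH HV by blast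
  have Mmat: "matching (M j)" for j
    by (cases j) (auto simp: M_def intro: matching_subset[OF mat[of "fst j"]])
  have MP: "M i \<inter> P j = {}" if "j \<in> J" for i j using MH[of i] P(1)[OF that] by auto
  have MM: "M i \<inter> M j = {}" if "i \<in> J" "j \<in> J" "i \<noteq> j" for i j
    using that inA_inB_disjoint[OF H] by (auto simp: M_def MA_def MB_def)
  have 1: "R j \<subseteq> H" if "j \<in> J" for j using MH[of j] P(1)[OF that] by (auto simp: R_def)
  have 2: "matching (R j)" if "j \<in> J" for j
  proof -
    have "\<Union>(M j) \<inter> \<Union>(P j) = {}" using P(3)[OF that] by (auto simp: U_def)
    then show ?thesis unfolding R_def by (rule matching_Un[OF Mmat P(2)[OF that]])
  qed
  have 3: "\<Union>(R j) = V" if "j \<in> J" for j using P(3)[OF that] MV[of j] by (auto simp: R_def U_def)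
  have 4: "R i \<inter> R j = {}" if "i \<in> J" "j \<in> J" "i \<noteq> j" for i j
    using MP[of i j] MP[of j i] MM[OF that] Pd[OF that] that unfolding R_def by blast
  have finJ: "finite J" by (simp add: J_def)
  note rem = colouring_remove_perfect_matchings[where P = R and J = J, OF fH VN r finJ 1 2 3 4]
  let ?H = "H - (\<Union>j\<in>J. R j)"
  \<comment> \<open>Once all inner edges lie in removed perfect matchings, the rest is bipartite and
    regular.\<close>
  have "inner H \<subseteq> (\<Union>j\<in>J. R j)"
  proof
    fix e assume e: "e \<in> inner H"
    have *: "e \<in> M (i, lab i e)" "(i, lab i e) \<in> J" if "i < q" "e \<in> MA i \<union> MB i" for i
      using that lab_lt by (auto simp: M_def J_def)
    have "\<exists>i<q. e \<in> MA i \<union> MB i"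
      using e cA(1) cB(1) unfolding inner_eq[OF H] by (auto simp: MA_def MB_def colouring_def)
    then show "e \<in> (\<Union>j\<in>J. R j)" using * by (auto simp: R_def)
  qed
  then have "\<forall>e\<in>?H. card (e \<inter> A) = 1" by auto
  moreover have "deg ?H v \<le> r - card J" for v
  proof (cases "v \<in> V")
    case True
    then show ?thesis using rem(1) by simp
  next
    case False
    then have "{e\<in>?H. v \<in> e} = {}" using HV by auto
    then show ?thesis unfolding deg_def by (metis card.empty le0)
  qed
  moreover have "edges ?H" using H by (rule edges_subset) auto
  ultimately have "\<exists>c. colouring ?H (r - card J) c" by (intro koenig_colouring) auto
  then show ?thesis using rem(3) by simp
qed

end

lemma sum_card_nb_swap:
  assumes "finite X" "finite Y"
  shows "(\<Sum>x\<in>X. card (nb C x \<inter> Y)) = (\<Sum>y\<in>Y. card (nb C y \<inter> X))"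
proof -
  have "(\<Sum>x\<in>X. card (nb C x \<inter> Y)) = (\<Sum>x\<in>X. \<Sum>y\<in>Y. if y \<in> nb C x then 1 else 0)"
    using assms by (intro sum.cong) (auto simp: sum.If_cases Int_def conj_commute)
  also have "\<dots> = (\<Sum>y\<in>Y. \<Sum>x\<in>X. if y \<in> nb C x then 1 else 0)" by (rule sum.swap)
  also have "\<dots> = (\<Sum>y\<in>Y. \<Sum>x\<in>X. if x \<in> nb C y then 1 else 0)" by (simp only: nb_sym[of _ C])
  also have "\<dots> = (\<Sum>y\<in>Y. card (nb C y \<inter> X))"
    using assms by (intro sum.cong) (auto simp: sum.If_cases Int_def conj_commute)
  finally show ?thesis .
qed

lemma deg_outside: "\<Union>H \<subseteq> V \<Longrightarrow> v \<notin> V \<Longrightarrow> deg H v = 0"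
proof -
  assume "\<Union>H \<subseteq> V" "v \<notin> V"
  then have "{e\<in>H. v \<in> e} = {}" by auto
  then show ?thesis unfolding deg_def by (simp only: card.empty)
qed

context halved
begin

text \<open>The matchings of a batch are thinned simultaneously. A vertex then loses a tiny number of
  cross edges during the batch compared with its degree into any set of uncovered vertices.\<close>
lemma complete_batch:
  fixes MA MB :: "'i \<Rightarrow> 'a set set"
  assumes host: "host H r" and Q: "finite Q" "real (card Q) \<le> d / 10"
    and MAH: "\<And>i. i \<in> Q \<Longrightarrow> MA i \<subseteq> inA H" and MBH: "\<And>i. i \<in> Q \<Longrightarrow> MB i \<subseteq> inB H"
    and mMA: "\<And>i. i \<in> Q \<Longrightarrow> matching (MA i)" and mMB: "\<And>i. i \<in> Q \<Longrightarrow> matching (MB i)"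
    and cardM: "\<And>i. i \<in> Q \<Longrightarrow> card (MA i) = card (MB i)"
    and Mdisj: "\<And>i j. i \<in> Q \<Longrightarrow> j \<in> Q \<Longrightarrow> i \<noteq> j \<Longrightarrow> (MA i \<union> MB i) \<inter> (MA j \<union> MB j) = {}"
    and dC: "\<And>v. v \<in> V \<Longrightarrow> real (deg (cross H) v) \<ge> 49 / 100 * d" "\<And>v. v \<in> V \<Longrightarrow> real (deg (cross H) v) \<le> 51 / 100 * d"
    and unc: "\<And>v. v \<in> V \<Longrightarrow> real (card {i\<in>Q. v \<notin> \<Union>(MA i \<union> MB i)}) \<le> 4 / 10 ^ 8 * d"
    and big: "\<And>i. i \<in> Q \<Longrightarrow> real (card (A - \<Union>(MA i))) \<le> 1 / 10 ^ 7 * card A"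
  shows "\<exists>P. \<forall>i\<in>Q. P i \<subseteq> H \<and> matching (P i) \<and> \<Union>(P i) = V \<and> inner (P i) \<subseteq> MA i \<union> MB i \<and>
    (\<forall>j\<in>Q. i \<noteq> j \<longrightarrow> P i \<inter> P j = {}) \<and>
    (\<forall>v\<in>V. real (card {i\<in>Q. v \<in> \<Union>(MA i \<union> MB i - P i)}) \<le> card Q / 40000 + d / 10 ^ 8)"
proof -
  have H: "edges H" and HV: "\<Union>H \<subseteq> V" and r: "\<And>v. v \<in> V \<Longrightarrow> deg H v = r"
    and eb: "edge_bound H V (d / card V) \<kappa>" using host by (auto simp: host_def)
  define C where "C = cross H"
  have eC: "edges C" using H by (auto simp: C_def intro: edges_subset)
  define M where "M i = MA i \<union> MB i" for i
  have MH: "M i \<subseteq> inner H" if "i \<in> Q" for i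
    unfolding inner_eq[OF H] M_def using MAH[OF that] MBH[OF that] by (rule Un_mono)
  have eMA: "edges (MA i)" if "i \<in> Q" for i by (rule edges_subset[OF H]) (use MAH[OF that] in auto)
  have eMB: "edges (MB i)" if "i \<in> Q" for i by (rule edges_subset[OF H]) (use MBH[OF that] in auto)
  have finM: "finite (MA i)" "finite (MB i)" if "i \<in> Q" for i
    using eMA[OF that] eMB[OF that] by (simp_all add: edges_def)
  have MA_A: "e \<subseteq> A" if "i \<in> Q" "e \<in> MA i" for i e using MAH[OF that(1)] that(2) by auto
  have MB_B: "e \<inter> A = {}" "e \<subseteq> V - A" if "i \<in> Q" "e \<in> MB i" for i e
    using MBH[OF that(1)] that(2) HV by auto
  have mat: "matching (M i)" if "i \<in> Q" for i
    unfolding M_def using mMA[OF that] mMB[OF that]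
    by (rule matching_Un) (use MA_A[OF that] MB_B(1)[OF that] in fastforce)
  have disj: "MA i \<inter> MB i = {}" if "i \<in> Q" for i
    using inA_inB_disjoint[OF H] MAH[OF that] MBH[OF that] by (meson disjoint_iff subsetD)
  have nbCd: "real (deg C v) \<le> 51 / 100 * d" if "v \<in> V" for v using dC(2)[OF that] by (simp add: C_def)
  have dCd: "real (deg C v) \<le> d" for v
  proof (cases "v \<in> V")
    case True
    then show ?thesis using nbCd[OF True] by simp
  next
    case False
    have "\<Union>C \<subseteq> V" using HV by (auto simp: C_def)
    then show ?thesis using deg_outside[of C V v] False by simp
  qed
  let ?\<theta> = "1 / 10 ^ 10 :: real"
  have d0: "real d > 0" using d_large by simp
  have Qd: "real (card Q) \<le> real d" and th: "0 < ?\<theta>" "?\<theta> \<le> 8" and d1: "1 \<le> real d"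
    and s: "(0::nat) < 40000" "1 \<le> (40000::nat)" "(40000::nat) \<le> 40000"
    using Q d_large by simp_all
  from split_matchings[OF Q(1) Qd eMA eMB disj mat[unfolded M_def] cardM eC dCd finV s(1) th d1 small_s[OF s(2,3)]]
  obtain lab :: "'i \<Rightarrow> 'a set \<Rightarrow> nat" where lab: "\<forall>l<(40000::nat). (\<forall>i\<in>Q. (\<forall>e. lab i e < 40000) \<and>
      card {e\<in>MA i. lab i e = l} = card {e\<in>MB i. lab i e = l} \<and>
      (\<forall>v\<in>V. \<bar>real (card (nb C v \<inter> \<Union>{e\<in>MA i \<union> MB i. lab i e = l})) -
         card (nb C v \<inter> \<Union>(MA i \<union> MB i)) / real 40000\<bar> \<le> ?\<theta> * d)) \<and>
      (\<forall>v\<in>V. \<bar>real (card {i\<in>Q. v \<in> \<Union>{e\<in>MA i \<union> MB i. lab i e = l}}) -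
         card {i\<in>Q. v \<in> \<Union>(MA i \<union> MB i)} / real 40000\<bar> \<le> ?\<theta> * d)"
    by (rule exE)
  \<comment> \<open>Label 0 marks the dropped edges, about 1/40000 of each neighbourhood's covered
    part; all other labels are kept.\<close>
  define D where "D i = {e\<in>M i. lab i e = 0}" for i
  define K where "K i = {e\<in>M i. lab i e \<noteq> 0}" for i
  note lab0 = mp[OF spec[OF lab, of 0] s(1), folded M_def, folded D_def]
  have labD: "card {e\<in>MA i. lab i e = 0} = card {e\<in>MB i. lab i e = 0}" if "i \<in> Q" for i
    using bspec[OF conjunct1[OF lab0] that] by (elim conjE)
  have labnb: "\<bar>real (card (nb C v \<inter> \<Union>(D i))) - card (nb C v \<inter> \<Union>(M i)) / real 40000\<bar> \<le> ?\<theta> * d"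
    if "i \<in> Q" "v \<in> V" for i v
    by (rule bspec[OF conjunct2[OF conjunct2[OF bspec[OF conjunct1[OF lab0] that(1)]]] that(2)])
  have labv: "\<bar>real (card {i\<in>Q. v \<in> \<Union>(D i)}) - card {i\<in>Q. v \<in> \<Union>(M i)} / real 40000\<bar> \<le> ?\<theta> * d"
    if "v \<in> V" for v
    using conjunct2[OF lab0] that by (rule bspec)
  define U where "U i = V - \<Union>(K i)" for i
  have MV: "\<Union>(M i) \<subseteq> V" if "i \<in> Q" for i using MH[OF that] HV by blast
  have DK: "\<Union>(D i) \<inter> \<Union>(K i) = {}" if i: "i \<in> Q" for i
  proof -
    have "e \<inter> f = {}" if "e \<in> D i" "f \<in> K i" for e f
      using that by (intro matchingD[OF mat[OF i]]) (auto simp: D_def K_def)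
    then show ?thesis by blast
  qed
  have MDK: "M i = D i \<union> K i" for i by (auto simp: D_def K_def)
  let ?DA = "\<lambda>i. {e\<in>MA i. lab i e = 0}" and ?DB = "\<lambda>i. {e\<in>MB i. lab i e = 0}"
  let ?KA = "\<lambda>i. {e\<in>MA i. lab i e \<noteq> 0}" and ?KB = "\<lambda>i. {e\<in>MB i. lab i e \<noteq> 0}"
  have cKD: "card (MA i) = card (?DA i) + card (?KA i)" "card (MB i) = card (?DB i) + card (?KB i)" if "i \<in> Q" for i
    using card_Int_Diff[OF finM(1)[OF that], of "{e. lab i e = 0}"] card_Int_Diff[OF finM(2)[OF that], of "{e. lab i e = 0}"]
    by (simp_all add: Int_def set_diff_eq)
  have UA: "card (U i \<inter> A) + 2 * card (?KA i) = card A" if i: "i \<in> Q" for i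
  proof -
    have "U i \<inter> A = A - \<Union>(?KA i)" unfolding U_def K_def M_def using AV MB_B(1)[OF i] by auto
    then show ?thesis
      by (simp only:, intro card_Diff_Union_matching edges_subset[OF eMA[OF i]] matching_subset[OF mMA[OF i]])
        (use MA_A[OF i] finA in auto)
  qed
  have UB: "card (U i - A) + 2 * card (?KB i) = card (V - A)" if i: "i \<in> Q" for i
  proof -
    have "U i - A = (V - A) - \<Union>(?KB i)" unfolding U_def K_def M_def using MA_A[OF i] by auto
    then show ?thesis
      by (simp only:, intro card_Diff_Union_matching edges_subset[OF eMB[OF i]] matching_subset[OF mMB[OF i]])
        (use MB_B(2)[OF i] finV in auto)
  qed
  have Ubal: "card (U i \<inter> A) = card (U i - A)" if "i \<in> Q" for i
    using UA[OF that] UB[OF that] cKD[OF that] cardM[OF that] labD[OF that] bal by linarith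
  \<comment> \<open>No test measures the total number of dropped edges. It follows by double
    counting cross edges between \<open>?Y\<close> and \<open>A\<close>: a vertex of
    \<open>?Y\<close> has at least \<open>0.49 * d\<close> neighbours in \<open>A\<close>, and a
    vertex of \<open>A\<close> sees at most about \<open>0.51 * d / 40000\<close> of
    \<open>?Y\<close>. The factor 105/100 absorbs 51/49 and the error.\<close>
  have sizeD: "2 * real (card (?DB i)) \<le> 105 / 100 / 40000 * card A" if i: "i \<in> Q" for i
  proof -
    let ?Y = "\<Union>(?DB i)"
    have YV: "?Y \<subseteq> V - A" using MB_B(2)[OF i] by blast
    have finY: "finite ?Y" using YV finV by (meson finite_Diff finite_subset)
    have cY: "card ?Y = 2 * card (?DB i)"
      by (intro card_Union_matching edges_subset[OF eMB[OF i]] matching_subset[OF mMB[OF i]]) auto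
    have nbA: "nb C y \<inter> A = nb C y" if "y \<in> ?Y" for y
      using nb_cross[OF H, of A y] YV that by (auto simp: C_def)
    have "(\<Sum>y\<in>?Y. 49 / 100 * real d) \<le> (\<Sum>y\<in>?Y. real (card (nb C y \<inter> A)))"
    proof (rule sum_mono)
      fix y assume y: "y \<in> ?Y"
      then have "y \<in> V" using YV by auto
      then show "49 / 100 * real d \<le> real (card (nb C y \<inter> A))"
        unfolding nbA[OF y] card_nb[OF eC] using dC(1)[of y] by (simp add: C_def)
    qed
    also have "\<dots> = real (\<Sum>y\<in>?Y. card (nb C y \<inter> A))" by simp
    also have "\<dots> = real (\<Sum>v\<in>A. card (nb C v \<inter> ?Y))" by (simp only: sum_card_nb_swap[OF finY finA])
    also have "\<dots> = (\<Sum>v\<in>A. real (card (nb C v \<inter> ?Y)))" by simp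
    also have "\<dots> \<le> (\<Sum>v\<in>A. 49 / 100 * d * (105 / 100 / 40000))"
    proof (rule sum_mono)
      fix v assume "v \<in> A"
      then have vV: "v \<in> V" using AV by auto
      have "real (card (nb C v \<inter> ?Y)) \<le> real (card (nb C v \<inter> \<Union>(D i)))"
        using finite_nb[OF eC] by (intro of_nat_mono card_mono) (auto simp: D_def M_def)
      moreover have "real (card (nb C v \<inter> \<Union>(M i))) \<le> real (deg C v)"
        unfolding card_nb[OF eC, symmetric] using finite_nb[OF eC] by (intro of_nat_mono card_mono) auto
      moreover note labnb[OF i vV] nbCd[OF vV]
      ultimately show "real (card (nb C v \<inter> ?Y)) \<le> 49 / 100 * d * (105 / 100 / 40000)"
        unfolding abs_le_iff using d0 by simp
    qed
    finally have "real (card ?Y) * (49 / 100 * d) \<le> (105 / 100 / 40000 * card A) * (49 / 100 * d)"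
      by (simp add: mult_ac)
    then have "real (card ?Y) \<le> 105 / 100 / 40000 * card A" using d0 by simp
    then show ?thesis using cY by simp
  qed
  have Uh: "real (card (U i \<inter> A)) \<le> 264 / 10 ^ 7 * card A" if i: "i \<in> Q" for i
  proof -
    have "card (A - \<Union>(MA i)) + 2 * card (MA i) = card A"
      by (rule card_Diff_Union_matching[OF eMA[OF i] mMA[OF i] MA_A[OF i] finA])
    then have "card (U i \<inter> A) = card (A - \<Union>(MA i)) + 2 * card (?DB i)"
      using UA[OF i] cKD[OF i] labD[OF i] by linarith
    then have "real (card (U i \<inter> A)) = real (card (A - \<Union>(MA i))) + 2 * real (card (?DB i))" by simp
    then show ?thesis using sizeD[OF i] big[OF i] by simp
  qed
  \<comment> \<open>In units of \<open>d / 10^8\<close>: 4 for classes missing \<open>v\<close> from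
    the start, 250 for 1/40000 of at most \<open>d / 10\<close> classes, and 1 for the
    error.\<close>
  have usage: "real (card {i\<in>Q. v \<in> U i}) \<le> 255 / 10 ^ 8 * d" and dropped: "real (card {i\<in>Q. v \<in> \<Union>(D i)}) \<le> card Q / 40000 + d / 10 ^ 8"
    if v: "v \<in> V" for v
  proof -
    have "real (card {i\<in>Q. v \<in> \<Union>(M i)}) \<le> card Q" using Q by (intro of_nat_mono card_mono) auto
    then show dr: "real (card {i\<in>Q. v \<in> \<Union>(D i)}) \<le> card Q / 40000 + d / 10 ^ 8"
      using labv[OF v] d0 unfolding abs_le_iff by simp
    have "card {i\<in>Q. v \<in> U i} \<le> card ({i\<in>Q. v \<notin> \<Union>(M i)} \<union> {i\<in>Q. v \<in> \<Union>(D i)})"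
      using Q MDK by (intro card_mono) (auto simp: U_def)
    also have "\<dots> \<le> card {i\<in>Q. v \<notin> \<Union>(M i)} + card {i\<in>Q. v \<in> \<Union>(D i)}" by (rule card_Un_le)
    finally have "real (card {i\<in>Q. v \<in> U i}) \<le> real (card {i\<in>Q. v \<notin> \<Union>(M i)}) + real (card {i\<in>Q. v \<in> \<Union>(D i)})"
      unfolding of_nat_add[symmetric] by (rule of_nat_mono)
    then show "real (card {i\<in>Q. v \<in> U i}) \<le> 255 / 10 ^ 8 * d"
      using unc[OF v, folded M_def] dr Q(2) by simp
  qed
  \<comment> \<open>Covered neighbours become uncovered at rate 1/40000 and the others count in
    full, so the worst case is that all are covered. This leaves about
    \<open>0.49 / 40000 * d\<close>, or \<open>1225 / 10^8 * d\<close>, against the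
    \<open>1215 / 10^8 * d\<close> demanded.\<close>
  have room: "real (card (nb C v \<inter> U i)) \<ge> 96 / 10 ^ 7 * d + 255 / 10 ^ 8 * d" if i: "i \<in> Q" and v: "v \<in> V" for i v
  proof -
    have fnb: "finite (nb C v)" by (rule finite_nb[OF eC])
    have nbV: "nb C v \<subseteq> V" using nb_subset[of C v] HV by (auto simp: C_def)
    have "(nb C v - \<Union>(M i)) \<union> (nb C v \<inter> \<Union>(D i)) \<subseteq> nb C v \<inter> U i"
      using nbV DK[OF i] MDK[of i] by (auto simp: U_def)
    then have "card ((nb C v - \<Union>(M i)) \<union> (nb C v \<inter> \<Union>(D i))) \<le> card (nb C v \<inter> U i)"
      using fnb by (intro card_mono) auto
    moreover have "card ((nb C v - \<Union>(M i)) \<union> (nb C v \<inter> \<Union>(D i))) = card (nb C v - \<Union>(M i)) + card (nb C v \<inter> \<Union>(D i))"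
      using fnb MDK[of i] by (intro card_Un_disjoint) auto
    moreover have "deg C v = card (nb C v \<inter> \<Union>(M i)) + card (nb C v - \<Union>(M i))"
      using card_Int_Diff[OF fnb, of "\<Union>(M i)"] card_nb[OF eC, of v] by simp
    ultimately have "deg C v + card (nb C v \<inter> \<Union>(D i)) \<le> card (nb C v \<inter> U i) + card (nb C v \<inter> \<Union>(M i))" by linarith
    then have "real (deg C v + card (nb C v \<inter> \<Union>(D i))) \<le> real (card (nb C v \<inter> U i) + card (nb C v \<inter> \<Union>(M i)))"
      by (rule of_nat_mono)
    moreover have "real (card (nb C v \<inter> \<Union>(M i))) \<le> real (deg C v)"
      unfolding card_nb[OF eC, symmetric] using fnb by (intro of_nat_mono card_mono) auto
    moreover have "real (deg C v) \<ge> 49 / 100 * d" using dC(1)[OF v] by (simp add: C_def)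
    moreover note labnb[OF i v]
    ultimately show ?thesis unfolding abs_le_iff using d0 by simp
  qed
  have "\<exists>N. (\<forall>i\<in>Q. N i \<subseteq> C \<and> matching (N i) \<and> \<Union>(N i) = U i) \<and> (\<forall>i\<in>Q. \<forall>j\<in>Q. i \<noteq> j \<longrightarrow> N i \<inter> N j = {})"
  proof (rule extend_matchings[where a = "96 / 10 ^ 7 * d" and \<mu> = "255 / 10 ^ 8 * d" and h = "264 / 10 ^ 7 * card A" and A = A])
    show "edge_bound C V (d / card V) \<kappa>" unfolding C_def by (rule edge_bound_subset[OF eb finV]) auto
    show "96 / 10 ^ 7 * d + 255 / 10 ^ 8 * d \<le> real (card (nb C v \<inter> U i))" if "i \<in> Q" "v \<in> U i" for i v
      using room[of i v] that by (simp add: U_def)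
    \<comment> \<open>The density term is \<open>66 / 10^7 * d\<close> and \<kappa> adds at most
      \<open>10 / 10^7 * d\<close>, below the threshold \<open>96 / 10^7 * d\<close>.\<close>
    have eq: "d / card V * (264 / 10 ^ 7 * card A) / 2 = 66 / 10 ^ 7 * d" using card_V card_V_pos by simp
    show "d / card V * (264 / 10 ^ 7 * card A) / 2 + \<kappa> < 96 / 10 ^ 7 * d"
      unfolding eq using d0 \<kappa> by simp
  qed (use finV eC \<kappa> Q Ubal Uh usage in \<open>auto simp: U_def C_def\<close>)
  then obtain N where N': "\<forall>i\<in>Q. N i \<subseteq> C \<and> matching (N i) \<and> \<Union>(N i) = U i"
    and Nd': "\<forall>i\<in>Q. \<forall>j\<in>Q. i \<noteq> j \<longrightarrow> N i \<inter> N j = {}" by (elim exE conjE)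
  have N: "N i \<subseteq> C" "matching (N i)" "\<Union>(N i) = U i" if "i \<in> Q" for i
    using bspec[OF N' that] by (simp_all only: simp_thms)
  have Nd: "N i \<inter> N j = {}" if "i \<in> Q" "j \<in> Q" "i \<noteq> j" for i j
    using Nd' that by metis
  define P where "P i = K i \<union> N i" for i
  have KM: "K i \<subseteq> M i" for i by (auto simp: K_def)
  have MN: "M i \<inter> N j = {}" if "i \<in> Q" "j \<in> Q" for i j
    using MH[OF that(1)] N(1)[OF that(2)] by (auto simp: C_def)
  show ?thesis
  proof (rule exI[of _ P], intro ballI conjI impI)
    fix i assume i: "i \<in> Q"
    show "P i \<subseteq> H" using MH[OF i] KM[of i] N(1)[OF i] by (auto simp: P_def C_def)
    show "matching (P i)" unfolding P_def
      by (rule matching_Un[OF matching_subset[OF mat[OF i] KM] N(2)[OF i]]) (auto simp: N(3)[OF i] U_def)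
    have "\<Union>(K i) \<subseteq> V" using Union_mono[OF KM[of i]] MV[OF i] by (rule order_trans)
    then show "\<Union>(P i) = V" unfolding P_def Union_Un_distrib N(3)[OF i] U_def by auto
    show "inner (P i) \<subseteq> MA i \<union> MB i" using N(1)[OF i] KM[of i] by (auto simp: P_def C_def M_def)
    show "P i \<inter> P j = {}" if "j \<in> Q" "i \<noteq> j" for j
      using Mdisj[OF i that, folded M_def] KM[of i] KM[of j] MN[OF i that(1)] MN[OF that(1) i] Nd[OF i that]
      unfolding P_def by blast
    show "real (card {i\<in>Q. v \<in> \<Union>(MA i \<union> MB i - P i)}) \<le> card Q / 40000 + d / 10 ^ 8" if v: "v \<in> V" for v
    proof -
      have eq: "M k - P k = D k" if k: "k \<in> Q" for k
      proof -
        have "D k = M k - K k" by (auto simp: D_def K_def)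
        then show ?thesis using MN[OF k k] unfolding P_def by blast
      qed
      have "{i\<in>Q. v \<in> \<Union>(M i - P i)} = {i\<in>Q. v \<in> \<Union>(D i)}"
        by (intro Collect_cong conj_cong refl) (simp only: eq)
      then show ?thesis using dropped[OF v] unfolding M_def[symmetric] by simp
    qed
  qed
qed

end

lemma deg_empty: "deg {} v = 0"
  by (simp add: deg_def)

context halved
begin

lemma deg_cross_inner:
  assumes "finite H"
  shows "deg (cross H) v + deg (inner H) v = deg H v"
proof -
  have "deg (cross H \<union> inner H) v = deg (cross H) v + deg (inner H) v"
    using assms by (intro deg_Un_disjoint) auto
  moreover have "cross H \<union> inner H = H" by auto
  ultimately show ?thesis by simp
qed

text \<open>Induction on the number \<open>j\<close> of batches still to come, with the highest
  colours treated first. The classes below \<open>min q (j * b)\<close> are intact in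
  \<open>H\<close>; inner edges outside them have been dropped, and each batch adds at most
  \<open>251 / 10^8 * d\<close> of these at a vertex: 250 from the rate 1/40000 on
  \<open>d / 10\<close> classes, 1 from the error.\<close>

lemma colouring_batches:
  fixes MA MB :: "nat \<Rightarrow> 'a set set" and q b j :: nat
  assumes mMA: "\<And>i. i < q \<Longrightarrow> matching (MA i)" and mMB: "\<And>i. i < q \<Longrightarrow> matching (MB i)"
    and A: "\<And>i e. i < q \<Longrightarrow> e \<in> MA i \<Longrightarrow> e \<subseteq> A" and B: "\<And>i e. i < q \<Longrightarrow> e \<in> MB i \<Longrightarrow> e \<inter> A = {}"
    and cardM: "\<And>i. i < q \<Longrightarrow> card (MA i) = card (MB i)"
    and Mdisj: "\<And>i j. i < q \<Longrightarrow> j < q \<Longrightarrow> i \<noteq> j \<Longrightarrow> (MA i \<union> MB i) \<inter> (MA j \<union> MB j) = {}"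
    and unc: "\<And>v. v \<in> V \<Longrightarrow> real (card {i\<in>{..<q}. v \<notin> \<Union>(MA i \<union> MB i)}) \<le> 4 / 10 ^ 8 * d"
    and big: "\<And>i. i < q \<Longrightarrow> real (card (A - \<Union>(MA i))) \<le> 1 / 10 ^ 7 * card A"
    and q: "real q \<le> (1 / 2 + 3 / 10 ^ 8) * d" and b: "real b \<le> d / 10"
    and "j \<le> 6" "host H (d - q + min q (j * b))" "\<And>i. i < min q (j * b) \<Longrightarrow> MA i \<union> MB i \<subseteq> H"
      "\<And>v. v \<in> V \<Longrightarrow> real (deg (cross H) v) \<le> 51 / 100 * d"
      "\<And>v. v \<in> V \<Longrightarrow> real (deg (inner H - (\<Union>i<min q (j * b). MA i \<union> MB i)) v) \<le> (6 - real j) * (251 / 10 ^ 8 * d)"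
  shows "\<exists>c. colouring H (d - q + min q (j * b)) c"
  using assms(11-)
proof (induction j arbitrary: H)
  case 0
  have host: "host H (d - q)" using 0 by simp
  have H: "edges H" and HV: "\<Union>H \<subseteq> V" and r: "\<And>v. v \<in> V \<Longrightarrow> deg H v = d - q" using host by (auto simp: host_def)
  have d0: "real d \<ge> 10 ^ 9" using d_large by simp
  have eq: "inner H - (\<Union>i<min q (0 * b). MA i \<union> MB i) = inner H" by simp
  have inn: "real (deg (inner H) v) \<le> 6 * (251 / 10 ^ 8 * d)" if "v \<in> V" for v
    using 0(5)[OF that] unfolding eq by simp
  have inV: "\<Union>(inner H) \<subseteq> V" using HV by auto
  \<comment> \<open>With no class left, the inner edges are those dropped in six batches, of degree
    below \<open>d / 60000\<close>: sparse enough for \<open>colouring_small_inner\<close>.\<close>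
  define \<Delta> where "\<Delta> = nat \<lfloor>6 * (251 / 10 ^ 8 * real d)\<rfloor>"
  have \<Delta>: "real \<Delta> \<le> 6 * (251 / 10 ^ 8 * d)" unfolding \<Delta>_def by (rule of_nat_floor) simp
  have "\<exists>c. colouring H (d - q) c"
  proof (rule colouring_small_inner[OF host])
    show "deg (inner H) v \<le> \<Delta>" for v
    proof (cases "v \<in> V")
      case True
      then show ?thesis using inn[OF True] unfolding \<Delta>_def by (rule_tac le_nat_floor)
    next
      case False
      then show ?thesis using deg_outside[OF inV False] by simp
    qed
    show "100 * (2 * real \<Delta> + 1) \<le> real d / 100" using \<Delta> d0 by simp
    show "45 / 100 * real d \<le> real (deg (cross H) v)" if v: "v \<in> V" for v
    proof -
      have fH: "finite H" using H by (simp add: edges_def)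
      have "real (deg (cross H) v) + real (deg (inner H) v) = real (d - q)"
        using arg_cong[OF deg_cross_inner[OF fH, of v], of real] unfolding r[OF v] of_nat_add .
      moreover have "real (d - q) \<ge> real d - real q" by simp
      moreover note inn[OF v] q d0
      ultimately show ?thesis by simp
    qed
  qed simp
  then show ?case by simp
next
  case (Suc j)
  define m where "m = min q (j * b)"
  define m' where "m' = min q (Suc j * b)"
  note host = Suc.prems(2)[folded m'_def]
  note MH = Suc.prems(3)[folded m'_def]
  note crossH = Suc.prems(4)
  note innerH = Suc.prems(5)[folded m'_def]
  have H: "edges H" and HV: "\<Union>H \<subseteq> V" and r: "\<And>v. v \<in> V \<Longrightarrow> deg H v = d - q + m'"
    and eb: "edge_bound H V (d / card V) \<kappa>" using host by (auto simp: host_def)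
  have fH: "finite H" using H by (simp add: edges_def)
  have d0: "real d \<ge> 10 ^ 9" using d_large by simp
  have mm: "m \<le> m'" "m' \<le> q" "m' \<le> m + b" by (auto simp: m_def m'_def)
  define M where "M i = MA i \<union> MB i" for i
  let ?Q = "{m..<m'}"
  have matM: "matching (M i)" if "i < q" for i
    unfolding M_def using mMA[OF that] mMB[OF that]
    by (rule matching_Un) (use A[OF that] B[OF that] in fastforce)
  have finM: "finite (M i)" if "i < m'" for i
    using MH[OF that] fH unfolding M_def by (rule finite_subset)
  have Minner: "M i \<subseteq> inner H" if i: "i < m'" for i
  proof -
    have "i < q" using i mm by simp
    then have "M i \<subseteq> inA H \<union> inB H" using MH[OF i] A B unfolding M_def by blast
    then show ?thesis unfolding inner_eq[OF H] .
  qed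
  let ?L = "inner H - (\<Union>i<m'. M i)"
  have innerL: "real (deg ?L v) \<le> (6 - real (Suc j)) * (251 / 10 ^ 8 * d)" if "v \<in> V" for v
    using innerH[OF that] unfolding M_def .
  \<comment> \<open>Each of the \<open>m'\<close> remaining classes has at most one edge at
    \<open>v\<close>, so inner edges account for at most \<open>m'\<close> plus the dropped ones.
    The cross degree therefore stays near \<open>d - q\<close>, however many batches are
    done.\<close>
  have crossL: "real (deg (cross H) v) \<ge> 49 / 100 * d" if v: "v \<in> V" for v
  proof -
    have "deg (cross H) v + deg (inner H) v = d - q + m'"
      using deg_cross_inner[OF fH, of v] unfolding r[OF v] .
    moreover have eq: "?L \<union> (\<Union>i<m'. M i) = inner H" using Minner by blast
    have "deg (inner H) v \<le> deg ?L v + deg (\<Union>i<m'. M i) v"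
      using deg_Un_le[of ?L "\<Union>i<m'. M i" v] unfolding eq .
    moreover have "deg (\<Union>i<m'. M i) v \<le> card {i\<in>{..<m'}. v \<in> \<Union>(M i)}"
      using finM matM mm by (intro deg_UN_le) auto
    moreover have "card {i\<in>{..<m'}. v \<in> \<Union>(M i)} \<le> card {..<m'}" by (intro card_mono) auto
    ultimately have "d - q + m' \<le> deg (cross H) v + deg ?L v + m'" by simp
    then have "real d \<le> real (deg (cross H) v + deg ?L v + q)" unfolding of_nat_le_iff by linarith
    moreover have "(6 - real (Suc j)) * (251 / 10 ^ 8 * d) \<le> 6 * (251 / 10 ^ 8 * d)" by (intro mult_right_mono) auto
    with innerL[OF v] have "real (deg ?L v) \<le> 6 * (251 / 10 ^ 8 * d)" by (rule order_trans)
    moreover note q d0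
    ultimately show ?thesis by simp
  qed
  have Qb: "real (card ?Q) \<le> d / 10" using mm b by simp
  have "\<exists>P. \<forall>i\<in>?Q. P i \<subseteq> H \<and> matching (P i) \<and> \<Union>(P i) = V \<and> inner (P i) \<subseteq> MA i \<union> MB i \<and>
    (\<forall>j\<in>?Q. i \<noteq> j \<longrightarrow> P i \<inter> P j = {}) \<and>
    (\<forall>v\<in>V. real (card {i\<in>?Q. v \<in> \<Union>(MA i \<union> MB i - P i)}) \<le> card ?Q / 40000 + d / 10 ^ 8)"
  proof (rule complete_batch[OF host _ Qb])
    fix i assume i: "i \<in> ?Q"
    then have iq: "i < q" "i < m'" using mm by auto
    show "MA i \<subseteq> inA H" "MB i \<subseteq> inB H" using MH[OF iq(2)] A[OF iq(1)] B[OF iq(1)] by auto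
    show "matching (MA i)" "matching (MB i)" "card (MA i) = card (MB i)"
      using mMA[OF iq(1)] mMB[OF iq(1)] cardM[OF iq(1)] by simp_all
    show "real (card (A - \<Union>(MA i))) \<le> 1 / 10 ^ 7 * card A" by (rule big[OF iq(1)])
    show "(MA i \<union> MB i) \<inter> (MA k \<union> MB k) = {}" if "k \<in> ?Q" "i \<noteq> k" for k
      using that mm iq by (intro Mdisj) auto
  next
    fix v assume v: "v \<in> V"
    show "49 / 100 * real d \<le> real (deg (cross H) v)" by (rule crossL[OF v])
    show "real (deg (cross H) v) \<le> 51 / 100 * real d" by (rule crossH[OF v])
    have "card {i\<in>?Q. v \<notin> \<Union>(MA i \<union> MB i)} \<le> card {i\<in>{..<q}. v \<notin> \<Union>(MA i \<union> MB i)}"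
      using mm by (intro card_mono) auto
    then show "real (card {i\<in>?Q. v \<notin> \<Union>(MA i \<union> MB i)}) \<le> 4 / 10 ^ 8 * d" using unc[OF v] by linarith
  qed simp
  then obtain P where P': "\<forall>i\<in>?Q. P i \<subseteq> H \<and> matching (P i) \<and> \<Union>(P i) = V \<and> inner (P i) \<subseteq> MA i \<union> MB i \<and>
    (\<forall>j\<in>?Q. i \<noteq> j \<longrightarrow> P i \<inter> P j = {}) \<and>
    (\<forall>v\<in>V. real (card {i\<in>?Q. v \<in> \<Union>(MA i \<union> MB i - P i)}) \<le> card ?Q / 40000 + d / 10 ^ 8)" by (rule exE)
  have P: "P i \<subseteq> H" "matching (P i)" "\<Union>(P i) = V" "inner (P i) \<subseteq> M i" if "i \<in> ?Q" for i
    using bspec[OF P' that] unfolding M_def by (simp_all only: simp_thms)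
  have Pd: "\<forall>j\<in>?Q. i \<noteq> j \<longrightarrow> P i \<inter> P j = {}" if "i \<in> ?Q" for i
    using bspec[OF P' that] by (elim conjE)
  have drop: "\<forall>v\<in>V. real (card {i\<in>?Q. v \<in> \<Union>(M i - P i)}) \<le> card ?Q / 40000 + d / 10 ^ 8" if "i \<in> ?Q" for i
    using bspec[OF P' that] unfolding M_def by (elim conjE)
  have Pd: "P i \<inter> P k = {}" if "i \<in> ?Q" "k \<in> ?Q" "i \<noteq> k" for i k using Pd[OF that(1)] that by metis
  note rem = colouring_remove_perfect_matchings[where P = P and J = ?Q, OF fH VN r finite_atLeastLessThan P(1) P(2) P(3) Pd]
  let ?H = "H - (\<Union>i\<in>?Q. P i)"
  have req: "d - q + m' - card ?Q = d - q + m" using mm by simp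
  have host': "host ?H (d - q + min q (j * b))"
    unfolding host_def m_def[symmetric]
  proof (intro conjI ballI)
    show "edges ?H" using H by (rule edges_subset) auto
    show "\<Union>?H \<subseteq> V" using HV by auto
    show "deg ?H v = d - q + m" if "v \<in> V" for v using rem(1)[of v] that req by simp
    show "edge_bound ?H V (d / card V) \<kappa>" by (rule edge_bound_subset[OF eb finV]) auto
  qed
  have "\<exists>c. colouring ?H (d - q + min q (j * b)) c"
  proof (rule Suc.IH[OF _ host'])
    show "j \<le> 6" using Suc.prems(1) by simp
    show "MA i \<union> MB i \<subseteq> ?H" if "i < min q (j * b)" for i
    proof -
      have i: "i < m" "i < q" "i < m'" using that mm by (auto simp: m_def)
      have "M i \<inter> P k = {}" if k: "k \<in> ?Q" for k
      proof -
        have "M i \<inter> M k = {}" unfolding M_def using k i mm by (intro Mdisj) auto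
        then show ?thesis using P(4)[OF k] Minner[OF i(3)] by blast
      qed
      then show ?thesis using MH[OF i(3)] unfolding M_def by blast
    qed
    show "real (deg (cross ?H) v) \<le> 51 / 100 * d" if v: "v \<in> V" for v
    proof -
      have "deg (cross ?H) v \<le> deg (cross H) v" using fH by (intro deg_mono) auto
      then show ?thesis using crossH[OF v] by linarith
    qed
    show "real (deg (inner ?H - (\<Union>i<min q (j * b). MA i \<union> MB i)) v) \<le> (6 - real j) * (251 / 10 ^ 8 * d)" if v: "v \<in> V" for v
    proof -
      have fin1: "finite (?L \<union> (\<Union>i\<in>?Q. M i - P i))" using fH finM by auto
      \<comment> \<open>The new stray inner edges are exactly edges of the batch that its perfect
        matching did not keep; all others were stray before.\<close>
      have "inner ?H - (\<Union>i<m. M i) \<subseteq> ?L \<union> (\<Union>i\<in>?Q. M i - P i)"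
      proof
        fix e assume e: "e \<in> inner ?H - (\<Union>i<m. M i)"
        show "e \<in> ?L \<union> (\<Union>i\<in>?Q. M i - P i)"
        proof (cases "\<exists>i<m'. e \<in> M i")
          case True
          then obtain i where i: "i < m'" "e \<in> M i" by blast
          have "\<not> i < m" using e i(2) by blast
          then have iQ: "i \<in> ?Q" using i(1) by simp
          have "e \<notin> P i" using e iQ by blast
          then have "e \<in> M i - P i" using i by simp
          then show ?thesis using iQ by blast
        next
          case False
          then have "e \<in> ?L" using e by simp
          then show ?thesis by (rule UnI1)
        qed
      qed
      then have "deg (inner ?H - (\<Union>i<m. M i)) v \<le> deg (?L \<union> (\<Union>i\<in>?Q. M i - P i)) v"
        using fin1 by (intro deg_mono)
      also have "\<dots> \<le> deg ?L v + deg (\<Union>i\<in>?Q. M i - P i) v" by (rule deg_Un_le)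
      also have "deg (\<Union>i\<in>?Q. M i - P i) v \<le> card {i\<in>?Q. v \<in> \<Union>(M i - P i)}"
      proof (rule deg_UN_le)
        fix i assume "i \<in> ?Q"
        then have "i < q" "i < m'" using mm by auto
        then show "finite (M i - P i)" "matching (M i - P i)"
          using finM matM by (auto intro: matching_subset)
      qed simp
      finally have "real (deg (inner ?H - (\<Union>i<m. M i)) v) \<le> real (deg ?L v + card {i\<in>?Q. v \<in> \<Union>(M i - P i)})"
        by simp
      moreover have "real (card {i\<in>?Q. v \<in> \<Union>(M i - P i)}) \<le> 251 / 10 ^ 8 * d"
      proof (cases "?Q = {}")
        case True
        then have "{i\<in>?Q. v \<in> \<Union>(M i - P i)} = {}" by blast
        then have "card {i\<in>?Q. v \<in> \<Union>(M i - P i)} = 0" by (simp only: card.empty)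
        then show ?thesis by (simp only:) simp
      next
        case False
        then obtain k where "k \<in> ?Q" by blast
        from bspec[OF drop[OF this] v]
        have "real (card {i\<in>?Q. v \<in> \<Union>(M i - P i)}) \<le> card ?Q / 40000 + d / 10 ^ 8" .
        also have "card ?Q / 40000 + d / 10 ^ 8 \<le> 251 / 10 ^ 8 * d" using Qb by (simp add: field_simps)
        finally show ?thesis .
      qed
      moreover note innerL[OF v]
      ultimately show ?thesis unfolding m_def[symmetric] M_def[symmetric] by (simp add: algebra_simps)
    qed
  qed
  then have "\<exists>c. colouring ?H (d - q + m' - card ?Q) c" unfolding req m_def[symmetric] .
  then show ?case using rem(3) unfolding m'_def by simp
qed

end

theorem pseudorandom_colouring:
  fixes G :: "nat set set" and n d :: nat and \<kappa> :: real
  assumes G: "edges G" and GV: "\<Union>G \<subseteq> {..<n}" and n: "even n" "n > 0"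
    and reg: "\<And>v. v < n \<Longrightarrow> deg G v = d" and eb: "edge_bound G {..<n} (d / n) \<kappa>"
    and \<kappa>: "0 \<le> \<kappa>" "\<kappa> \<le> d / 10 ^ 6" and d_large: "d \<ge> 10 ^ 9"
    and small: "8 * real d * (8 * real d * 40000) * exp (- (1 / 10 ^ 10)\<^sup>2 * real d / 64) \<le> 1"
  shows "\<exists>c. colouring G d c"
proof -
  let ?\<theta> = "1 / 10 ^ 10 :: real"
  have d0: "real d \<ge> 10 ^ 9" using d_large by simp
  have d1: "real d \<ge> 1" using d0 by simp
  have fG: "finite G" using G by (simp add: edges_def)
  have degle: "real (deg G v) \<le> d" for v
    using reg[of v] deg_outside[OF GV, of v] by (cases "v < n") auto
  have "8 * real d * (2 * real d) \<le> 8 * real d * (8 * real d * 40000)" by (intro mult_left_mono) auto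
  then have "8 * real d * (2 * real d) * exp (- ?\<theta>\<^sup>2 * real d / 64) \<le>
    8 * real d * (8 * real d * 40000) * exp (- ?\<theta>\<^sup>2 * real d / 64)" by (rule mult_right_mono) simp
  then have small': "8 * real d * (2 * real d) * exp (- ?\<theta>\<^sup>2 * real d / 64) \<le> 1" using small by linarith
  have "\<exists>A\<subseteq>{..<n}. card A = n div 2 \<and> (\<forall>v. \<bar>real (card (nb G v \<inter> A)) - deg G v / 2\<bar> \<le> ?\<theta> * d)"
    by (rule balanced_halving[OF G GV n(1) degle _ _ d1 small']) simp_all
  then obtain A where A: "A \<subseteq> {..<n}" "card A = n div 2"
    and half: "\<And>v. \<bar>real (card (nb G v \<inter> A)) - deg G v / 2\<bar> \<le> ?\<theta> * d" by auto
  have cardB: "card A = card ({..<n} - A)"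
    using A n by (simp add: card_Diff_subset finite_subset) (auto elim!: evenE)
  interpret halved "{..<n}" A d \<kappa>
    by unfold_locales (use A n cardB \<kappa> d_large small in auto)
  have host: "host G d" using G GV reg eb by (auto simp: host_def)
  let ?I = "inner G"
  have eI: "edges ?I" and eC: "edges (cross G)" using G by (auto intro: edges_subset)
  have cd: "real (deg G v) = real (card (nb G v \<inter> A)) + real (card (nb G v - A))" for v
    using card_Int_Diff[OF finite_nb[OF G, of v], of A] card_nb[OF G, of v] by simp
  have degI: "\<bar>real (deg ?I v) - deg G v / 2\<bar> \<le> ?\<theta> * d" for v
    using half[of v] cd[of v] unfolding card_nb[OF eI, symmetric] nb_inner[OF G] abs_le_iff
    by (cases "v \<in> A") (simp_all add: field_simps)
  have degC: "\<bar>real (deg (cross G) v) - deg G v / 2\<bar> \<le> ?\<theta> * d" for v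
    using half[of v] cd[of v] unfolding card_nb[OF eC, symmetric] nb_cross[OF G] abs_le_iff
    by (cases "v \<in> A") (simp_all add: field_simps)
  define x where "x = (1 / 2 + 1 / 10 ^ 9) * real d"
  \<comment> \<open>Thirty halvings push \<open>x / 2 ^ 30\<close> below \<open>d / 10 ^ 9\<close>,
    and their errors sum to \<open>9 / 10 ^ 9 * d\<close>. With the slack in \<open>x\<close> the
    excess over \<open>d / 2\<close> is at most \<open>11 / 10 ^ 9 * d\<close>.\<close>
  have "\<exists>q c. colouring ?I q c \<and> real q \<le> x + x / 2 ^ 30 + 3 * real 30 * ?\<theta> * d"
  proof (rule colouring_by_halving[OF n(1) _ _ d1 small' eI])
    show "\<Union>?I \<subseteq> {..<n}" using GV by auto
    show "real (deg ?I v) \<le> x" for v using degI[of v] degle[of v] d0 unfolding x_def abs_le_iff by simp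
    show "0 \<le> x" "x \<le> real d" by (simp_all add: x_def)
  qed simp_all
  then obtain q c where c: "colouring ?I q c" and q0: "real q \<le> x + x / 2 ^ 30 + 3 * real 30 * ?\<theta> * d" by blast
  have q: "real q \<le> (1 / 2 + 11 / 10 ^ 9) * d" using q0 d0 unfolding x_def by simp
  have inI: "real (deg ?I v) \<ge> (1 / 2 - 1 / 10 ^ 10) * d" if "v < n" for v
    using degI[of v] reg[OF that] unfolding abs_le_iff by (simp add: algebra_simps)
  have Iparts: "?I = inA G \<union> inB G" by (rule inner_eq[OF G])
  have q1: "q > 0"
  proof (rule ccontr)
    assume "\<not> ?thesis"
    then have "?I = {}" using c by (auto simp: colouring_def)
    then have "deg ?I 0 = 0" by (simp only: deg_empty)
    then show False using inI[of 0] n d0 by simp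
  qed
  have eA: "edges (inA G)" and eB: "edges (inB G)" using G by (auto intro: edges_subset)
  \<comment> \<open>Each side is recoloured equitably with the same \<open>q\<close>; since the
    sides have equally many edges, classes of equal colour match in size.\<close>
  have "colouring (inA G) q c" "colouring (inB G) q c"
    by (rule colouring_subset[OF c[unfolded Iparts]], simp)+
  then obtain cA cB where cA: "colouring (inA G) q cA" "\<And>i. i < q \<Longrightarrow> card {e\<in>inA G. cA e = i} = eq_size (card (inA G)) q i"
    and cB: "colouring (inB G) q cB" "\<And>i. i < q \<Longrightarrow> card {e\<in>inB G. cB e = i} = eq_size (card (inB G)) q i"
    using equitable_colouring[OF eA, of q c] equitable_colouring[OF eB, of q c] q1 by auto
  define MA where "MA i = {e\<in>inA G. cA e = i}" for i
  define MB where "MB i = {e\<in>inB G. cB e = i}" for i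
  \<comment> \<open>As \<open>q\<close> barely exceeds \<open>d / 2\<close>, six batches of at most
    \<open>d / 10\<close> colours suffice despite the rounding.\<close>
  define b where "b = d div 10"
  have b: "real b \<le> d / 10" by (simp add: b_def)
  have "10 * b + 10 \<ge> d" by (simp add: b_def)
  then have "10 * real b + 10 \<ge> real d" by linarith
  then have "real q \<le> real (6 * b)" using q d0 by simp
  then have min: "min q (6 * b) = q" by simp
  have qd: "q \<le> d" using q d0 by simp
  have IM: "?I \<subseteq> (\<Union>i<q. MA i \<union> MB i)"
    unfolding Iparts using cA(1) cB(1) by (auto simp: MA_def MB_def colouring_def)
  have mMA: "matching (MA i)" for i unfolding MA_def by (rule colouring_class_matching[OF cA(1)])
  have mMB: "matching (MB i)" for i unfolding MB_def by (rule colouring_class_matching[OF cB(1)])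
  have eMA: "edges (MA i)" for i using eA by (rule edges_subset) (auto simp: MA_def)
  have AB: "e \<notin> inB G" if "e \<in> inA G" for e using inA_inB_disjoint[OF G] that by blast
  have "\<exists>c. colouring G (d - q + min q (6 * b)) c"
  proof (rule colouring_batches[where MA = MA and MB = MB and q = q and b = b])
    fix i assume i: "i < q"
    show "matching (MA i)" "matching (MB i)" by (rule mMA, rule mMB)
    show "card (MA i) = card (MB i)"
      unfolding MA_def MB_def cA(2)[OF i] cB(2)[OF i] side_edges_balanced[OF host] ..
    show "(MA i \<union> MB i) \<inter> (MA k \<union> MB k) = {}" if "i \<noteq> k" for k
      using that AB by (auto simp: MA_def MB_def)
    \<comment> \<open>Summing inner degrees over \<open>A\<close> bounds \<open>card (inA G)\<close>
      from below. As \<open>q\<close> is nearly \<open>d / 2\<close>, a class of average size misses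
      at most \<open>3 / 10 ^ 8 * card A\<close> vertices of \<open>A\<close>, plus 2 for rounding
      down; \<open>card A\<close> is at least \<open>5 * 10 ^ 8\<close>, which absorbs the
      2.\<close>
    show "real (card (A - \<Union>(MA i))) \<le> 1 / 10 ^ 7 * card A"
    proof -
      have "card (A - \<Union>(MA i)) + 2 * card (MA i) = card A"
        by (rule card_Diff_Union_matching[OF eMA mMA]) (auto simp: MA_def finA)
      then have 1: "real (card (A - \<Union>(MA i))) + 2 * real (card (MA i)) = card A" by linarith
      have "(\<Sum>e\<in>?I. card (e \<inter> A)) = (\<Sum>e\<in>inA G. card (e \<inter> A)) + (\<Sum>e\<in>inB G. card (e \<inter> A))"
        unfolding Iparts using fG by (intro sum.union_disjoint inA_inB_disjoint[OF G]) auto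
      also have "(\<Sum>e\<in>inA G. card (e \<inter> A)) = (\<Sum>e\<in>inA G. 2)"
        by (intro sum.cong) (auto simp: card_2_cases[OF G])
      finally have "(\<Sum>v\<in>A. deg ?I v) = 2 * card (inA G)" using sum_deg[OF eI finA] by simp
      then have 2: "(\<Sum>v\<in>A. real (deg ?I v)) = 2 * real (card (inA G))"
        unfolding of_nat_sum[symmetric] by simp
      have "card A * ((1 / 2 - 1 / 10 ^ 10) * real d) \<le> (\<Sum>v\<in>A. real (deg ?I v))"
        using sum_bounded_below[of A "(1 / 2 - 1 / 10 ^ 10) * real d" "\<lambda>v. real (deg ?I v)"] inI A by auto
      moreover have "card A * ((1 - 3 / 10 ^ 8) * real q) \<le> card A * ((1 / 2 - 1 / 10 ^ 10) * real d)"
        using q d0 by (intro mult_left_mono) auto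
      ultimately have 3: "card A * ((1 - 3 / 10 ^ 8) * real q) \<le> 2 * real (card (inA G))" using 2 by linarith
      have "card (inA G) \<le> q * (card (inA G) div q) + q"
        using mult_div_mod_eq[of q "card (inA G)"] mod_less_divisor[OF q1, of "card (inA G)"] by linarith
      also have "card (inA G) div q \<le> card (MA i)" unfolding MA_def cA(2)[OF i] by (simp add: eq_size_def)
      finally have "card (inA G) \<le> q * card (MA i) + q" by simp
      then have "real (card (inA G)) \<le> real (q * card (MA i) + q)" by (rule of_nat_mono)
      then have "real q * (card A * (1 - 3 / 10 ^ 8)) \<le> real q * (2 * real (card (MA i)) + 2)"
        using 3 by (simp add: algebra_simps)
      then have 4: "card A * (1 - 3 / 10 ^ 8) \<le> 2 * real (card (MA i)) + 2" using q1 by simp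
      have "d \<le> n"
      proof -
        have "card (nb G 0) \<le> card {..<n}" using nb_subset[of G 0] GV by (intro card_mono) auto
        then show ?thesis using card_nb[OF G, of 0] reg[of 0] n by simp
      qed
      then have "2 * card A \<ge> d" using A(2) n by auto
      then have "2 * real (card A) \<ge> 10 ^ 9" using d_large by simp
      then show ?thesis using 1 4 by (simp add: algebra_simps)
    qed
  next
    fix v assume v: "v \<in> {..<n}"
    have sub: "finite (\<Union>i<q. MA i \<union> MB i)" using fG by (auto simp: MA_def MB_def)
    have "deg ?I v \<le> deg (\<Union>i<q. MA i \<union> MB i) v" by (rule deg_mono[OF sub IM])
    also have "\<dots> \<le> card {i\<in>{..<q}. v \<in> \<Union>(MA i \<union> MB i)}"
    proof (rule deg_UN_le)
      fix i
      show "finite (MA i \<union> MB i)" using fG by (auto simp: MA_def MB_def)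
      show "matching (MA i \<union> MB i)" using mMA mMB by (rule matching_Un) (auto simp: MA_def MB_def)
    qed simp
    finally have 1: "deg ?I v \<le> card {i\<in>{..<q}. v \<in> \<Union>(MA i \<union> MB i)}" .
    have "card {..<q} = card ({..<q} \<inter> {i. v \<in> \<Union>(MA i \<union> MB i)}) + card ({..<q} - {i. v \<in> \<Union>(MA i \<union> MB i)})"
      by (rule card_Int_Diff) simp
    then have "q = card {i\<in>{..<q}. v \<in> \<Union>(MA i \<union> MB i)} + card {i\<in>{..<q}. v \<notin> \<Union>(MA i \<union> MB i)}"
      by (simp add: Int_def set_diff_eq)
    \<comment> \<open>The number of colours missing at \<open>v\<close> is at most \<open>q\<close>
      minus its inner degree; both are close to \<open>d / 2\<close>.\<close>
    then have "real (deg ?I v) + real (card {i\<in>{..<q}. v \<notin> \<Union>(MA i \<union> MB i)}) \<le> real q" using 1 by linarith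
    then show "real (card {i\<in>{..<q}. v \<notin> \<Union>(MA i \<union> MB i)}) \<le> 4 / 10 ^ 8 * d"
      using inI[of v] v q d0 by (simp add: algebra_simps)
    show "real (deg (cross G) v) \<le> 51 / 100 * d" using degC[of v] reg[of v] v d0 unfolding abs_le_iff by simp
    have "?I - (\<Union>i<min q (6 * b). MA i \<union> MB i) = {}" unfolding min using IM by auto
    then show "real (deg (?I - (\<Union>i<min q (6 * b). MA i \<union> MB i)) v) \<le> (6 - real 6) * (251 / 10 ^ 8 * d)"
      by (simp only: deg_empty) simp
  next
    show "real q \<le> (1 / 2 + 3 / 10 ^ 8) * d" using q d0 by (simp add: algebra_simps)
    show "host G (d - q + min q (6 * b))" using host qd by (simp add: min)
  qed (use b in \<open>auto simp: MA_def MB_def\<close>)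
  then show ?thesis using qd by (simp add: min)
qed

section \<open>The expander mixing lemma\<close>

text \<open>A complex eigenvalue exists and is real because its Hermitian form is. It is then a root
  of the real characteristic polynomial, which supplies a real eigenvector.\<close>

lemma real_symmetric_eigenvector:
  fixes A :: "real mat"
  assumes A: "A \<in> carrier_mat n n" and sym: "A\<^sup>T = A" and n: "n > 0"
  shows "\<exists>e v. v \<in> carrier_vec n \<and> v \<bullet> v = 1 \<and> A *\<^sub>v v = e \<cdot>\<^sub>v v"
proof -
  let ?c = "complex_of_real"
  define C where "C = map_mat ?c A"
  have C: "C \<in> carrier_mat n n" using A by (simp add: C_def)
  obtain as where as: "char_poly C = (\<Prod>a\<leftarrow>as. [:- a, 1:])" "length as = n"
    using char_poly_factorized[OF C] by auto
  then obtain z as' where "as = z # as'" using n by (cases as) auto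
  then have root: "poly (char_poly C) z = 0" using as by simp
  then have "eigenvalue C z" using eigenvalue_root_char_poly[OF C] by simp
  then obtain x where x: "x \<in> carrier_vec n" "x \<noteq> 0\<^sub>v n" "C *\<^sub>v x = z \<cdot>\<^sub>v x"
    using C by (auto simp: eigenvalue_def eigenvector_def)
  have symA: "A $$ (i, j) = A $$ (j, i)" if "i < n" "j < n" for i j
    using arg_cong[OF sym, of "\<lambda>M. M $$ (i, j)"] A that by simp
  have zx: "z * x $ i = (\<Sum>j<n. ?c (A $$ (i, j)) * x $ j)" if "i < n" for i
  proof -
    have "z * x $ i = (C *\<^sub>v x) $ i" using x that by simp
    also have "\<dots> = row C i \<bullet> x" using C that by simp
    also have "\<dots> = (\<Sum>j<n. ?c (A $$ (i, j)) * x $ j)"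
      using C A x that unfolding scalar_prod_def by (intro sum.cong) (auto simp: C_def lessThan_atLeast0)
    finally show ?thesis .
  qed
  define S where "S = (\<Sum>i<n. \<Sum>j<n. cnj (x $ i) * ?c (A $$ (i, j)) * x $ j)"
  define N where "N = (\<Sum>i<n. (cmod (x $ i))\<^sup>2)"
  have "z * ?c N = (\<Sum>i<n. cnj (x $ i) * (z * x $ i))"
    unfolding N_def of_real_sum sum_distrib_left by (intro sum.cong) (simp_all add: complex_norm_square mult_ac del: of_real_power)
  also have "\<dots> = S" unfolding S_def by (intro sum.cong) (auto simp: zx sum_distrib_left mult_ac)
  finally have zN: "z * ?c N = S" .
  have "cnj S = (\<Sum>i<n. \<Sum>j<n. cnj (x $ j) * ?c (A $$ (j, i)) * x $ i)"
    unfolding S_def cnj_sum by (intro sum.cong) (auto simp: symA mult_ac)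
  also have "\<dots> = S" unfolding S_def by (rule sum.swap)
  finally have "cnj (z * ?c N) = z * ?c N" using zN by simp
  then have "(cnj z - z) * ?c N = 0" by (simp add: algebra_simps)
  moreover have "N \<noteq> 0"
  proof
    assume "N = 0"
    then have "\<forall>i\<in>{..<n}. (cmod (x $ i))\<^sup>2 = 0" unfolding N_def by (subst (asm) sum_nonneg_eq_0_iff) auto
    then have "x = 0\<^sub>v n" using x(1) by (intro eq_vecI) auto
    then show False using x(2) by simp
  qed
  ultimately have "cnj z = z" by simp
  then have z: "z = ?c (Re z)" by (simp add: complex_eq_iff)
  have "char_poly C = map_poly ?c (char_poly A)" unfolding C_def by (rule of_real_hom.char_poly_hom[OF A])
  then have "?c (poly (char_poly A) (Re z)) = poly (char_poly C) z"
    using z by (metis of_real_hom.poly_map_poly)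
  then have "poly (char_poly A) (Re z) = 0" using root by simp
  then have "eigenvalue A (Re z)" using eigenvalue_root_char_poly[OF A] by simp
  then obtain u where u: "u \<in> carrier_vec n" "u \<noteq> 0\<^sub>v n" "A *\<^sub>v u = Re z \<cdot>\<^sub>v u"
    using A by (auto simp: eigenvalue_def eigenvector_def)
  have uu: "u \<bullet> u > 0"
  proof -
    have eq: "u \<bullet> u = (\<Sum>i<n. (u $ i)\<^sup>2)" using u by (simp add: scalar_prod_def power2_eq_square lessThan_atLeast0)
    have "u \<bullet> u \<noteq> 0"
    proof
      assume "u \<bullet> u = 0"
      then have "\<forall>i\<in>{..<n}. (u $ i)\<^sup>2 = 0" unfolding eq by (subst (asm) sum_nonneg_eq_0_iff) auto
      then have "u = 0\<^sub>v n" using u(1) by (intro eq_vecI) auto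
      then show False using u(2) by simp
    qed
    moreover have "u \<bullet> u \<ge> 0" unfolding eq by (intro sum_nonneg) auto
    ultimately show ?thesis by simp
  qed
  define t where "t = 1 / sqrt (u \<bullet> u)"
  have "(t \<cdot>\<^sub>v u) \<bullet> (t \<cdot>\<^sub>v u) = t * t * (u \<bullet> u)" using u by simp
  also have "\<dots> = 1" using uu by (simp add: t_def)
  finally have "(t \<cdot>\<^sub>v u) \<bullet> (t \<cdot>\<^sub>v u) = 1" .
  moreover have "A *\<^sub>v (t \<cdot>\<^sub>v u) = Re z \<cdot>\<^sub>v (t \<cdot>\<^sub>v u)"
    using u A by (simp add: mult_mat_vec smult_smult_assoc mult.commute)
  ultimately show ?thesis using u by (intro exI[of _ "Re z"] exI[of _ "t \<cdot>\<^sub>v u"]) auto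
qed

text \<open>The Householder reflection exchanging v and the first unit vector.\<close>
lemma orthogonal_first_column:
  fixes v :: "real vec"
  assumes v: "v \<in> carrier_vec n" "v \<bullet> v = 1" and n: "n > 0"
  shows "\<exists>W\<in>carrier_mat n n. W\<^sup>T = W \<and> W * W = 1\<^sub>m n \<and> W *\<^sub>v unit_vec n 0 = v"
proof -
  define w where "w i = v $ i - (if i = 0 then 1 else 0)" for i
  define m where "m = (\<Sum>i<n. w i * w i)"
  \<comment> \<open>The reflection is \<open>1 - c w w^T\<close> with \<open>m\<close> the squared
    length of \<open>w\<close>. If \<open>v\<close> is already the first unit vector then
    \<open>w = 0\<close>, and \<open>c = 0\<close> gives the identity.\<close>
  define c where "c = (if m = 0 then 0 else 2 / m)"
  define W where "W = mat n n (\<lambda>(i, j). (if i = j then 1 else 0) - c * w i * w j)"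
  have W: "W \<in> carrier_mat n n" by (simp add: W_def)
  have vv: "(\<Sum>i<n. v $ i * v $ i) = 1" using v by (simp add: scalar_prod_def lessThan_atLeast0)
  have "m = (\<Sum>i<n. v $ i * v $ i - (if i = 0 then 2 * v $ 0 - 1 else 0))"
    unfolding m_def by (intro sum.cong) (auto simp: w_def algebra_simps)
  also have "\<dots> = 1 - (2 * v $ 0 - 1)" using n by (simp add: sum_subtractf vv)
  finally have m: "m = - 2 * w 0" by (simp add: w_def)
  have w0: "w i = 0" if "m = 0" "i < n" for i
  proof -
    have "\<forall>i\<in>{..<n}. w i * w i = 0" using that(1) unfolding m_def by (subst (asm) sum_nonneg_eq_0_iff) auto
    then show ?thesis using that by auto
  qed
  have cm: "c * c * m = 2 * c" by (simp add: c_def)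
  have "W * W = 1\<^sub>m n"
  proof (rule eq_matI)
    fix i j assume "i < dim_row (1\<^sub>m n)" "j < dim_col (1\<^sub>m n)"
    then have ij: "i < n" "j < n" by auto
    have "(W * W) $$ (i, j) = (\<Sum>k<n. W $$ (i, k) * W $$ (k, j))"
      using W ij by (simp add: scalar_prod_def lessThan_atLeast0)
    also have "\<dots> = (\<Sum>k<n. (if i = k then (if k = j then 1 else 0) else 0) - (if i = k then c * w k * w j else 0)
        - (if k = j then c * w i * w k else 0) + c * c * w i * w j * (w k * w k))"
      using ij by (intro sum.cong) (auto simp: W_def algebra_simps)
    also have "\<dots> = (if i = j then 1 else 0) - c * w i * w j - c * w i * w j + c * c * w i * w j * m"
      using ij by (simp add: sum.distrib sum_subtractf m_def sum_distrib_left[symmetric])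
    also have "c * c * w i * w j * m = (c * c * m) * w i * w j" by simp
    finally show "(W * W) $$ (i, j) = 1\<^sub>m n $$ (i, j)" using ij by (simp add: cm)
  qed (use W in auto)
  moreover have "W\<^sup>T = W" by (rule eq_matI) (auto simp: W_def)
  moreover have "W *\<^sub>v unit_vec n 0 = v"
  proof (rule eq_vecI)
    fix i assume "i < dim_vec v"
    then have i: "i < n" using v by simp
    have "(W *\<^sub>v unit_vec n 0) $ i = W $$ (i, 0)" using W i n by simp
    also have "\<dots> = (if i = 0 then 1 else 0) - (c * w 0) * w i" using i n by (simp add: W_def)
    also have "(c * w 0) * w i = - w i" using m w0[OF _ i] by (cases "m = 0") (auto simp: c_def field_simps)
    finally show "(W *\<^sub>v unit_vec n 0) $ i = v $ i" by (simp add: w_def)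
  qed (use W v in auto)
  ultimately show ?thesis using W by blast
qed

section \<open>Orthogonal diagonalisation and the eigenvalue list\<close>

lemma block_diagonal_mult:
  fixes A1 A2 D1 D2 :: "'a :: semiring_1 mat"
  assumes "A1 \<in> carrier_mat m m" "A2 \<in> carrier_mat m m" "D1 \<in> carrier_mat n n" "D2 \<in> carrier_mat n n"
  shows "four_block_mat A1 (0\<^sub>m m n) (0\<^sub>m n m) D1 * four_block_mat A2 (0\<^sub>m m n) (0\<^sub>m n m) D2 =
    four_block_mat (A1 * A2) (0\<^sub>m m n) (0\<^sub>m n m) (D1 * D2)"
  using assms by (subst mult_four_block_mat[OF assms(1) zero_carrier_mat zero_carrier_mat assms(3) assms(2) zero_carrier_mat zero_carrier_mat assms(4)]) auto

text \<open>Deflation: conjugating by the reflection makes the first column a multiple of the first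
  unit vector, symmetry does the same for the first row, and the induction applies to the remaining
  block.\<close>

theorem real_symmetric_spectral:
  fixes A :: "real mat"
  assumes "A \<in> carrier_mat n n" and "A\<^sup>T = A"
  shows "\<exists>P es. P \<in> carrier_mat n n \<and> length es = n \<and> P\<^sup>T * P = 1\<^sub>m n \<and> A = P * mat_diag n ((!) es) * P\<^sup>T"
  using assms
proof (induction n arbitrary: A)
  case 0
  then show ?case by (intro exI[of _ "1\<^sub>m 0"] exI[of _ "[]"]) (auto intro!: eq_matI)
next
  case (Suc n A)
  let ?n = "Suc n"
  note A = Suc.prems(1) and sym = Suc.prems(2)
  obtain e v where v: "v \<in> carrier_vec ?n" "v \<bullet> v = 1" "A *\<^sub>v v = e \<cdot>\<^sub>v v"
    using real_symmetric_eigenvector[OF A sym] by auto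
  obtain W where W: "W \<in> carrier_mat ?n ?n" "W\<^sup>T = W" "W * W = 1\<^sub>m ?n" "W *\<^sub>v unit_vec ?n 0 = v"
    using orthogonal_first_column[OF v(1,2)] by auto
  define B where "B = W * (A * W)"
  have B: "B \<in> carrier_mat ?n ?n" using W A by (simp add: B_def)
  have AW: "A * W \<in> carrier_mat ?n ?n" using W A by simp
  have "B\<^sup>T = (A * W)\<^sup>T * W\<^sup>T" unfolding B_def by (rule transpose_mult[OF W(1) AW])
  also have "(A * W)\<^sup>T = W\<^sup>T * A\<^sup>T" by (rule transpose_mult[OF A W(1)])
  finally have symB: "B\<^sup>T = B" using W A sym by (simp add: B_def assoc_mult_mat[of _ ?n ?n _ ?n _ ?n])
  have u: "unit_vec ?n 0 \<in> carrier_vec ?n" by simp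
  have "B *\<^sub>v unit_vec ?n 0 = W *\<^sub>v (A *\<^sub>v (W *\<^sub>v unit_vec ?n 0))"
    unfolding B_def by (simp add: assoc_mult_mat_vec[OF W(1) AW u] assoc_mult_mat_vec[OF A W(1) u])
  also have "\<dots> = e \<cdot>\<^sub>v (W *\<^sub>v (W *\<^sub>v unit_vec ?n 0))" using W v by (simp add: mult_mat_vec)
  also have "W *\<^sub>v (W *\<^sub>v unit_vec ?n 0) = unit_vec ?n 0"
    by (simp add: assoc_mult_mat_vec[OF W(1) W(1) u, symmetric] W(3))
  finally have Bu: "B *\<^sub>v unit_vec ?n 0 = e \<cdot>\<^sub>v unit_vec ?n 0" .
  have B0: "B $$ (i, 0) = (if i = 0 then e else 0)" if "i < ?n" for i
    using arg_cong[OF Bu, of "\<lambda>x. x $ i"] B that by simp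
  have B0': "B $$ (0, i) = (if i = 0 then e else 0)" if "i < ?n" for i
    using arg_cong[OF symB, of "\<lambda>M. M $$ (i, 0)"] B that B0[OF that] by simp
  define A3 where "A3 = mat n n (\<lambda>(i, j). B $$ (Suc i, Suc j))"
  let ?E = "mat 1 1 (\<lambda>_. e)"
  have A3: "A3 \<in> carrier_mat n n" by (simp add: A3_def)
  have Bblock: "B = four_block_mat ?E (0\<^sub>m 1 n) (0\<^sub>m n 1) A3"
    by (rule eq_matI) (use B in \<open>auto simp: A3_def B0 B0'\<close>)
  have "A3\<^sup>T = A3"
  proof (rule eq_matI)
    fix i j assume "i < dim_row A3" "j < dim_col A3"
    then have ij: "Suc i < ?n" "Suc j < ?n" by (auto simp: A3_def)
    then show "A3\<^sup>T $$ (i, j) = A3 $$ (i, j)"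
      using arg_cong[OF symB, of "\<lambda>M. M $$ (Suc i, Suc j)"] B by (simp add: A3_def)
  qed (auto simp: A3_def)
  then obtain P es where P: "P \<in> carrier_mat n n" "length es = n" "P\<^sup>T * P = 1\<^sub>m n" "A3 = P * mat_diag n ((!) es) * P\<^sup>T"
    using Suc.IH[OF A3] by blast
  let ?D = "mat_diag n ((!) es)"
  have D: "?D \<in> carrier_mat n n" and PT: "P\<^sup>T \<in> carrier_mat n n" using P by auto
  have Ec: "?E \<in> carrier_mat 1 1" and PDc: "P * ?D \<in> carrier_mat n n" using P D by auto
  define Q where "Q = four_block_mat (1\<^sub>m 1) (0\<^sub>m 1 n) (0\<^sub>m n 1) P"
  define F where "F = four_block_mat ?E (0\<^sub>m 1 n) (0\<^sub>m n 1) ?D"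
  have Q: "Q \<in> carrier_mat ?n ?n" and F: "F \<in> carrier_mat ?n ?n"
    using four_block_carrier_mat[of "1\<^sub>m 1" 1 1 P n n] four_block_carrier_mat[of ?E 1 1 ?D n n] P(1) D
    by (simp_all add: Q_def F_def)
  have QT: "Q\<^sup>T = four_block_mat (1\<^sub>m 1) (0\<^sub>m 1 n) (0\<^sub>m n 1) (P\<^sup>T)"
    unfolding Q_def by (subst transpose_four_block_mat[OF _ _ _ P(1)]) auto
  have I: "1\<^sub>m 1 \<in> carrier_mat 1 1" by simp
  have QQ: "Q\<^sup>T * Q = 1\<^sub>m ?n"
    unfolding QT unfolding Q_def block_diagonal_mult[OF I I PT P(1)] P(3) by simp
  have F_diag: "F = mat_diag ?n ((!) (e # es))"
    by (rule eq_matI) (auto simp: F_def mat_diag_def nth_Cons')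
  have "1\<^sub>m 1 * ?E = ?E" "?E * 1\<^sub>m 1 = ?E" using Ec by simp_all
  then have QFQ: "Q * F * Q\<^sup>T = B"
    unfolding QT Bblock P(4) unfolding Q_def F_def
    by (simp only: block_diagonal_mult[OF I Ec P(1) D] block_diagonal_mult[OF Ec I PDc PT])
  define R where "R = W * Q"
  have R: "R \<in> carrier_mat ?n ?n" using W Q by (simp add: R_def)
  define T where "T = Q\<^sup>T"
  have T: "T \<in> carrier_mat ?n ?n" using Q by (simp add: T_def)
  have RT: "R\<^sup>T = T * W" unfolding R_def T_def using transpose_mult[OF W(1) Q] W(2) by simp
  note assoc = assoc_mult_mat[of _ ?n ?n _ ?n _ ?n] mult_carrier_mat[of _ ?n ?n _ ?n]
  have WW: "W * (W * X) = X" if "X \<in> carrier_mat ?n ?n" for X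
    using assoc_mult_mat[OF W(1) W(1) that] that unfolding W(3) by simp
  have "R\<^sup>T * R = T * (W * (W * Q))" unfolding RT unfolding R_def by (simp add: assoc W(1) T Q)
  then have 1: "R\<^sup>T * R = 1\<^sub>m ?n" unfolding WW[OF Q] using QQ by (simp add: T_def)
  have "R * F * R\<^sup>T = W * ((Q * F * T) * W)" unfolding RT unfolding R_def by (simp add: assoc W(1) T Q F)
  also have "Q * F * T = B" using QFQ by (simp add: T_def)
  also have "W * (B * W) = W * (W * (A * (W * W)))" unfolding B_def by (simp add: assoc W(1) A)
  also have "\<dots> = A" unfolding W(3) using WW[OF A] A by simp
  finally have "A = R * mat_diag ?n ((!) (e # es)) * R\<^sup>T" unfolding F_diag ..
  then show ?case using R 1 P(2) by (intro exI[of _ R] exI[of _ "e # es"]) auto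
qed

lemma order_prod_linear:
  fixes b :: "'a :: field"
  shows "order b (\<Prod>a\<leftarrow>xs. [:- a, 1:]) = count (mset xs) b"
proof (induction xs)
  case Nil
  then show ?case by (simp add: order_0I)
next
  case (Cons a xs)
  have nz: "(\<Prod>a\<leftarrow>ys. [:- a, 1:]) \<noteq> (0 :: 'a poly)" for ys by (subst prod_list_zero_iff) auto
  have "order b ([:- a, 1:] * (\<Prod>a\<leftarrow>xs. [:- a, 1:])) = order b [:- a, 1:] + order b (\<Prod>a\<leftarrow>xs. [:- a, 1:])"
    using nz[of "a # xs"] by (intro order_mult) simp
  moreover have "order b [:- a, 1:] = (if a = b then 1 else 0)"
    using order_power_n_n[of b 1] by (auto intro: order_0I)
  ultimately show ?case using Cons by simp
qed

text \<open>The definite description is justified here. A factorisation into linear factors fixes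
  the multiset of roots through their orders, and sorting fixes the list.\<close>

lemma adj_eigenvalues_eqI:
  assumes "char_poly (adj_matrix n E) = (\<Prod>a\<leftarrow>es. [:- a, 1:])"
  shows "sorted (rev (adj_eigenvalues n E))" and "mset (adj_eigenvalues n E) = mset es"
proof -
  have *: "ls = rev (sort es)" if "sorted (rev ls) \<and> char_poly (adj_matrix n E) = (\<Prod>a\<leftarrow>ls. [:- a, 1:])" for ls
  proof -
    have "count (mset ls) b = count (mset es) b" for b
      using that assms by (metis order_prod_linear)
    then have "mset (rev ls) = mset es" by (simp add: multiset_eq_iff)
    then have "sort es = rev ls" using that by (intro properties_for_sort) auto
    then show ?thesis by simp
  qed
  have "(\<Prod>a\<leftarrow>rev (sort es). [:- a, 1:]) = (\<Prod>a\<leftarrow>es. [:- a, 1:])"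
    using prod_mset_prod_list[of "map (\<lambda>a. [:- a, 1:]) (rev (sort es))"]
      prod_mset_prod_list[of "map (\<lambda>a. [:- a, 1:]) es"] by simp
  then have ex: "sorted (rev (rev (sort es))) \<and> char_poly (adj_matrix n E) = (\<Prod>a\<leftarrow>rev (sort es). [:- a, 1:])"
    using assms by simp
  have "adj_eigenvalues n E = rev (sort es)"
    unfolding adj_eigenvalues_def using ex * by (rule the_equality)
  then show "sorted (rev (adj_eigenvalues n E))" "mset (adj_eigenvalues n E) = mset es" by auto
qed

section \<open>Edge counts in an eigenbasis\<close>

lemma mult_mat_entry:
  assumes "X \<in> carrier_mat n n" "Y \<in> carrier_mat n n" "i < n" "j < n"
  shows "(X * Y) $$ (i, j) = (\<Sum>k<n. X $$ (i, k) * Y $$ (k, j))"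
  using assms by (simp add: scalar_prod_def lessThan_atLeast0)

lemma Cauchy_Schwarz_sum:
  fixes f g :: "'i \<Rightarrow> real"
  shows "(\<Sum>i\<in>I. \<bar>f i\<bar> * \<bar>g i\<bar>) \<le> sqrt ((\<Sum>i\<in>I. (f i)\<^sup>2) * (\<Sum>i\<in>I. (g i)\<^sup>2))"
  using L2_set_mult_ineq[of f g I] by (simp add: L2_set_def real_sqrt_mult)

text \<open>\<open>spectral_lambda\<close> refers to positions in a sorted list, while the
  diagonalisation yields the eigenvalues in unknown order. The two are linked by counting: at most
  one eigenvalue exceeds \<open>lam\<close> in absolute value. Regularity identifies it as
  \<open>d > lam\<close>.\<close>

theorem expander_mixing_upper:
  assumes E: "simple_graph n E" and reg: "regular n E d" and lam: "spectral_lambda n E \<le> lam" "lam < d"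
    and n: "n \<ge> 2" and X: "X \<subseteq> {..<n}" and Y: "Y \<subseteq> {..<n}"
  shows "real (card {(x, y). x \<in> X \<and> y \<in> Y \<and> E x y}) \<le> d / n * card X * card Y + lam * sqrt (real (card X) * real (card Y))"
proof -
  let ?A = "adj_matrix n E"
  have A: "?A \<in> carrier_mat n n" by (simp add: adj_matrix_def)
  have entry: "?A $$ (i, j) = (if E i j then 1 else 0)" if "i < n" "j < n" for i j
    using that by (simp add: adj_matrix_def)
  have Esym: "E i j \<longleftrightarrow> E j i" for i j using E by (auto simp: simple_graph_def)
  have "?A\<^sup>T = ?A" by (rule eq_matI) (use Esym in \<open>auto simp: adj_matrix_def\<close>)
  then obtain P es where P: "P \<in> carrier_mat n n" "length es = n" "P\<^sup>T * P = 1\<^sub>m n" "?A = P * mat_diag n ((!) es) * P\<^sup>T"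
    using real_symmetric_spectral[OF A] by blast
  let ?D = "mat_diag n ((!) es)"
  have D: "?D \<in> carrier_mat n n" and PT: "P\<^sup>T \<in> carrier_mat n n" using P by auto
  have PPT: "P * P\<^sup>T = 1\<^sub>m n" by (rule mat_mult_left_right_inverse[OF PT P(1) P(3)])
  have "similar_mat_wit ?A ?D P (P\<^sup>T)" by (rule similar_mat_witI[OF PPT P(3,4) A D P(1) PT])
  then have "char_poly ?A = char_poly ?D" by (intro char_poly_similar) (auto simp: similar_mat_def)
  also have "\<dots> = (\<Prod>a\<leftarrow>diag_mat ?D. [:- a, 1:])"
    by (rule char_poly_upper_triangular[OF D]) (auto simp: upper_triangular_def mat_diag_def)
  also have "diag_mat ?D = es" using P(2) by (auto simp: diag_mat_def mat_diag_def intro!: nth_equalityI)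
  finally have cp: "char_poly ?A = (\<Prod>a\<leftarrow>es. [:- a, 1:])" .
  define ls where "ls = adj_eigenvalues n E"
  have ls: "sorted (rev ls)" "mset ls = mset es" using adj_eigenvalues_eqI[OF cp] by (simp_all add: ls_def)
  have lenl: "length ls = n" using ls(2) P(2) by (metis size_mset)
  have lam': "\<bar>ls ! 1\<bar> \<le> lam" "\<bar>ls ! (n - 1)\<bar> \<le> lam"
    using lam(1) by (simp_all add: spectral_lambda_def Let_def ls_def)
  have tail: "\<bar>ls ! i\<bar> \<le> lam" if "1 \<le> i" "i < n" for i
  proof -
    have mono: "ls ! k \<le> ls ! j" if "j \<le> k" "k < n" for j k
      using sorted_rev_nth_mono[OF ls(1)] that lenl by simp
    show ?thesis using mono[of 1 i] mono[of i "n - 1"] that lam' by linarith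
  qed
  let ?big = "\<lambda>a. \<not> \<bar>a\<bar> \<le> lam"
  \<comment> \<open>The bounds at positions 1 and \<open>n - 1\<close> extend to all positions
    between them by monotonicity, leaving position 0 only.\<close>
  have "{i. i < n \<and> ?big (ls ! i)} \<subseteq> {0}" using tail by (auto simp: not_less_eq_eq Suc_le_eq)
  then have "card {i. i < n \<and> ?big (ls ! i)} \<le> 1" using card_mono[of "{0::nat}"] by fastforce
  then have "length (filter ?big ls) \<le> 1" by (simp add: length_filter_conv_card lenl)
  also have "length (filter ?big ls) = length (filter ?big es)"
    using ls(2) by (metis mset_filter size_mset)
  finally have big: "card {i. i < n \<and> ?big (es ! i)} \<le> 1" by (simp add: length_filter_conv_card P(2))
  define p where "p i k = P $$ (i, k)" for i k
  define e where "e k = es ! k" for k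
  have col: "(\<Sum>i<n. p i k * p i l) = (if k = l then 1 else 0)" if "k < n" "l < n" for k l
    using arg_cong[OF P(3), of "\<lambda>M. M $$ (k, l)"] P(1) that
    by (simp add: p_def scalar_prod_def lessThan_atLeast0)
  have row: "(\<Sum>k<n. p i k * p j k) = (if i = j then 1 else 0)" if "i < n" "j < n" for i j
    using arg_cong[OF PPT, of "\<lambda>M. M $$ (i, j)"] P(1) that
    by (simp add: p_def scalar_prod_def lessThan_atLeast0)
  have PD: "(P * ?D) $$ (i, k) = p i k * e k" if "i < n" "k < n" for i k
    using that P(1) by (simp add: mat_diag_mult_right p_def e_def)
  have a: "(if E i j then 1 else 0) = (\<Sum>k<n. e k * p i k * p j k)" if "i < n" "j < n" for i j
  proof -
    have "(if E i j then 1 else 0) = (P * ?D * P\<^sup>T) $$ (i, j)" using entry[OF that] P(4) by simp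
    also have "\<dots> = (\<Sum>k<n. (P * ?D) $$ (i, k) * P\<^sup>T $$ (k, j))"
      using that P(1) D PT by (intro mult_mat_entry mult_carrier_mat)
    also have "\<dots> = (\<Sum>k<n. e k * p i k * p j k)"
      using that P(1) by (intro sum.cong) (simp_all add: PD, simp_all add: p_def mult_ac)
    finally show ?thesis .
  qed
  \<comment> \<open>Coordinates of the all-ones vector in the eigenbasis.\<close>
  define u where "u k = (\<Sum>i<n. p i k)" for k
  have eu: "e k * u k = d * u k" if k: "k < n" for k
  proof -
    have rowsum: "(\<Sum>j<n. if E i j then 1 else 0 :: real) = d" if "i < n" for i
    proof -
      have "(\<Sum>j<n. if E i j then 1 else 0 :: real) = card ({..<n} \<inter> {j. E i j})" by (simp add: sum.If_cases)
      also have "{..<n} \<inter> {j. E i j} = {j. j < n \<and> E i j}" by auto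
      finally show ?thesis using reg that by (simp add: regular_def)
    qed
    have "d * u k = (\<Sum>i<n. p i k * d)" by (simp add: u_def sum_distrib_left mult.commute)
    also have "\<dots> = (\<Sum>i<n. p i k * (\<Sum>j<n. if E i j then 1 else 0))"
      by (intro sum.cong refl) (simp only: rowsum lessThan_iff)
    also have "\<dots> = (\<Sum>i<n. \<Sum>j<n. \<Sum>l<n. p i k * (e l * p i l * p j l))"
      by (intro sum.cong) (simp_all add: a sum_distrib_left)
    also have "\<dots> = (\<Sum>i<n. \<Sum>l<n. \<Sum>j<n. p i k * (e l * p i l * p j l))"
      by (intro sum.cong sum.swap) simp
    also have "\<dots> = (\<Sum>l<n. \<Sum>i<n. \<Sum>j<n. p i k * (e l * p i l * p j l))" by (rule sum.swap)
    also have "\<dots> = (\<Sum>l<n. e l * (\<Sum>i<n. p i k * p i l) * u l)"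
      unfolding u_def by (intro sum.cong) (simp_all add: sum_distrib_left sum_distrib_right mult_ac)
    also have "\<dots> = (\<Sum>l<n. if k = l then e l * u l else 0)"
      using k by (intro sum.cong) (simp_all add: col)
    also have "\<dots> = e k * u k" using k by simp
    finally show ?thesis by (rule sym)
  qed
  have proj: "(\<Sum>k<n. (\<Sum>i\<in>S. p i k) * (\<Sum>j\<in>T. p j k)) = card (S \<inter> T)" if "S \<subseteq> {..<n}" "T \<subseteq> {..<n}" for S T
  proof -
    have fin: "finite S" "finite T" using that finite_subset by auto
    have "(\<Sum>k<n. (\<Sum>i\<in>S. p i k) * (\<Sum>j\<in>T. p j k)) = (\<Sum>k<n. \<Sum>i\<in>S. \<Sum>j\<in>T. p i k * p j k)"
      by (simp add: sum_product)
    also have "\<dots> = (\<Sum>i\<in>S. \<Sum>k<n. \<Sum>j\<in>T. p i k * p j k)" by (rule sum.swap)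
    also have "\<dots> = (\<Sum>i\<in>S. \<Sum>j\<in>T. \<Sum>k<n. p i k * p j k)" by (intro sum.cong sum.swap) simp
    also have "\<dots> = (\<Sum>i\<in>S. \<Sum>j\<in>T. if i = j then 1 else 0)"
      using that by (intro sum.cong refl row) auto
    also have "\<dots> = (\<Sum>i\<in>S. if i \<in> T then 1 else 0)" using fin by (intro sum.cong) simp_all
    also have "\<dots> = card (S \<inter> T)" using fin by (simp add: sum.If_cases Int_def)
    finally show ?thesis .
  qed
  have "(\<Sum>k<n. u k * u k) = n" using proj[of "{..<n}" "{..<n}"] by (simp add: u_def)
  then have "\<exists>k<n. u k \<noteq> 0" using n by (intro ccontr[of "\<exists>k<n. u k \<noteq> 0"]) (simp add: sum.neutral)
  then obtain k0 where k0: "k0 < n" "u k0 \<noteq> 0" by blast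
  have e0: "e k0 = d" using eu[OF k0(1)] k0(2) by simp
  have small: "\<bar>e k\<bar> \<le> lam" if "k < n" "k \<noteq> k0" for k
  proof (rule ccontr)
    assume "\<not> ?thesis"
    then have "{k, k0} \<subseteq> {i. i < n \<and> ?big (es ! i)}" using that k0 e0 lam(2) by (auto simp: e_def)
    then have "card {k, k0} \<le> card {i. i < n \<and> ?big (es ! i)}" by (intro card_mono) auto
    then show False using big that by simp
  qed
  \<comment> \<open>A nonzero coordinate forces the eigenvalue \<open>d\<close>, so the all-ones
    vector is a multiple of column \<open>k0\<close>.\<close>
  have u0: "u k = 0" if "k < n" "k \<noteq> k0" for k
    using eu[OF that(1)] small[OF that] lam(2) by auto
  define xs where "xs S k = (\<Sum>i\<in>S. p i k)" for S k
  \<comment> \<open>Hence the coordinate along \<open>k0\<close> of an indicator vector is known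
    exactly; with \<open>u k0 * u k0 = n\<close> it produces the main term.\<close>
  have xu: "xs S k0 * u k0 = card S" if "S \<subseteq> {..<n}" for S
  proof -
    have "real (card S) = (\<Sum>k<n. xs S k * u k)"
      using proj[OF that, of "{..<n}"] that by (simp add: xs_def u_def Int_absorb2)
    also have "\<dots> = (\<Sum>k<n. if k = k0 then xs S k0 * u k0 else 0)" by (intro sum.cong) (auto simp: u0)
    also have "\<dots> = xs S k0 * u k0" using k0 by simp
    finally show ?thesis by simp
  qed
  have uu: "u k0 * u k0 = n" using xu[of "{..<n}"] by (simp add: xs_def u_def)
  have sq: "(\<Sum>k<n. (xs S k)\<^sup>2) = card S" if "S \<subseteq> {..<n}" for S
    using proj[OF that that] by (simp add: xs_def power2_eq_square)
  have fin: "finite X" "finite Y" using X Y finite_subset by auto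
  have "{(x, y). x \<in> X \<and> y \<in> Y \<and> E x y} = (SIGMA x:X. {y\<in>Y. E x y})" by auto
  then have "card {(x, y). x \<in> X \<and> y \<in> Y \<and> E x y} = (\<Sum>x\<in>X. card {y\<in>Y. E x y})" using fin by simp
  then have "real (card {(x, y). x \<in> X \<and> y \<in> Y \<and> E x y}) = (\<Sum>x\<in>X. \<Sum>y\<in>Y. if E x y then 1 else 0)"
    using fin by (simp add: sum.If_cases Int_def)
  also have "\<dots> = (\<Sum>x\<in>X. \<Sum>y\<in>Y. \<Sum>k<n. e k * p x k * p y k)"
    using X Y by (intro sum.cong refl a) auto
  also have "\<dots> = (\<Sum>x\<in>X. \<Sum>k<n. \<Sum>y\<in>Y. e k * p x k * p y k)" by (intro sum.cong sum.swap) simp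
  also have "\<dots> = (\<Sum>k<n. \<Sum>x\<in>X. \<Sum>y\<in>Y. e k * p x k * p y k)" by (rule sum.swap)
  also have "\<dots> = (\<Sum>k<n. e k * (xs X k * xs Y k))"
  proof (rule sum.cong)
    fix k
    have "xs X k * xs Y k = (\<Sum>x\<in>X. \<Sum>y\<in>Y. p x k * p y k)" by (simp only: xs_def sum_product)
    then show "(\<Sum>x\<in>X. \<Sum>y\<in>Y. e k * p x k * p y k) = e k * (xs X k * xs Y k)"
      by (simp only: sum_distrib_left mult.assoc)
  qed simp
  \<comment> \<open>At \<open>k0\<close> a nonnegative term is added, so that Cauchy-Schwarz runs
    over all coordinates, where the squared lengths are just \<open>card X\<close> and
    \<open>card Y\<close>.\<close>
  also have "\<dots> \<le> (\<Sum>k<n. (if k = k0 then d * (xs X k0 * xs Y k0) else 0) + lam * (\<bar>xs X k\<bar> * \<bar>xs Y k\<bar>))"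
  proof (rule sum_mono)
    fix k assume "k \<in> {..<n}"
    then have k: "k < n" by simp
    have lam0: "0 \<le> lam" using lam'(1) by linarith
    show "e k * (xs X k * xs Y k) \<le> (if k = k0 then d * (xs X k0 * xs Y k0) else 0) + lam * (\<bar>xs X k\<bar> * \<bar>xs Y k\<bar>)"
    proof (cases "k = k0")
      case True
      then show ?thesis using e0 lam0 by simp
    next
      case False
      have "e k * (xs X k * xs Y k) \<le> \<bar>e k\<bar> * (\<bar>xs X k\<bar> * \<bar>xs Y k\<bar>)"
        by (metis abs_ge_self abs_mult)
      also have "\<dots> \<le> lam * (\<bar>xs X k\<bar> * \<bar>xs Y k\<bar>)" using small[OF k False] by (intro mult_right_mono) auto
      finally show ?thesis using False by simp
    qed
  qed
  also have "\<dots> = d * (xs X k0 * xs Y k0) + lam * (\<Sum>k<n. \<bar>xs X k\<bar> * \<bar>xs Y k\<bar>)"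
    using k0 by (simp add: sum.distrib sum_distrib_left)
  also have "\<dots> \<le> d * (xs X k0 * xs Y k0) + lam * sqrt (real (card X) * real (card Y))"
    using Cauchy_Schwarz_sum[of "xs X" "xs Y" "{..<n}"] lam'(1) unfolding sq[OF X] sq[OF Y]
    by (intro add_left_mono mult_left_mono) auto
  also have "d * (xs X k0 * xs Y k0) = d / n * card X * card Y"
  proof -
    have "(xs X k0 * xs Y k0) * n = card X * card Y"
      unfolding uu[symmetric] using xu[OF X] xu[OF Y] by (metis mult.assoc mult.left_commute of_nat_mult)
    then show ?thesis using n by (simp add: field_simps)
  qed
  finally show ?thesis .
qed

section \<open>The chromatic index\<close>

lemma edges_graph_edges: "simple_graph n E \<Longrightarrow> edges (graph_edges n E)"
proof -
  assume E: "simple_graph n E"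
  have "graph_edges n E \<subseteq> Pow {..<n}" by (auto simp: graph_edges_def)
  then have "finite (graph_edges n E)" by (rule finite_subset) simp
  moreover have "card e = 2" if "e \<in> graph_edges n E" for e
  proof -
    obtain u v where "e = {u, v}" "E u v" using \<open>e \<in> graph_edges n E\<close> by (auto simp: graph_edges_def)
    moreover from this have "u \<noteq> v" using E by (auto simp: simple_graph_def)
    ultimately show ?thesis by simp
  qed
  ultimately show ?thesis by (simp add: edges_def)
qed

lemma doubleton_graph_edges:
  assumes "simple_graph n E"
  shows "{x, y} \<in> graph_edges n E \<longleftrightarrow> E x y"
  using assms unfolding graph_edges_def simple_graph_def by (auto simp: doubleton_eq_iff)

lemma proper_edge_colouring_iff: "proper_edge_colouring n E k c \<longleftrightarrow> colouring (graph_edges n E) k c"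
  by (simp only: proper_edge_colouring_def colouring_def)

lemma deg_graph_edges:
  assumes "simple_graph n E" "regular n E d" "v < n"
  shows "deg (graph_edges n E) v = d"
proof -
  have "nb (graph_edges n E) v = {u. u < n \<and> E v u}"
    using assms(1) by (auto simp: nb_def doubleton_graph_edges simple_graph_def)
  then show ?thesis
    using card_nb[OF edges_graph_edges[OF assms(1)], of v] assms(2,3) by (simp add: regular_def)
qed

text \<open>The trivial lower bound, which turns a colouring with \<open>d\<close> colours into the
  exact value.\<close>

lemma deg_le_colours:
  assumes c: "colouring F k c" and F: "finite F"
  shows "deg F v \<le> k"
proof -
  have "inj_on c {e\<in>F. v \<in> e}"
  proof (rule inj_onI)
    fix e f assume ef: "e \<in> {e\<in>F. v \<in> e}" "f \<in> {e\<in>F. v \<in> e}" "c e = c f"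
    then have "e \<inter> f \<noteq> {}" by auto
    then show "e = f" using c ef unfolding colouring_def by auto
  qed
  moreover have "c ` {e\<in>F. v \<in> e} \<subseteq> {..<k}" using c by (auto simp: colouring_def)
  ultimately have "card {e\<in>F. v \<in> e} \<le> card {..<k}" by (rule card_inj_on_le) simp
  then show ?thesis by (simp add: deg_def)
qed

theorem theorem1p1:
  fixes \<epsilon> :: real
  assumes "\<epsilon> > 0"
  shows "\<exists>d0 n0 :: nat. \<forall>n d :: nat. \<forall>E lam.
           even n \<and> n \<ge> n0 \<and> d0 \<le> d \<and> d \<le> n - 1 \<and>
           nd_lambda_graph n d lam E \<and> lam \<le> real d powr (1 - \<epsilon>)
           \<longrightarrow> chromatic_index n E = d"
proof -
  \<comment> \<open>Both the numerical condition of the local lemma and the spectral condition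
    involve \<open>d\<close> alone, so a threshold \<open>d0\<close> independent of \<open>n\<close>
    suffices.\<close>
  have "eventually (\<lambda>d::nat. 8 * real d * (8 * real d * 40000) * exp (- (1 / 10 ^ 10)\<^sup>2 * real d / 64) \<le> 1) at_top"
    by real_asymp
  moreover have "eventually (\<lambda>d::nat. real d powr (1 - \<epsilon>) \<le> real d / 10 ^ 6) at_top"
    using assms by real_asymp
  moreover have "eventually (\<lambda>d::nat. d \<ge> 10 ^ 9) at_top" by (rule eventually_ge_at_top)
  ultimately have "eventually (\<lambda>d::nat.
      8 * real d * (8 * real d * 40000) * exp (- (1 / 10 ^ 10)\<^sup>2 * real d / 64) \<le> 1 \<and>
      real d powr (1 - \<epsilon>) \<le> real d / 10 ^ 6 \<and> d \<ge> 10 ^ 9) at_top"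
    by (intro eventually_conj)
  then obtain d0 where d0: "\<forall>d\<ge>d0.
      8 * real d * (8 * real d * 40000) * exp (- (1 / 10 ^ 10)\<^sup>2 * real d / 64) \<le> 1 \<and>
      real d powr (1 - \<epsilon>) \<le> real d / 10 ^ 6 \<and> d \<ge> 10 ^ 9"
    unfolding eventually_at_top_linorder by (rule exE)
  have "chromatic_index n E = d"
    if n: "even n" and d: "d0 \<le> d" "d \<le> n - 1" and G: "nd_lambda_graph n d lam E"
      and lam: "lam \<le> real d powr (1 - \<epsilon>)" for n d E lam
  proof -
    have small: "8 * real d * (8 * real d * 40000) * exp (- (1 / 10 ^ 10)\<^sup>2 * real d / 64) \<le> 1"
      and pw: "real d powr (1 - \<epsilon>) \<le> real d / 10 ^ 6" and large: "d \<ge> 10 ^ 9" using mp[OF spec[OF d0] d(1)] by (simp_all only: simp_thms)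
    \<comment> \<open>A large \<open>d\<close> with \<open>d \<le> n - 1\<close> forces
      \<open>n\<close> to be large, so the eigenvalue list has a position 1.\<close>
    have n2: "n \<ge> 2" using d(2) large by simp
    have E: "simple_graph n E" and reg: "regular n E d" and sl: "spectral_lambda n E \<le> lam"
      using G by (auto simp: nd_lambda_graph_def)
    have lam1: "lam \<le> real d / 10 ^ 6" using lam pw by linarith
    have "0 \<le> spectral_lambda n E" by (simp add: spectral_lambda_def Let_def)
    then have lam0: "0 \<le> lam" using sl by linarith
    have lamd: "lam < real d" using lam1 large by simp
    let ?G = "graph_edges n E"
    have eG: "edges ?G" by (rule edges_graph_edges[OF E])
    have "edge_bound ?G {..<n} (d / n) lam"
      unfolding edge_bound_def doubleton_graph_edges[OF E]
      using expander_mixing_upper[OF E reg sl lamd n2] by blast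
    then have "\<exists>c. colouring ?G d c"
      using n n2 lam0 lam1 large small
      by (intro pseudorandom_colouring[OF eG _ _ _ deg_graph_edges[OF E reg]]) (auto simp: graph_edges_def)
    moreover have "d \<le> k" if "colouring ?G k c" for k c
      using deg_le_colours[OF that edgesD(2)[OF eG], of 0] deg_graph_edges[OF E reg, of 0] n2 by simp
    ultimately show ?thesis
      unfolding chromatic_index_def proper_edge_colouring_iff by (intro Least_equality) auto
  qed
  then show ?thesis by blast
qed

end
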